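(* Let $n\ge1$ be an integer, $p>2$, $l\ge p/(p-1)$ and $\theta>0$, and let $$\Theta_{l,\theta}=\{(x,t)\in\mathbf{R}^{n}\times\mathbf{R}: 0<-t<\theta|x|^l<\theta\}.$$ Then $(0,0)$ is a regular boundary point for $\Theta_{l,\theta}$ with small boundary data, in the following sense: if $0<\delta\le1$ and $f:\partial\Theta_{l,\theta}\to\mathbf{R}$ satisfies $$|f(x,t)-f(0,0)|\le\frac{p-2}{p}\biggl(\frac{\delta^{\frac{p}{p-1}-l}}{np\theta}\biggr)^{1/(p-2)}\min\{|x|,\delta\}^{p/(p-1)}\quad\text{for all }(x,t)\in\partial\Theta_{l,\theta},$$ then $$\lim_{\Theta_{l,\theta}\ni\xi\to(0,0)}\underline{H}_{\Theta_{l,\theta}}f(\xi)=\lim_{\Theta_{l,\theta}\ni\xi\to(0,0)}\overline{H}_{\Theta_{l,\theta}}f(\xi)=f(0,0).$$ Moreover, there is a barrier for $\Theta_{l,\theta}$ at $(0,0)$.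
   Context: Let $n\ge1$ be an integer, $1<p<\infty$, and let $\Theta\subset\mathbf{R}^{n+1}$ be a nonempty bounded open set, with points written $(x,t)$, $x\in\mathbf{R}^n$, $t\in\mathbf{R}$. $\nabla$ and $\operatorname{div}$ are taken with respect to $x$ only, and $\partial\Theta$ is the full topological boundary. The $p$-parabolic equation is $\partial_t u-\Delta_p u=0$, where $\Delta_p u=\operatorname{div}(|\nabla u|^{p-2}\nabla u)$. Solutions: $u:\Theta\to[-\infty,\infty]$ is a (weak) solution if for every open cylinder $U_{t_1,t_2}=U\times(t_1,t_2)\Subset\Theta$ we have $u\in C([t_1,t_2];L^2(U))\cap L^p(t_1,t_2;W^{1,p}(U))$ and $$\int_{t_1}^{t_2}\int_U|\nabla u|^{p-2}\nabla u\cdot\nabla\varphi\,dx\,dt-\int_{t_1}^{t_2}\int_U u\,\frac{\partial\varphi}{\partial t}\,dx\,dt=0\quad\text{for all }\varphi\in C_0^\infty(U_{t_1,t_2}).$$ A $p$-parabolic function is a continuous solution. Superparabolic functions: $u:\Theta\to(-\infty,\infty]$ is $p$-superparabolic if (i) $u$ is lower semicontinuous; (ii) $u$ is finite in a dense subset of $\Theta$; (iii) for every space-time box $Q_{t_1,t_2}=Q\times(t_1,t_2)\Subset\Theta$, $Q=(a_1,b_1)\times\dots\times(a_n,b_n)$, and every $h$ that is $p$-parabolic in $Q_{t_1,t_2}$, continuous on $\overline{Q_{t_1,t_2}}$ and satisfies $h\le u$ on the parabolic boundary $(\overline{Q}\times\{t_1\})\cup(\partial Q\times(t_1,t_2])$,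 we have $h\le u$ in $Q_{t_1,t_2}$. A function $v:\Theta\to[-\infty,\infty)$ is $p$-subparabolic if $-v$ is $p$-superparabolic. Perron solutions: for bounded $f:\partial\Theta\to\mathbf{R}$, let $\mathcal{U}_f$ be the set of $p$-superparabolic $u$ on $\Theta$ with $\liminf_{\Theta\ni\eta\to\xi}u(\eta)\ge f(\xi)$ for all $\xi\in\partial\Theta$, and $\mathcal{L}_f$ the set of $p$-subparabolic $u$ on $\Theta$ with $\limsup_{\Theta\ni\eta\to\xi}u(\eta)\le f(\xi)$ for all $\xi\in\partial\Theta$. For $\xi\in\Theta$ set $\overline{H}_\Theta f(\xi)=\inf_{u\in\mathcal{U}_f}u(\xi)$ (upper Perron solution) and $\underline{H}_\Theta f(\xi)=\sup_{u\in\mathcal{L}_f}u(\xi)$ (lower Perron solution). Barrier: for $\xi_0\in\partial\Theta$, a positive $p$-superparabolic function $w$ in $\Theta$ is a barrier (for $\Theta$) at $\xi_0$ if $\lim_{\Theta\ni\zeta\to\xi_0}w(\zeta)=0$ and $\liminf_{\Theta\ni\zeta\to\xi}w(\zeta)>0$ for all $\xi\in\partial\Theta\setminus\{\xi_0\}$. *)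

theory Defs
  imports "HOL-Analysis.Analysis"
begin

text \<open>
  Points \<open>(x, t)\<close> of \<open>\<real>\<^sup>n \<times> \<real>\<close> are elements of \<^typ>\<open>(real ^ 'n) \<times> real\<close>, so \<open>n = CARD('n)\<close>.
  A function given on a set \<open>\<Theta>\<close> is a total function of which only the values on \<open>\<Theta>\<close> are used.
\<close>


subsection \<open>Test functions\<close>

primrec C_k :: "nat \<Rightarrow> ('a::euclidean_space \<Rightarrow> real) \<Rightarrow> bool" where
  "C_k 0 f \<longleftrightarrow> continuous_on UNIV f"
| "C_k (Suc k) f \<longleftrightarrow>
     (\<forall>x. f differentiable (at x)) \<and>
     (\<forall>b\<in>Basis. C_k k (\<lambda>x. frechet_derivative f (at x) b))"

definition compactly_contained :: "'a::topological_space set \<Rightarrow> 'a set \<Rightarrow> bool"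
    (infix "\<Subset>" 50) where
  "A \<Subset> B \<longleftrightarrow> compact (closure A) \<and> closure A \<subseteq> B"

text \<open>\<open>C\<^sub>0\<^sup>\<infinity>(U)\<close>, its elements being extended by zero outside \<open>U\<close>.\<close>

definition test_functions :: "'a::euclidean_space set \<Rightarrow> ('a \<Rightarrow> real) set" where
  "test_functions U = {\<phi>. (\<forall>k. C_k k \<phi>) \<and> {x. \<phi> x \<noteq> 0} \<Subset> U}"

definition grad :: "(real ^ 'n \<Rightarrow> real) \<Rightarrow> real ^ 'n \<Rightarrow> real ^ 'n" where
  "grad \<phi> x = (\<chi> i. frechet_derivative \<phi> (at x) (axis i 1))"

definition grad_x :: "((real ^ 'n) \<times> real \<Rightarrow> real) \<Rightarrow> (real ^ 'n) \<times> real \<Rightarrow> real ^ 'n" where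
  "grad_x \<phi> z = (\<chi> i. frechet_derivative \<phi> (at z) (axis i 1, 0))"

definition deriv_t :: "((real ^ 'n) \<times> real \<Rightarrow> real) \<Rightarrow> (real ^ 'n) \<times> real \<Rightarrow> real" where
  "deriv_t \<phi> z = frechet_derivative \<phi> (at z) (0, 1)"


subsection \<open>Function spaces\<close>

definition Lp :: "real \<Rightarrow> 'a::euclidean_space set \<Rightarrow> ('a \<Rightarrow> 'b::euclidean_space) set" where
  "Lp p A = {f \<in> borel_measurable (lebesgue_on A).
               integrable (lebesgue_on A) (\<lambda>x. norm (f x) powr p)}"

definition Lp_norm :: "real \<Rightarrow> 'a::euclidean_space set \<Rightarrow> ('a \<Rightarrow> 'b::euclidean_space) \<Rightarrow> real" where
  "Lp_norm p A f = (\<integral>x. norm (f x) powr p \<partial>lebesgue_on A) powr (1 / p)"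

text \<open>\<open>W1p_grad p U f g\<close>: \<open>f \<in> W\<^sup>1\<^sup>,\<^sup>p(U)\<close> and \<open>g\<close> is (a representative of) its distributional gradient.\<close>

definition W1p_grad ::
    "real \<Rightarrow> (real ^ 'n) set \<Rightarrow> (real ^ 'n \<Rightarrow> real) \<Rightarrow> (real ^ 'n \<Rightarrow> real ^ 'n) \<Rightarrow> bool" where
  "W1p_grad p U f g \<longleftrightarrow>
     f \<in> Lp p U \<and> g \<in> Lp p U \<and>
     (\<forall>\<phi>\<in>test_functions U.
        (\<integral>x. f x *\<^sub>R grad \<phi> x \<partial>lebesgue_on U) = - (\<integral>x. \<phi> x *\<^sub>R g x \<partial>lebesgue_on U))"

text \<open>\<open>u \<in> L\<^sup>p(t1, t2; W\<^sup>1\<^sup>,\<^sup>p(U))\<close> with spatial gradient \<open>G\<close>: both are jointly measurable and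
  \<open>p\<close>-integrable on the cylinder, and almost every time slice lies in \<open>W\<^sup>1\<^sup>,\<^sup>p(U)\<close>.\<close>

definition LpW1p_grad ::
    "real \<Rightarrow> (real ^ 'n) set \<Rightarrow> real \<Rightarrow> real \<Rightarrow> ((real ^ 'n) \<times> real \<Rightarrow> real) \<Rightarrow>
     ((real ^ 'n) \<times> real \<Rightarrow> real ^ 'n) \<Rightarrow> bool" where
  "LpW1p_grad p U t1 t2 u G \<longleftrightarrow>
     u \<in> Lp p (U \<times> {t1<..<t2}) \<and> G \<in> Lp p (U \<times> {t1<..<t2}) \<and>
     (AE t in lebesgue_on {t1<..<t2}. W1p_grad p U (\<lambda>x. u (x, t)) (\<lambda>x. G (x, t)))"

text \<open>\<open>u \<in> C([t1, t2]; L\<^sup>2(U))\<close>\<close>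

definition CL2 ::
    "(real ^ 'n) set \<Rightarrow> real \<Rightarrow> real \<Rightarrow> ((real ^ 'n) \<times> real \<Rightarrow> real) \<Rightarrow> bool" where
  "CL2 U t1 t2 u \<longleftrightarrow>
     (\<forall>t\<in>{t1..t2}. (\<lambda>x. u (x, t)) \<in> Lp 2 U \<and>
        ((\<lambda>s. Lp_norm 2 U (\<lambda>x. u (x, s) - u (x, t))) \<longlongrightarrow> 0) (at t within {t1..t2}))"


subsection \<open>The \<open>p\<close>-parabolic equation\<close>

text \<open>
  Membership of an extended real-valued \<open>u\<close> in the function spaces means that \<open>u\<close> is finite almost
  everywhere and that its finite part lies in the space.  The spatial gradient \<open>G\<close> is unique up to
  null sets, so its existential quantification is harmless.  For \<open>p < 2\<close> the factor
  \<open>norm (G z) powr (p - 2) *\<^sub>R G z\<close> is 0 where \<open>G z = 0\<close>, which is the usual convention.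
\<close>

definition weak_solution ::
    "real \<Rightarrow> ((real ^ 'n) \<times> real) set \<Rightarrow> ((real ^ 'n) \<times> real \<Rightarrow> ereal) \<Rightarrow> bool" where
  "weak_solution p \<Theta> u \<longleftrightarrow>
     (\<forall>U t1 t2. open U \<longrightarrow> t1 < t2 \<longrightarrow> U \<times> {t1<..<t2} \<Subset> \<Theta> \<longrightarrow>
        (let v = (\<lambda>z. real_of_ereal (u z)); C = U \<times> {t1<..<t2} in
          (\<forall>t\<in>{t1..t2}. AE x in lebesgue_on U. \<bar>u (x, t)\<bar> \<noteq> \<infinity>) \<and>
          (AE z in lebesgue_on C. \<bar>u z\<bar> \<noteq> \<infinity>) \<and>
          CL2 U t1 t2 v \<and>
          (\<exists>G. LpW1p_grad p U t1 t2 v G \<and>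
             (\<forall>\<phi>\<in>test_functions C.
                (\<integral>z. (norm (G z) powr (p - 2) *\<^sub>R G z) \<bullet> grad_x \<phi> z \<partial>lebesgue_on C)
                - (\<integral>z. v z * deriv_t \<phi> z \<partial>lebesgue_on C) = 0))))"

text \<open>Continuous solutions are understood to be finite-valued.\<close>

definition p_parabolic ::
    "real \<Rightarrow> ((real ^ 'n) \<times> real) set \<Rightarrow> ((real ^ 'n) \<times> real \<Rightarrow> real) \<Rightarrow> bool" where
  "p_parabolic p \<Theta> h \<longleftrightarrow> continuous_on \<Theta> h \<and> weak_solution p \<Theta> (\<lambda>z. ereal (h z))"

definition lower_semicontinuous_on :: "'a::topological_space set \<Rightarrow> ('a \<Rightarrow> ereal) \<Rightarrow> bool" where
  "lower_semicontinuous_on A u \<longleftrightarrow> (\<forall>z\<in>A. u z \<le> Liminf (at z within A) u)"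

definition p_superparabolic ::
    "real \<Rightarrow> ((real ^ 'n) \<times> real) set \<Rightarrow> ((real ^ 'n) \<times> real \<Rightarrow> ereal) \<Rightarrow> bool" where
  "p_superparabolic p \<Theta> u \<longleftrightarrow>
     (\<forall>z\<in>\<Theta>. u z \<noteq> -\<infinity>) \<and>
     lower_semicontinuous_on \<Theta> u \<and>
     \<Theta> \<subseteq> closure {z \<in> \<Theta>. \<bar>u z\<bar> \<noteq> \<infinity>} \<and>
     (\<forall>a b t1 t2 h. (\<forall>i. a $ i < b $ i) \<longrightarrow> t1 < t2 \<longrightarrow>
        (let Q = box a b; QT = Q \<times> {t1<..<t2} in
          QT \<Subset> \<Theta> \<longrightarrow> p_parabolic p QT h \<longrightarrow> continuous_on (closure QT) h \<longrightarrow>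
          (\<forall>z \<in> closure Q \<times> {t1} \<union> frontier Q \<times> {t1<..t2}. ereal (h z) \<le> u z) \<longrightarrow>
          (\<forall>z\<in>QT. ereal (h z) \<le> u z)))"

definition p_subparabolic ::
    "real \<Rightarrow> ((real ^ 'n) \<times> real) set \<Rightarrow> ((real ^ 'n) \<times> real \<Rightarrow> ereal) \<Rightarrow> bool" where
  "p_subparabolic p \<Theta> v \<longleftrightarrow> p_superparabolic p \<Theta> (\<lambda>z. - v z)"


subsection \<open>Perron solutions and barriers\<close>

definition upper_class ::
    "real \<Rightarrow> ((real ^ 'n) \<times> real) set \<Rightarrow> ((real ^ 'n) \<times> real \<Rightarrow> real) \<Rightarrow>
     ((real ^ 'n) \<times> real \<Rightarrow> ereal) set" where
  "upper_class p \<Theta> f =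
     {u. p_superparabolic p \<Theta> u \<and> (\<forall>\<xi>\<in>frontier \<Theta>. Liminf (at \<xi> within \<Theta>) u \<ge> ereal (f \<xi>))}"

definition lower_class ::
    "real \<Rightarrow> ((real ^ 'n) \<times> real) set \<Rightarrow> ((real ^ 'n) \<times> real \<Rightarrow> real) \<Rightarrow>
     ((real ^ 'n) \<times> real \<Rightarrow> ereal) set" where
  "lower_class p \<Theta> f =
     {u. p_subparabolic p \<Theta> u \<and> (\<forall>\<xi>\<in>frontier \<Theta>. Limsup (at \<xi> within \<Theta>) u \<le> ereal (f \<xi>))}"

definition upper_Perron ::
    "real \<Rightarrow> ((real ^ 'n) \<times> real) set \<Rightarrow> ((real ^ 'n) \<times> real \<Rightarrow> real) \<Rightarrow>
     (real ^ 'n) \<times> real \<Rightarrow> ereal" where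
  "upper_Perron p \<Theta> f \<xi> = (INF u\<in>upper_class p \<Theta> f. u \<xi>)"

definition lower_Perron ::
    "real \<Rightarrow> ((real ^ 'n) \<times> real) set \<Rightarrow> ((real ^ 'n) \<times> real \<Rightarrow> real) \<Rightarrow>
     (real ^ 'n) \<times> real \<Rightarrow> ereal" where
  "lower_Perron p \<Theta> f \<xi> = (SUP u\<in>lower_class p \<Theta> f. u \<xi>)"

definition is_barrier ::
    "real \<Rightarrow> ((real ^ 'n) \<times> real) set \<Rightarrow> (real ^ 'n) \<times> real \<Rightarrow>
     ((real ^ 'n) \<times> real \<Rightarrow> ereal) \<Rightarrow> bool" where
  "is_barrier p \<Theta> \<xi>0 w \<longleftrightarrow>
     \<xi>0 \<in> frontier \<Theta> \<and>
     p_superparabolic p \<Theta> w \<and> (\<forall>z\<in>\<Theta>. 0 < w z) \<and>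
     (w \<longlongrightarrow> 0) (at \<xi>0 within \<Theta>) \<and>
     (\<forall>\<xi>\<in>frontier \<Theta> - {\<xi>0}. 0 < Liminf (at \<xi> within \<Theta>) w)"

definition Theta_dom :: "real \<Rightarrow> real \<Rightarrow> ((real ^ 'n) \<times> real) set" where
  "Theta_dom l \<theta> = {(x, t). 0 < - t \<and> - t < \<theta> * norm x powr l \<and> \<theta> * norm x powr l < \<theta>}"

end

theory Submission
  imports Defs
begin

text \<open>
  The function \<open>w(x,t) = a |x|\<^bsup>p/(p-1)\<^esup> + b t\<close> with \<open>b = n (a p/(p-1))\<^bsup>p-1\<^esup>\<close> has a linear \<open>p\<close>-flux and solves the
  equation, and so does \<open>-w\<close>.  As \<open>-t < \<theta> |x|\<^sup>l\<close> in the domain, for the optimal \<open>a\<close> it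
  dominates \<open>c |x|\<^bsup>p/(p-1)\<^esup>\<close> for \<open>|x| \<le> \<delta>\<close>, where \<open>c\<close> is the constant in the smallness condition.  Hence
  \<open>min w (c \<delta>\<^bsup>p/(p-1)\<^esup>)\<close>, extended by \<open>c \<delta>\<^bsup>p/(p-1)\<^esup>\<close> to \<open>|x| \<ge> \<delta>\<close>, is a barrier \<open>u\<close>, and both
  Perron solutions lie between \<open>f(0,0) - u\<close> and \<open>f(0,0) + u\<close>.

  Two comparison results are needed.  That a weak solution stays below \<open>w\<close> follows by mollifying the solution,
  testing with the square of the positive part of the difference, and monotonicity of the \<open>p\<close>-flux.  That every
  superparabolic function of the upper class stays above \<open>f(0,0) - u\<close> follows without any existence theory: the
  function \<open>-w - \<kappa> t\<close> is strictly touched from below, at every point, by an exact solution of the same form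
  with another centre and a steeper slope, and this excludes interior minima of the difference.
\<close>

subsection \<open>Convolution and approximation in \<open>L\<^sup>1\<close>\<close>

text \<open>A superparabolic function has no weak formulation of its own: it is only known to
  dominate p-parabolic functions in boxes. Hence the two comparisons differ in kind. For a solution
  h below w, energy methods apply, but h has no time derivative to test with. After mollification in
  space and time the equation holds pointwise, at the price that the mollified flux is not the flux
  of the mollified gradient, so monotonicity is available only in the limit. Both h and w solve the
  equation, so a sign has to be produced: a term e / (t2 - t) added to w makes it a strict
  supersolution and blows up at the final time, which keeps the contact set away from the top. For a
  superparabolic v above -w, an exact solution must be placed under -w in a small box. A steeper one
  falls off strictly faster in x but also decreases faster in time; the extra -\<kappa> t pays for
  this. Both e and \<kappa> tend to 0 in the end. Changing slope and centre stays within explicit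
  solutions because the exponent p/(p-1) makes the flux linear, and strict convexity of |x|^q, q =
  p/(p-1), becomes strict touching.\<close>

lemma integrable_indicator_cball:
  "integrable lborel (indicator (cball (a::'a::euclidean_space) r) :: 'a \<Rightarrow> real)"
  by (rule integrable_real_indicator) (use emeasure_lborel_cball_finite[of a r] in auto)

lemma integrable_bounded_support:
  fixes f :: "'a::euclidean_space \<Rightarrow> real"
  assumes "f \<in> borel_measurable borel" "\<And>z. \<bar>f z\<bar> \<le> B" "\<And>z. R < norm z \<Longrightarrow> f z = 0"
  shows "integrable lborel f"
proof (rule Bochner_Integration.integrable_bound)
  show "integrable lborel (\<lambda>z. B * indicator (cball 0 R) z)"
    by (intro integrable_mult_right integrable_indicator_cball)
  have "0 \<le> B" using assms(2)[of 0] by linarith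
  then show "AE z in lborel. norm (f z) \<le> norm (B * indicator (cball 0 R) z)"
    using assms by (auto simp: indicator_def intro!: AE_I2)
qed (use assms in simp)

text \<open>Truncation in value (\<open>cl\<close>) and in space (\<open>\<theta>\<close>) changes
  \<open>u\<close> little in L^1. A measurable function is an a.e. limit of continuous functions
  \<open>F n\<close>; the same truncation applied to \<open>F n\<close> bounds all of them by a
  multiple of the indicator of one ball, so dominated convergence applies.\<close>

lemma dense_continuous_L1:
  fixes u :: "'a::euclidean_space \<Rightarrow> real"
  assumes u: "integrable lborel u" and e: "e > 0"
  obtains g R where "continuous_on UNIV g" "\<And>x. R < norm x \<Longrightarrow> g x = 0"
    "integrable lborel g" "(\<integral>x. \<bar>u x - g x\<bar> \<partial>lborel) < e"
proof -
  define \<theta> where "\<theta> M x = max 0 (min 1 (real M + 1 - norm x))" for M::nat and x::'a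
  define cl where "cl M s = max (- real M) (min (real M) s)" for M::nat and s::real
  have um [measurable]: "u \<in> borel_measurable borel" using u by auto
  have \<theta>c: "continuous_on UNIV (\<theta> M)" for M
    unfolding \<theta>_def by (intro continuous_intros)
  have \<theta>m [measurable]: "\<theta> M \<in> borel_measurable borel" for M
    using \<theta>c by (rule borel_measurable_continuous_onI)
  have [measurable]: "cl M \<in> borel_measurable borel" for M
    unfolding cl_def by (rule borel_measurable_continuous_onI) (intro continuous_intros)
  have \<theta>01: "0 \<le> \<theta> M x" "\<theta> M x \<le> 1" for M x by (auto simp: \<theta>_def)
  have clu: "\<bar>cl M s\<bar> \<le> \<bar>s\<bar>" "\<bar>cl M s\<bar> \<le> real M" for M s by (auto simp: cl_def)
  have cl\<theta>: "\<bar>cl M s * \<theta> M x\<bar> \<le> \<bar>s\<bar>" for M s x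
  proof -
    have "\<bar>cl M s\<bar> * \<bar>\<theta> M x\<bar> \<le> \<bar>s\<bar> * 1"
      by (rule mult_mono) (use clu(1)[of M s] \<theta>01[of M x] in auto)
    then show ?thesis by (simp add: abs_mult)
  qed
  have "(\<lambda>M. \<integral>x. \<bar>u x - cl M (u x) * \<theta> M x\<bar> \<partial>lborel) \<longlonglongrightarrow> (\<integral>x. 0 \<partial>(lborel::'a measure))"
  proof (rule integral_dominated_convergence[where w="\<lambda>x. 2 * \<bar>u x\<bar>"])
    show "AE x in lborel. (\<lambda>M. \<bar>u x - cl M (u x) * \<theta> M x\<bar>) \<longlonglongrightarrow> 0"
    proof (intro AE_I2 tendsto_eventually)
      fix x
      have "\<forall>M \<ge> nat \<lceil>max \<bar>u x\<bar> (norm x)\<rceil>. \<bar>u x - cl M (u x) * \<theta> M x\<bar> = 0"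
      proof (intro allI impI)
        fix M assume "M \<ge> nat \<lceil>max \<bar>u x\<bar> (norm x)\<rceil>"
        then have "real M \<ge> \<bar>u x\<bar>" "real M \<ge> norm x" by linarith+
        then show "\<bar>u x - cl M (u x) * \<theta> M x\<bar> = 0" by (auto simp: cl_def \<theta>_def)
      qed
      then show "\<forall>\<^sub>F M in sequentially. \<bar>u x - cl M (u x) * \<theta> M x\<bar> = 0"
        unfolding eventually_sequentially by blast
    qed
    show "AE x in lborel. norm \<bar>u x - cl M (u x) * \<theta> M x\<bar> \<le> 2 * \<bar>u x\<bar>" for M
    proof (intro AE_I2)
      fix x show "norm \<bar>u x - cl M (u x) * \<theta> M x\<bar> \<le> 2 * \<bar>u x\<bar>"
        using cl\<theta>[of M "u x" x] by auto
    qed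
  qed (use u in auto)
  from order_tendstoD(2)[OF this, of "e/2"]
  have "\<forall>\<^sub>F M in sequentially. (\<integral>x. \<bar>u x - cl M (u x) * \<theta> M x\<bar> \<partial>lborel) < e/2"
    using e by simp
  then obtain M where M: "(\<integral>x. \<bar>u x - cl M (u x) * \<theta> M x\<bar> \<partial>lborel) < e/2"
    unfolding eventually_sequentially by blast
  have "u measurable_on UNIV"
    by (rule lebesgue_measurable_imp_measurable_on_real)
      (use um in \<open>auto intro: measurable_completion\<close>)
  then obtain N F where N: "negligible N" and F: "\<And>n. continuous_on UNIV (F n)"
      and lim: "\<And>x. x \<notin> N \<Longrightarrow> (\<lambda>n. F n x) \<longlonglongrightarrow> u x"
    unfolding measurable_on_def by auto
  have Fm [measurable]: "F n \<in> borel_measurable borel" for n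
    using F by (rule borel_measurable_continuous_onI)
  let ?w = "\<lambda>x::'a. (2 * real M) * indicator (cball 0 (real M + 1)) x"
  have wi: "integrable lborel ?w"
    by (intro integrable_mult_right integrable_indicator_cball)
  have \<theta>ind: "\<theta> M x = 0" if "x \<notin> cball 0 (real M + 1)" for x
    using that by (auto simp: \<theta>_def)
  have "AE x in lebesgue. x \<notin> N"
    using N by (simp add: negligible_iff_null_sets AE_not_in)
  then have AEN: "AE x in lborel. x \<notin> N" by (simp add: AE_completion_iff)
  have Mb: "\<bar>cl M s * \<theta> M x\<bar> \<le> real M * indicator (cball 0 (real M + 1)) x" for s x
  proof (cases "x \<in> cball 0 (real M + 1)")
    case True
    have "\<bar>cl M s\<bar> * \<bar>\<theta> M x\<bar> \<le> real M * 1"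
      by (rule mult_mono) (use clu(2)[of M s] \<theta>01[of M x] in auto)
    then show ?thesis using True by (simp add: abs_mult)
  qed (simp add: \<theta>ind)
  have Fi: "integrable lborel (\<lambda>x. cl M (F n x) * \<theta> M x)" for n
  proof (rule Bochner_Integration.integrable_bound[OF wi])
    show "AE x in lborel. norm (cl M (F n x) * \<theta> M x) \<le> norm (?w x)"
    proof (intro AE_I2)
      fix x show "norm (cl M (F n x) * \<theta> M x) \<le> norm (?w x)"
        using Mb[of "F n x" x] by (simp add: indicator_def split: if_splits)
    qed
  qed simp
  have "(\<lambda>n. \<integral>x. \<bar>cl M (u x) * \<theta> M x - cl M (F n x) * \<theta> M x\<bar> \<partial>lborel) \<longlonglongrightarrow> (\<integral>x. 0 \<partial>(lborel::'a measure))"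
  proof (rule integral_dominated_convergence[where w="?w"])
    show "AE x in lborel. (\<lambda>n. \<bar>cl M (u x) * \<theta> M x - cl M (F n x) * \<theta> M x\<bar>) \<longlonglongrightarrow> 0"
      using AEN
    proof eventually_elim
      case (elim x)
      have "(\<lambda>n. cl M (F n x)) \<longlonglongrightarrow> cl M (u x)"
        unfolding cl_def by (intro tendsto_intros lim elim)
      then have "(\<lambda>n. \<bar>cl M (u x) * \<theta> M x - cl M (F n x) * \<theta> M x\<bar>) \<longlonglongrightarrow> \<bar>cl M (u x) * \<theta> M x - cl M (u x) * \<theta> M x\<bar>"
        by (intro tendsto_intros)
      then show ?case by simp
    qed
    show "AE x in lborel. norm \<bar>cl M (u x) * \<theta> M x - cl M (F n x) * \<theta> M x\<bar> \<le> ?w x" for n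
    proof (intro AE_I2)
      fix x show "norm \<bar>cl M (u x) * \<theta> M x - cl M (F n x) * \<theta> M x\<bar> \<le> ?w x"
        using Mb[of "u x" x] Mb[of "F n x" x] by (auto simp: algebra_simps)
    qed
  qed (use wi in auto)
  from order_tendstoD(2)[OF this, of "e/2"]
  have "\<forall>\<^sub>F n in sequentially. (\<integral>x. \<bar>cl M (u x) * \<theta> M x - cl M (F n x) * \<theta> M x\<bar> \<partial>lborel) < e/2"
    using e by simp
  then obtain n where n: "(\<integral>x. \<bar>cl M (u x) * \<theta> M x - cl M (F n x) * \<theta> M x\<bar> \<partial>lborel) < e/2"
    unfolding eventually_sequentially by blast
  have ui: "integrable lborel (\<lambda>x. cl M (u x) * \<theta> M x)"
    by (rule Bochner_Integration.integrable_bound[OF u]) (use cl\<theta> in auto)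
  have "(\<integral>x. \<bar>u x - cl M (F n x) * \<theta> M x\<bar> \<partial>lborel)
      \<le> (\<integral>x. \<bar>u x - cl M (u x) * \<theta> M x\<bar> + \<bar>cl M (u x) * \<theta> M x - cl M (F n x) * \<theta> M x\<bar> \<partial>lborel)"
    by (rule integral_mono) (use u ui Fi in auto)
  also have "\<dots> = (\<integral>x. \<bar>u x - cl M (u x) * \<theta> M x\<bar> \<partial>lborel) + (\<integral>x. \<bar>cl M (u x) * \<theta> M x - cl M (F n x) * \<theta> M x\<bar> \<partial>lborel)"
    by (rule Bochner_Integration.integral_add) (use u ui Fi in auto)
  also have "\<dots> < e" using M n by linarith
  finally have L: "(\<integral>x. \<bar>u x - cl M (F n x) * \<theta> M x\<bar> \<partial>lborel) < e" .
  show ?thesis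
  proof (rule that[of "\<lambda>x. cl M (F n x) * \<theta> M x" "real M + 1"])
    show "continuous_on UNIV (\<lambda>x. cl M (F n x) * \<theta> M x)"
      unfolding cl_def using F \<theta>c by (intro continuous_intros)
  qed (use L Fi \<theta>ind in auto)
qed

definition conv :: "('a::euclidean_space \<Rightarrow> real) \<Rightarrow> ('a \<Rightarrow> real) \<Rightarrow> 'a \<Rightarrow> real" where
  "conv \<eta> u z = (\<integral>y. \<eta> (z - y) * u y \<partial>lborel)"

lemma lborel_integral_shift:
  fixes f :: "'a::euclidean_space \<Rightarrow> real"
  assumes [measurable]: "f \<in> borel_measurable borel"
  shows "(\<integral>x. f (x + c) \<partial>lborel) = (\<integral>x. f x \<partial>lborel)"
proof -
  have "(\<integral>x. f x \<partial>lborel) = (\<integral>x. f x \<partial>distr lborel borel ((+) c))" by (simp add: lborel_distr_plus)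
  also have "\<dots> = (\<integral>x. f (c + x) \<partial>lborel)" by (rule integral_distr) auto
  finally show ?thesis by (simp add: add.commute)
qed

lemma lborel_integrable_shift:
  fixes f :: "'a::euclidean_space \<Rightarrow> real"
  assumes "integrable lborel f"
  shows "integrable lborel (\<lambda>x. f (x + c))"
proof -
  have "integrable (distr lborel borel ((+) c)) f" using assms by (simp add: lborel_distr_plus)
  then have "integrable lborel (\<lambda>x. f (c + x))" by (rule integrable_distr[rotated]) auto
  then show ?thesis by (simp add: add.commute)
qed

lemma lborel_distr_minus: "distr lborel borel (\<lambda>y. c - y) = (lborel :: 'a::euclidean_space measure)"
proof -
  have "(lborel :: 'a measure) = density (distr lborel borel (\<lambda>y. c + (-1) *\<^sub>R y)) (\<lambda>_. ennreal (\<bar>-1\<bar> ^ DIM('a)))"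
    by (rule lborel_affine) simp
  also have "\<dots> = distr lborel borel (\<lambda>y. c - y)" by (simp add: density_1)
  finally show ?thesis by (rule sym)
qed

lemma lborel_integral_reflect:
  fixes f :: "'a::euclidean_space \<Rightarrow> real"
  assumes [measurable]: "f \<in> borel_measurable borel"
  shows "(\<integral>y. f (c - y) \<partial>lborel) = (\<integral>x. f x \<partial>lborel)"
proof -
  have "(\<integral>x. f x \<partial>lborel) = (\<integral>x. f x \<partial>distr lborel borel (\<lambda>y. c - y))" by (simp add: lborel_distr_minus)
  also have "\<dots> = (\<integral>x. f (c - x) \<partial>lborel)" by (rule integral_distr) auto
  finally show ?thesis by simp
qed

lemma lborel_nn_integral_shift:
  fixes f :: "'a::euclidean_space \<Rightarrow> ennreal"
  assumes [measurable]: "f \<in> borel_measurable borel"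
  shows "(\<integral>\<^sup>+x. f (x - c) \<partial>lborel) = (\<integral>\<^sup>+x. f x \<partial>lborel)"
proof -
  have "(\<integral>\<^sup>+x. f x \<partial>lborel) = (\<integral>\<^sup>+x. f x \<partial>distr lborel borel ((+) (-c)))" by (simp add: lborel_distr_plus)
  also have "\<dots> = (\<integral>\<^sup>+x. f (-c + x) \<partial>lborel)" by (rule nn_integral_distr) auto
  finally show ?thesis by simp
qed

lemma integrable_conv_kernel:
  fixes \<eta> u :: "'a::euclidean_space \<Rightarrow> real"
  assumes u: "integrable lborel u" and [measurable]: "\<eta> \<in> borel_measurable borel" and B: "\<And>z. \<bar>\<eta> z\<bar> \<le> B"
  shows "integrable lborel (\<lambda>y. \<eta> (z - y) * u y)"
proof (rule Bochner_Integration.integrable_bound)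
  show "integrable lborel (\<lambda>y. B * u y)" using u by simp
  have "0 \<le> B" using B[of 0] by linarith
  then show "AE y in lborel. norm (\<eta> (z - y) * u y) \<le> norm (B * u y)"
    by (intro AE_I2) (auto simp: abs_mult intro!: mult_right_mono B)
qed (use u in auto)

lemma continuous_bounded_support:
  fixes f :: "'a::euclidean_space \<Rightarrow> real"
  assumes "continuous_on UNIV f" "\<And>z. r < norm z \<Longrightarrow> f z = 0"
  shows "\<exists>B. \<forall>z. \<bar>f z\<bar> \<le> B"
proof -
  have "compact (f ` cball 0 r)"
    by (rule compact_continuous_image) (use assms in \<open>auto intro: continuous_on_subset\<close>)
  from compact_imp_bounded[OF this] obtain B where "\<forall>y\<in>f ` cball 0 r. norm y \<le> B"
    unfolding bounded_iff ..
  then have B: "\<And>x. x \<in> cball 0 r \<Longrightarrow> norm (f x) \<le> B" by blast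
  have "\<bar>f z\<bar> \<le> max B 0" for z
    using B[of z] assms(2)[of z] by (cases "z \<in> cball 0 r") (force simp: max_def)+
  then show ?thesis by blast
qed

definition mollifier :: "real \<Rightarrow> ('a::euclidean_space \<Rightarrow> real) \<Rightarrow> bool" where
  "mollifier r \<eta> \<longleftrightarrow> (\<forall>k. C_k k \<eta>) \<and> (\<forall>z. 0 \<le> \<eta> z) \<and> (\<forall>z. r \<le> norm z \<longrightarrow> \<eta> z = 0) \<and>
     integrable lborel \<eta> \<and> (\<integral>z. \<eta> z \<partial>lborel) = 1"

lemma mollifierD:
  assumes "mollifier r \<eta>"
  shows "C_k k \<eta>" "0 \<le> \<eta> z" "r \<le> norm z \<Longrightarrow> \<eta> z = 0" "integrable lborel \<eta>" "(\<integral>z. \<eta> z \<partial>lborel) = 1"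
    "continuous_on UNIV \<eta>" "\<eta> \<in> borel_measurable borel" "\<exists>B. \<forall>z. \<bar>\<eta> z\<bar> \<le> B"
proof -
  show c: "C_k k \<eta>" "0 \<le> \<eta> z" "r \<le> norm z \<Longrightarrow> \<eta> z = 0" "integrable lborel \<eta>" "(\<integral>z. \<eta> z \<partial>lborel) = 1" for k z
    using assms by (auto simp: mollifier_def)
  show cc: "continuous_on UNIV \<eta>" using c(1)[of 0] by simp
  then show "\<eta> \<in> borel_measurable borel" by (rule borel_measurable_continuous_onI)
  show "\<exists>B. \<forall>z. \<bar>\<eta> z\<bar> \<le> B"
    by (rule continuous_bounded_support[OF cc, of r]) (simp add: c(3))
qed

lemma mollifier_integral_reflect:
  assumes "mollifier r \<eta>"
  shows "(\<integral>y. \<eta> (z - y) \<partial>lborel) = 1" "integrable lborel (\<lambda>y. \<eta> (z - y))"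
proof -
  show 1: "(\<integral>y. \<eta> (z - y) \<partial>lborel) = 1"
    using lborel_integral_reflect[of \<eta> z] mollifierD[OF assms] by simp
  \<comment> \<open>A non-integrable function has Bochner integral 0, so the value 1 forces
    integrability.\<close>
  show "integrable lborel (\<lambda>y. \<eta> (z - y))"
    by (rule ccontr) (use 1 not_integrable_integral_eq in force)
qed

lemma integrable_mollifier_kernel:
  assumes "mollifier r \<eta>" "integrable lborel u"
  shows "integrable lborel (\<lambda>y. \<eta> (z - y) * u y)"
proof -
  obtain B where "\<And>z. \<bar>\<eta> z\<bar> \<le> B" using mollifierD(8)[OF assms(1)] by blast
  then show ?thesis using integrable_conv_kernel[OF assms(2) mollifierD(7)[OF assms(1)]] by blast
qed

text \<open>\<open>conv \<eta> u z\<close> is an average of \<open>u\<close> over the ball of radius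
  \<open>r\<close> around \<open>z\<close>. The oscillation bound is therefore local, which lets it
  be applied to functions that jump elsewhere, such as a solution cut off outside a
  cylinder.\<close>

lemma conv_close:
  assumes m: "mollifier r \<eta>" and u: "integrable lborel u"
    and e: "\<And>y. dist y z < r \<Longrightarrow> \<bar>u y - u z\<bar> \<le> e"
  shows "\<bar>conv \<eta> u z - u z\<bar> \<le> e"
proof -
  note i1 = integrable_mollifier_kernel[OF m u, of z]
  note i2 = mollifier_integral_reflect[OF m, of z]
  have "conv \<eta> u z - u z = (\<integral>y. \<eta> (z - y) * u y \<partial>lborel) - (\<integral>y. \<eta> (z - y) * u z \<partial>lborel)"
    using i2 by (simp add: conv_def)
  also have "\<dots> = (\<integral>y. \<eta> (z - y) * u y - \<eta> (z - y) * u z \<partial>lborel)"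
    using i1 i2 by simp
  finally have eq: "conv \<eta> u z - u z = (\<integral>y. \<eta> (z - y) * u y - \<eta> (z - y) * u z \<partial>lborel)" .
  have "norm (\<integral>y. \<eta> (z - y) * u y - \<eta> (z - y) * u z \<partial>lborel) \<le> (\<integral>y. \<eta> (z - y) * e \<partial>lborel)"
  proof (rule Bochner_Integration.integral_norm_bound_integral)
    show "norm (\<eta> (z - y) * u y - \<eta> (z - y) * u z) \<le> \<eta> (z - y) * e" for y
    proof (cases "dist y z < r")
      case True
      have "norm (\<eta> (z - y) * u y - \<eta> (z - y) * u z) = \<eta> (z - y) * \<bar>u y - u z\<bar>"
        using mollifierD(2)[OF m, of "z - y"] by (simp add: abs_mult flip: right_diff_distrib)
      also have "\<dots> \<le> \<eta> (z - y) * e" using e[OF True] mollifierD(2)[OF m] by (intro mult_left_mono)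
      finally show ?thesis .
    next
      case False
      then have "\<eta> (z - y) = 0" using mollifierD(3)[OF m, of "z - y"] by (simp add: dist_norm norm_minus_commute)
      then show ?thesis by simp
    qed
  qed (use i1 i2 in auto)
  then show ?thesis unfolding eq using i2 by simp
qed

lemma conv_measurable:
  assumes [measurable]: "\<eta> \<in> borel_measurable borel" "u \<in> borel_measurable borel"
  shows "conv \<eta> u \<in> borel_measurable borel"
proof -
  have "(\<lambda>z. \<integral>y. \<eta> (z - y) * u y \<partial>lborel) \<in> borel_measurable lborel"
    by measurable
  then show ?thesis unfolding conv_def by simp
qed

text \<open>Tonelli and translation invariance: every point of \<open>u\<close> is spread with total
  mass 1.\<close>

lemma conv_L1_bound:
  assumes m: "mollifier r \<eta>" and u: "integrable lborel u"
  shows "integrable lborel (conv \<eta> u)" "(\<integral>z. \<bar>conv \<eta> u z\<bar> \<partial>lborel) \<le> (\<integral>z. \<bar>u z\<bar> \<partial>lborel)"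
proof -
  have [measurable]: "u \<in> borel_measurable borel" using u by auto
  note [measurable] = mollifierD(7)[OF m]
  have cm [measurable]: "conv \<eta> u \<in> borel_measurable borel" by (rule conv_measurable) measurable
  have \<eta>0: "0 \<le> \<eta> z" for z using mollifierD(2)[OF m] .
  have "(\<integral>\<^sup>+z. ennreal (norm (conv \<eta> u z)) \<partial>lborel)
      \<le> (\<integral>\<^sup>+z. (\<integral>\<^sup>+y. ennreal (\<eta> (z - y)) * ennreal \<bar>u y\<bar> \<partial>lborel) \<partial>lborel)"
  proof (rule nn_integral_mono)
    fix z
    have "norm (conv \<eta> u z) \<le> (\<integral>y. norm (\<eta> (z - y) * u y) \<partial>lborel)"
      unfolding conv_def by (rule integral_norm_bound)
    then have "ennreal (norm (conv \<eta> u z)) \<le> ennreal (\<integral>y. norm (\<eta> (z - y) * u y) \<partial>lborel)"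
      by (rule ennreal_leI)
    also have "\<dots> = (\<integral>\<^sup>+y. ennreal (norm (\<eta> (z - y) * u y)) \<partial>lborel)"
      by (rule nn_integral_eq_integral[symmetric])
        (use integrable_mollifier_kernel[OF m u, of z] in auto)
    also have "\<dots> = (\<integral>\<^sup>+y. ennreal (\<eta> (z - y)) * ennreal \<bar>u y\<bar> \<partial>lborel)"
      by (intro nn_integral_cong) (simp add: abs_mult \<eta>0 ennreal_mult)
    finally show "ennreal (norm (conv \<eta> u z)) \<le> (\<integral>\<^sup>+y. ennreal (\<eta> (z - y)) * ennreal \<bar>u y\<bar> \<partial>lborel)" .
  qed
  also have "\<dots> = (\<integral>\<^sup>+y. (\<integral>\<^sup>+z. ennreal (\<eta> (z - y)) * ennreal \<bar>u y\<bar> \<partial>lborel) \<partial>lborel)"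
    by (rule lborel_pair.Fubini') measurable
  also have "\<dots> = (\<integral>\<^sup>+y. ennreal \<bar>u y\<bar> \<partial>lborel)"
  proof (rule nn_integral_cong)
    fix y :: 'a
    have "(\<integral>\<^sup>+z. ennreal (\<eta> (z - y)) * ennreal \<bar>u y\<bar> \<partial>lborel) = (\<integral>\<^sup>+z. ennreal (\<eta> (z - y)) \<partial>lborel) * ennreal \<bar>u y\<bar>"
      by (rule nn_integral_multc) measurable
    also have "(\<integral>\<^sup>+z. ennreal (\<eta> (z - y)) \<partial>lborel) = (\<integral>\<^sup>+z. ennreal (\<eta> z) \<partial>lborel)"
      by (rule lborel_nn_integral_shift) measurable
    also have "\<dots> = ennreal (\<integral>z. \<eta> z \<partial>lborel)"
      by (rule nn_integral_eq_integral) (use mollifierD[OF m] in auto)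
    finally show "(\<integral>\<^sup>+z. ennreal (\<eta> (z - y)) * ennreal \<bar>u y\<bar> \<partial>lborel) = ennreal \<bar>u y\<bar>"
      using mollifierD(5)[OF m] by simp
  qed
  also have "\<dots> = ennreal (\<integral>y. \<bar>u y\<bar> \<partial>lborel)"
    by (rule nn_integral_eq_integral) (use u in auto)
  finally have le: "(\<integral>\<^sup>+z. ennreal (norm (conv \<eta> u z)) \<partial>lborel) \<le> ennreal (\<integral>y. \<bar>u y\<bar> \<partial>lborel)" .
  show i: "integrable lborel (conv \<eta> u)"
    by (rule integrableI_bounded) (use le_less_trans[OF le ennreal_less_top] in auto)
  have "(\<integral>\<^sup>+z. ennreal (norm (conv \<eta> u z)) \<partial>lborel) = ennreal (\<integral>z. \<bar>conv \<eta> u z\<bar> \<partial>lborel)"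
    by (subst nn_integral_eq_integral) (use i in auto)
  with le show "(\<integral>z. \<bar>conv \<eta> u z\<bar> \<partial>lborel) \<le> (\<integral>z. \<bar>u z\<bar> \<partial>lborel)"
    by (simp add: ennreal_le_iff)
qed

lemma conv_diff:
  assumes m: "mollifier r \<eta>" and u: "integrable lborel u" "integrable lborel v"
  shows "conv \<eta> (\<lambda>y. u y - v y) z = conv \<eta> u z - conv \<eta> v z"
  unfolding conv_def right_diff_distrib
  by (rule Bochner_Integration.integral_diff) (use integrable_mollifier_kernel[OF m] u in auto)

text \<open>Approximate \<open>u\<close> by a continuous \<open>g\<close> of bounded support.
  Convolution is an L^1 contraction, so only \<open>g\<close> has to be followed through the limit,
  and there uniform continuity suffices.\<close>

lemma conv_L1_tendsto:
  fixes u :: "'a::euclidean_space \<Rightarrow> real"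
  assumes u: "integrable lborel u" and m: "\<And>j. mollifier (r j) (\<eta> j)" and r: "r \<longlonglongrightarrow> 0"
  shows "(\<lambda>j. \<integral>z. \<bar>conv (\<eta> j) u z - u z\<bar> \<partial>lborel) \<longlonglongrightarrow> 0"
proof (rule LIMSEQ_I)
  fix e :: real assume e: "e > 0"
  obtain g R where g: "continuous_on UNIV g" "\<And>x. R < norm x \<Longrightarrow> g x = 0"
    "integrable lborel g" "(\<integral>x. \<bar>u x - g x\<bar> \<partial>lborel) < e / 3"
    using dense_continuous_L1[OF u, of "e/3"] e by auto
  let ?K = "cball 0 (\<bar>R\<bar> + 2) :: 'a set"
  define c where "c = measure lborel (cball (0::'a) (\<bar>R\<bar> + 1))"
  have c0: "c \<ge> 0" unfolding c_def by (rule measure_nonneg)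
  \<comment> \<open>For \<open>r j < 1\<close> the difference of \<open>g\<close> and its
    mollification lives on a ball of volume \<open>c\<close>, so the uniform error \<open>e'\<close>
    costs less than \<open>e / 3\<close> in L^1. The \<open>+ 1\<close> avoids division by
    0.\<close>
  define e' where "e' = e / (4 * (c + 1))"
  have "4 * (c + 1) > 0" using c0 by (simp add: add_nonneg_pos)
  then have e': "e' > 0" using e unfolding e'_def by (rule divide_pos_pos[rotated])
  have e'c: "e' * c < e / 3"
  proof -
    have "e' * c \<le> e' * (c + 1)" using e' by simp
    also have "\<dots> = e / 4" using c0 by (simp add: e'_def field_simps)
    also have "\<dots> < e / 3" using e by simp
    finally show ?thesis .
  qed
  have "uniformly_continuous_on ?K g"
    by (rule compact_uniformly_continuous) (use g in \<open>auto intro: continuous_on_subset\<close>)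
  then obtain d where d: "d > 0" "\<And>x y. x \<in> ?K \<Longrightarrow> y \<in> ?K \<Longrightarrow> dist y x < d \<Longrightarrow> dist (g y) (g x) < e'"
    unfolding uniformly_continuous_on_def using e' by meson
  have "\<forall>\<^sub>F j in sequentially. r j < min d 1"
    by (rule order_tendstoD(2)[OF r]) (use d in simp)
  then obtain j0 where j0: "\<And>j. j \<ge> j0 \<Longrightarrow> r j < min d 1"
    unfolding eventually_sequentially by blast
  show "\<exists>no. \<forall>n\<ge>no. norm ((\<integral>z. \<bar>conv (\<eta> n) u z - u z\<bar> \<partial>lborel) - 0) < e"
  proof (intro exI allI impI)
    fix j assume "j \<ge> j0"
    then have rj: "r j < d" "r j < 1" using j0 by auto
    have close: "\<bar>conv (\<eta> j) g z - g z\<bar> \<le> e' * indicator (cball 0 (\<bar>R\<bar> + 1)) z" for z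
    proof (cases "z \<in> cball 0 (\<bar>R\<bar> + 1)")
      case True
      have "\<bar>conv (\<eta> j) g z - g z\<bar> \<le> e'"
      proof (rule conv_close[OF m g(3)])
        fix y assume y: "dist y z < r j"
        have "norm y \<le> norm z + dist y z" using norm_triangle_sub[of y z] by (simp add: dist_norm)
        then have "y \<in> ?K" using True y rj by auto
        moreover have "z \<in> ?K" using True by auto
        ultimately show "\<bar>g y - g z\<bar> \<le> e'" using d(2)[of z y] y rj by (auto simp: dist_real_def)
      qed
      then show ?thesis using True by simp
    next
      case False
      have "\<bar>conv (\<eta> j) g z - g z\<bar> \<le> 0"
      proof (rule conv_close[OF m g(3)])
        fix y assume y: "dist y z < r j"
        have "norm z \<le> norm y + dist y z" using norm_triangle_sub[of z y] by (simp add: dist_norm norm_minus_commute)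
        then have "R < norm y" "R < norm z" using False y rj by auto
        then show "\<bar>g y - g z\<bar> \<le> 0" using g(2) by simp
      qed
      then show ?thesis using False by simp
    qed
    have ci: "integrable lborel (conv (\<eta> j) g)" "integrable lborel (conv (\<eta> j) u)"
      "integrable lborel (conv (\<eta> j) (\<lambda>y. u y - g y))"
      using conv_L1_bound(1)[OF m] u g(3) by auto
    have "(\<integral>z. \<bar>conv (\<eta> j) u z - u z\<bar> \<partial>lborel)
       \<le> (\<integral>z. \<bar>conv (\<eta> j) (\<lambda>y. u y - g y) z\<bar> + (\<bar>conv (\<eta> j) g z - g z\<bar> + \<bar>u z - g z\<bar>) \<partial>lborel)"
    proof (rule integral_mono)
      fix z show "\<bar>conv (\<eta> j) u z - u z\<bar> \<le> \<bar>conv (\<eta> j) (\<lambda>y. u y - g y) z\<bar> + (\<bar>conv (\<eta> j) g z - g z\<bar> + \<bar>u z - g z\<bar>)"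
        using conv_diff[OF m u g(3), of j z] by linarith
    qed (use ci u g(3) in auto)
    also have "\<dots> = (\<integral>z. \<bar>conv (\<eta> j) (\<lambda>y. u y - g y) z\<bar> \<partial>lborel) + ((\<integral>z. \<bar>conv (\<eta> j) g z - g z\<bar> \<partial>lborel) + (\<integral>z. \<bar>u z - g z\<bar> \<partial>lborel))"
      using ci u g(3) by simp
    also have "(\<integral>z. \<bar>conv (\<eta> j) (\<lambda>y. u y - g y) z\<bar> \<partial>lborel) \<le> (\<integral>z. \<bar>u z - g z\<bar> \<partial>lborel)"
      by (rule conv_L1_bound(2)[OF m]) (use u g(3) in auto)
    also have "(\<integral>z. \<bar>conv (\<eta> j) g z - g z\<bar> \<partial>lborel) \<le> (\<integral>z. e' * indicator (cball 0 (\<bar>R\<bar> + 1)) z \<partial>(lborel::'a measure))"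
      by (rule integral_mono)
        (use ci g(3) close in \<open>auto intro!: integrable_indicator_cball\<close>)
    also have "(\<integral>z. e' * indicator (cball 0 (\<bar>R\<bar> + 1)) z \<partial>(lborel::'a measure)) = e' * c"
      by (simp add: c_def)
    finally have "(\<integral>z. \<bar>conv (\<eta> j) u z - u z\<bar> \<partial>lborel) < e" using e'c g(4) by linarith
    moreover have "0 \<le> (\<integral>z. \<bar>conv (\<eta> j) u z - u z\<bar> \<partial>lborel)" by simp
    ultimately show "norm ((\<integral>z. \<bar>conv (\<eta> j) u z - u z\<bar> \<partial>lborel) - 0) < e" by simp
  qed
qed

subsection \<open>Directional derivatives\<close>

text \<open>A derivative along a single direction: integration by parts uses one direction at a
  time, so convolutions and their products are handled without total differentiability.\<close>

definition has_dderiv :: "('a::euclidean_space \<Rightarrow> real) \<Rightarrow> real \<Rightarrow> 'a \<Rightarrow> 'a \<Rightarrow> bool" where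
  "has_dderiv f d e z \<longleftrightarrow> ((\<lambda>s. f (z + s *\<^sub>R e)) has_real_derivative d) (at 0)"

lemma has_dderiv_line:
  assumes "has_dderiv f d e (z + s *\<^sub>R e)"
  shows "((\<lambda>s. f (z + s *\<^sub>R e)) has_real_derivative d) (at s)"
proof -
  have "((\<lambda>t. f (z + (t + s) *\<^sub>R e)) has_real_derivative d) (at 0)"
    using assms unfolding has_dderiv_def by (simp add: scaleR_add_left add.commute add.left_commute)
  then show ?thesis using DERIV_shift[of "\<lambda>s. f (z + s *\<^sub>R e)" d 0 s] by simp
qed

lemma has_dderiv_lipschitz:
  assumes "\<And>z. has_dderiv f (f' z) e z" "\<And>z. \<bar>f' z\<bar> \<le> L"
  shows "\<bar>f (z + s *\<^sub>R e) - f z\<bar> \<le> L * \<bar>s\<bar>"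
proof -
  have "norm ((\<lambda>s. f (z + s *\<^sub>R e)) s - (\<lambda>s. f (z + s *\<^sub>R e)) 0) \<le> L * norm (s - 0)"
  proof (rule field_differentiable_bound[where S=UNIV and f'="\<lambda>s. f' (z + s *\<^sub>R e)"])
    show "((\<lambda>s. f (z + s *\<^sub>R e)) has_real_derivative f' (z + s *\<^sub>R e)) (at s within UNIV)" for s
      using has_dderiv_line[OF assms(1)] by simp
  qed (use assms in auto)
  then show ?thesis by simp
qed

lemma has_derivative_imp_dderiv:
  assumes "(f has_derivative D) (at z)"
  shows "has_dderiv f (D e) e z"
proof -
  interpret D: bounded_linear D using assms by (rule has_derivative_bounded_linear)
  have 1: "((\<lambda>s. z + s *\<^sub>R e) has_derivative (\<lambda>s. s *\<^sub>R e)) (at (0::real))"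
    by (auto intro!: derivative_eq_intros)
  have "(f has_derivative D) (at (z + 0 *\<^sub>R e))" using assms by simp
  from has_derivative_compose[OF 1 this]
  have "((\<lambda>s. f (z + s *\<^sub>R e)) has_derivative (\<lambda>s. s * D e)) (at 0)" by (simp add: D.scaleR)
  moreover have "(\<lambda>s. s * D e) = (*) (D e)" by (simp add: fun_eq_iff mult.commute)
  ultimately show ?thesis unfolding has_dderiv_def has_field_derivative_def by simp
qed

text \<open>Integration by parts: by translation invariance the integral of every difference quotient vanishes.\<close>

lemma integral_dderiv_eq_0:
  fixes f :: "'a::euclidean_space \<Rightarrow> real"
  assumes [measurable]: "f \<in> borel_measurable borel" "f' \<in> borel_measurable borel"
    and d: "\<And>z. has_dderiv f (f' z) e z" and L: "\<And>z. \<bar>f' z\<bar> \<le> L" and B: "\<And>z. \<bar>f z\<bar> \<le> B"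
    and R: "\<And>z. R < norm z \<Longrightarrow> f z = 0"
  shows "(\<integral>z. f' z \<partial>lborel) = 0"
proof -
  let ?q = "\<lambda>n z. real (Suc n) * (f (z + (1 / real (Suc n)) *\<^sub>R e) - f z)"
  have fi: "integrable lborel f" by (rule integrable_bounded_support[OF assms(1) B R])
  have L0: "L \<ge> 0" using L[of 0] by linarith
  have "(\<lambda>n. \<integral>z. ?q n z \<partial>lborel) \<longlonglongrightarrow> (\<integral>z. f' z \<partial>lborel)"
  proof (rule integral_dominated_convergence[where w="\<lambda>z. L * indicator (cball 0 (R + norm e)) z"])
    show "integrable lborel (\<lambda>z. L * indicator (cball 0 (R + norm e)) (z::'a))"
      by (intro integrable_mult_right integrable_indicator_cball)
    show "AE z in lborel. (\<lambda>n. ?q n z) \<longlonglongrightarrow> f' z"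
    proof (intro AE_I2)
      fix z
      have "((\<lambda>s. (f (z + s *\<^sub>R e) - f z) / s) \<longlongrightarrow> f' z) (at 0)"
        using d[of z] unfolding has_dderiv_def DERIV_def by simp
      moreover have "filterlim (\<lambda>n. 1 / real (Suc n)) (at 0) sequentially"
        unfolding filterlim_at
        by (intro conjI always_eventually LIMSEQ_Suc[OF lim_1_over_n]) auto
      ultimately have "(\<lambda>n. (f (z + (1 / real (Suc n)) *\<^sub>R e) - f z) / (1 / real (Suc n))) \<longlonglongrightarrow> f' z"
        by (rule filterlim_compose)
      then show "(\<lambda>n. ?q n z) \<longlonglongrightarrow> f' z" by (simp add: field_simps)
    qed
    show "AE z in lborel. norm (?q n z) \<le> L * indicator (cball 0 (R + norm e)) z" for n
    proof (intro AE_I2)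
      fix z
      show "norm (?q n z) \<le> L * indicator (cball 0 (R + norm e)) z"
      proof (cases "z \<in> cball 0 (R + norm e)")
        case True
        have "norm (?q n z) = real (Suc n) * \<bar>f (z + (1 / real (Suc n)) *\<^sub>R e) - f z\<bar>" by (simp add: abs_mult)
        also have "\<dots> \<le> real (Suc n) * (L * \<bar>1 / real (Suc n)\<bar>)"
          by (intro mult_left_mono has_dderiv_lipschitz[OF d L]) auto
        also have "\<dots> = L" by simp
        finally show ?thesis using True by simp
      next
        case False
        then have F: "R + norm e < norm z" by simp
        have "norm z \<le> norm (z + (1 / real (Suc n)) *\<^sub>R e) + norm ((1 / real (Suc n)) *\<^sub>R e)"
          using norm_triangle_ineq4[of "z + (1 / real (Suc n)) *\<^sub>R e" "(1 / real (Suc n)) *\<^sub>R e"] by simp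
        also have "norm ((1 / real (Suc n)) *\<^sub>R e) \<le> norm e"
          by (simp add: divide_le_eq mult_left_le_one_le mult_le_cancel_left1 divide_simps)
        finally have "R < norm (z + (1 / real (Suc n)) *\<^sub>R e)" "R < norm z"
          using F norm_ge_zero[of e] by linarith+
        then have "f (z + (1 / real (Suc n)) *\<^sub>R e) = 0" "f z = 0" using R by blast+
        then show ?thesis using False by simp
      qed
    qed
  qed auto
  moreover have "(\<integral>z. ?q n z \<partial>lborel) = 0" for n
    using fi lborel_integrable_shift[OF fi] lborel_integral_shift[of f] by (simp add: right_diff_distrib)
  ultimately have "(\<lambda>n. 0::real) \<longlonglongrightarrow> (\<integral>z. f' z \<partial>lborel)" by simp
  then show ?thesis using LIMSEQ_unique tendsto_const by blast
qed

text \<open>The derivative falls on the kernel. Its difference quotients are bounded by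
  \<open>L\<close> through the mean value inequality, so L |u| dominates.\<close>

lemma conv_dderiv:
  fixes u :: "'a::euclidean_space \<Rightarrow> real"
  assumes u: "integrable lborel u"
    and m [measurable]: "\<eta> \<in> borel_measurable borel" "\<eta>' \<in> borel_measurable borel"
    and d: "\<And>z. has_dderiv \<eta> (\<eta>' z) e z" and L: "\<And>z. \<bar>\<eta>' z\<bar> \<le> L" and B: "\<And>z. \<bar>\<eta> z\<bar> \<le> B"
  shows "has_dderiv (conv \<eta> u) (conv \<eta>' u z) e z"
proof -
  have [measurable]: "u \<in> borel_measurable borel" using u by auto
  note ki = integrable_conv_kernel[OF u m(1) B]
  have "((\<lambda>s. (conv \<eta> u (z + s *\<^sub>R e) - conv \<eta> u z) / s) \<longlongrightarrow> conv \<eta>' u z) (at 0)"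
    unfolding tendsto_at_iff_sequentially comp_def
  proof (intro allI impI)
    fix X :: "nat \<Rightarrow> real" assume X: "\<forall>i. X i \<in> UNIV - {0}" "X \<longlonglongrightarrow> 0"
    have eq: "(conv \<eta> u (z + X i *\<^sub>R e) - conv \<eta> u z) / X i
        = (\<integral>y. ((\<eta> (z - y + X i *\<^sub>R e) - \<eta> (z - y)) / X i) * u y \<partial>lborel)" for i
    proof -
      have "conv \<eta> u (z + X i *\<^sub>R e) - conv \<eta> u z = (\<integral>y. \<eta> (z + X i *\<^sub>R e - y) * u y - \<eta> (z - y) * u y \<partial>lborel)"
        unfolding conv_def by (rule Bochner_Integration.integral_diff[symmetric]) (use ki in auto)
      then have "(conv \<eta> u (z + X i *\<^sub>R e) - conv \<eta> u z) / X i
         = (\<integral>y. (\<eta> (z + X i *\<^sub>R e - y) * u y - \<eta> (z - y) * u y) / X i \<partial>lborel)" by simp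
      also have "\<dots> = (\<integral>y. ((\<eta> (z - y + X i *\<^sub>R e) - \<eta> (z - y)) / X i) * u y \<partial>lborel)"
        by (rule Bochner_Integration.integral_cong) (auto simp: algebra_simps diff_divide_distrib)
      finally show ?thesis .
    qed
    show "(\<lambda>i. (conv \<eta> u (z + X i *\<^sub>R e) - conv \<eta> u z) / X i) \<longlonglongrightarrow> conv \<eta>' u z"
      unfolding eq unfolding conv_def
    proof (rule integral_dominated_convergence[where w="\<lambda>y. L * \<bar>u y\<bar>"])
      show "AE y in lborel. (\<lambda>i. (\<eta> (z - y + X i *\<^sub>R e) - \<eta> (z - y)) / X i * u y) \<longlonglongrightarrow> \<eta>' (z - y) * u y"
      proof (intro AE_I2 tendsto_intros)
        fix y
        have "((\<lambda>s. (\<eta> (z - y + s *\<^sub>R e) - \<eta> (z - y)) / s) \<longlongrightarrow> \<eta>' (z - y)) (at 0)"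
          using d[of "z - y"] unfolding has_dderiv_def DERIV_def by simp
        then show "(\<lambda>i. (\<eta> (z - y + X i *\<^sub>R e) - \<eta> (z - y)) / X i) \<longlonglongrightarrow> \<eta>' (z - y)"
          using X unfolding tendsto_at_iff_sequentially comp_def by blast
      qed
      show "AE y in lborel. norm ((\<eta> (z - y + X i *\<^sub>R e) - \<eta> (z - y)) / X i * u y) \<le> L * \<bar>u y\<bar>" for i
      proof (intro AE_I2)
        fix y
        have "X i \<noteq> 0" using X by auto
        then have "\<bar>(\<eta> (z - y + X i *\<^sub>R e) - \<eta> (z - y)) / X i\<bar> \<le> L"
          using has_dderiv_lipschitz[OF d L, of "z - y" "X i"] by (simp add: abs_divide divide_le_eq)
        then have "\<bar>(\<eta> (z - y + X i *\<^sub>R e) - \<eta> (z - y)) / X i\<bar> * \<bar>u y\<bar> \<le> L * \<bar>u y\<bar>"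
          by (rule mult_right_mono) simp
        then show "norm ((\<eta> (z - y + X i *\<^sub>R e) - \<eta> (z - y)) / X i * u y) \<le> L * \<bar>u y\<bar>"
          by (simp only: real_norm_def abs_mult)
      qed
    qed (use u in auto)
  qed
  then show ?thesis unfolding has_dderiv_def DERIV_def by simp
qed

subsection \<open>Smooth functions and mollifiers\<close>

lemma C_k_imp_partial:
  assumes c: "C_k (Suc 0) f" and e: "e \<in> Basis"
  shows "continuous_on UNIV (\<lambda>z. frechet_derivative f (at z) e)"
    "has_dderiv f (frechet_derivative f (at z) e) e z" "f differentiable (at z)"
proof -
  show "continuous_on UNIV (\<lambda>z. frechet_derivative f (at z) e)" using c e by simp
  show "f differentiable (at z)" using c by simp
  then show "has_dderiv f (frechet_derivative f (at z) e) e z"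
    using frechet_derivative_works has_derivative_imp_dderiv by blast
qed

lemma frechet_derivative_outside_support:
  fixes f :: "'a::euclidean_space \<Rightarrow> real"
  assumes "\<And>z. r \<le> norm z \<Longrightarrow> f z = 0" "r < norm z"
  shows "frechet_derivative f (at z) = (\<lambda>h. 0)"
proof -
  have "((\<lambda>_. 0) has_derivative (\<lambda>h. 0)) (at z)" by simp
  then have "(f has_derivative (\<lambda>h. 0)) (at z)"
  proof (rule has_derivative_transform_within_open)
    show "open (- cball 0 r :: 'a set)" by (simp add: open_Compl)
  qed (use assms in auto)
  then show ?thesis by (rule frechet_derivative_at[symmetric])
qed

lemma mollifier_partial:
  fixes \<eta> :: "'a::euclidean_space \<Rightarrow> real"
  assumes m: "mollifier r \<eta>" and e: "e \<in> Basis"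
  defines "\<eta>' \<equiv> \<lambda>z. frechet_derivative \<eta> (at z) e"
  shows "continuous_on UNIV \<eta>'" "\<eta>' \<in> borel_measurable borel" "has_dderiv \<eta> (\<eta>' z) e z"
    "\<exists>L. \<forall>z. \<bar>\<eta>' z\<bar> \<le> L" "r < norm z \<Longrightarrow> \<eta>' z = 0"
proof -
  have c: "C_k (Suc 0) \<eta>" using mollifierD(1)[OF m] .
  show 1: "continuous_on UNIV \<eta>'" "has_dderiv \<eta> (\<eta>' z) e z" for z
    unfolding \<eta>'_def using C_k_imp_partial[OF c e] by auto
  show "\<eta>' \<in> borel_measurable borel" using 1(1) by (rule borel_measurable_continuous_onI)
  show z: "\<eta>' z = 0" if "r < norm z" for z
    unfolding \<eta>'_def using frechet_derivative_outside_support[OF mollifierD(3)[OF m] that] by simp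
  show "\<exists>L. \<forall>z. \<bar>\<eta>' z\<bar> \<le> L" by (rule continuous_bounded_support[OF 1(1) z])
qed

lemma conv_mollifier_dderiv:
  assumes m: "mollifier r \<eta>" and u: "integrable lborel u" and e: "e \<in> Basis"
  shows "has_dderiv (conv \<eta> u) (conv (\<lambda>z. frechet_derivative \<eta> (at z) e) u z) e z"
proof -
  obtain B where B: "\<And>z. \<bar>\<eta> z\<bar> \<le> B" using mollifierD(8)[OF m] by blast
  obtain L where L: "\<And>z. \<bar>frechet_derivative \<eta> (at z) e\<bar> \<le> L" using mollifier_partial(4)[OF m e] by blast
  show ?thesis
    by (rule conv_dderiv[OF u mollifierD(7)[OF m] mollifier_partial(2)[OF m e] mollifier_partial(3)[OF m e] L B])
qed

lemma conv_bounded: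
  assumes u: "integrable lborel u" and [measurable]: "\<eta> \<in> borel_measurable borel" and B: "\<And>z. \<bar>\<eta> z\<bar> \<le> B"
  shows "\<bar>conv \<eta> u z\<bar> \<le> B * (\<integral>y. \<bar>u y\<bar> \<partial>lborel)"
proof -
  have "norm (conv \<eta> u z) \<le> (\<integral>y. B * \<bar>u y\<bar> \<partial>lborel)"
    unfolding conv_def
  proof (rule Bochner_Integration.integral_norm_bound_integral)
    show "norm (\<eta> (z - y) * u y) \<le> B * \<bar>u y\<bar>" for y using B by (simp add: abs_mult mult_right_mono)
  qed (use u integrable_conv_kernel[OF u assms(2) B] in auto)
  then show ?thesis by simp
qed

text \<open>The factor \<open>c\<close> closes the induction: every differentiation of the
  reflection produces a sign, which \<open>c\<close> absorbs.\<close>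

lemma C_k_reflect: "C_k k f \<Longrightarrow> C_k k (\<lambda>z. c * f (z0 - z))"
proof (induction k arbitrary: f c)
  case 0
  then have "continuous_on UNIV (\<lambda>z. f (z0 - z))"
    by (auto intro!: continuous_on_compose2[of UNIV f] continuous_intros)
  then show ?case by (auto intro!: continuous_intros)
next
  case (Suc k)
  have D: "((\<lambda>z. c * f (z0 - z)) has_derivative (\<lambda>h. c * frechet_derivative f (at (z0 - z)) (- h))) (at z)" for z
  proof -
    have "(f has_derivative frechet_derivative f (at (z0 - z))) (at (z0 - z))"
      using Suc.prems frechet_derivative_works by auto
    moreover have "((\<lambda>z. z0 - z) has_derivative (\<lambda>h. - h)) (at z)"
      by (auto intro!: derivative_eq_intros)
    ultimately have "((\<lambda>z. f (z0 - z)) has_derivative (\<lambda>h. frechet_derivative f (at (z0 - z)) (- h))) (at z)"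
      by (rule has_derivative_compose[rotated])
    then show ?thesis by (rule has_derivative_mult_right)
  qed
  have lin: "linear (frechet_derivative f (at z))" for z
    using Suc.prems linear_frechet_derivative by auto
  have eq: "frechet_derivative (\<lambda>z. c * f (z0 - z)) (at z) b = (- c) * frechet_derivative f (at (z0 - z)) b" for z b
    using frechet_derivative_at[OF D, symmetric] by (simp add: linear_neg[OF lin])
  show ?case
    unfolding C_k.simps
  proof (intro conjI allI ballI)
    show "(\<lambda>z. c * f (z0 - z)) differentiable at z" for z using D differentiableI by blast
    show "C_k k (\<lambda>z. frechet_derivative (\<lambda>z. c * f (z0 - z)) (at z) b)" if "b \<in> Basis" for b
      unfolding eq by (rule Suc.IH[of "\<lambda>z. frechet_derivative f (at z) b"]) (use Suc.prems that in simp)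
  qed
qed

lemma frechet_derivative_reflect:
  assumes "C_k (Suc 0) f"
  shows "frechet_derivative (\<lambda>z. f (z0 - z)) (at z) b = - frechet_derivative f (at (z0 - z)) b"
proof -
  have f: "(f has_derivative frechet_derivative f (at (z0 - z))) (at (z0 - z))"
    using assms frechet_derivative_works by auto
  moreover have "((\<lambda>z. z0 - z) has_derivative (\<lambda>h. - h)) (at z)"
    by (auto intro!: derivative_eq_intros)
  ultimately have "((\<lambda>z. f (z0 - z)) has_derivative (\<lambda>h. frechet_derivative f (at (z0 - z)) (- h))) (at z)"
    by (rule has_derivative_compose[rotated])
  moreover have "linear (frechet_derivative f (at (z0 - z)))"
    using f has_derivative_linear by blast
  ultimately show ?thesis using frechet_derivative_at[symmetric] linear_neg by metis
qed

lemma has_derivative_slice: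
  fixes f :: "'a::euclidean_space \<times> 'b::euclidean_space \<Rightarrow> real"
  assumes "f differentiable (at (x, t))"
  shows "((\<lambda>x. f (x, t)) has_derivative (\<lambda>h. frechet_derivative f (at (x, t)) (h, 0))) (at x)"
proof -
  have "(f has_derivative frechet_derivative f (at (x, t))) (at (x, t))"
    using assms frechet_derivative_works by auto
  moreover have "((\<lambda>x. (x, t)) has_derivative (\<lambda>h. (h, 0))) (at x)"
    by (auto intro!: derivative_eq_intros)
  ultimately show ?thesis by (rule has_derivative_compose[rotated])
qed

lemma C_k_slice:
  fixes f :: "'a::euclidean_space \<times> 'b::euclidean_space \<Rightarrow> real"
  shows "C_k k f \<Longrightarrow> C_k k (\<lambda>x. f (x, t))"
proof (induction k arbitrary: f)
  case 0
  then show ?case by (auto intro!: continuous_on_compose2[of UNIV f] continuous_intros)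
next
  case (Suc k)
  have D: "((\<lambda>x. f (x, t)) has_derivative (\<lambda>h. frechet_derivative f (at (x, t)) (h, 0))) (at x)" for x
    using Suc.prems by (intro has_derivative_slice) auto
  have eq: "frechet_derivative (\<lambda>x. f (x, t)) (at x) b = frechet_derivative f (at (x, t)) (b, 0)" for x b
    using frechet_derivative_at[OF D, symmetric] by simp
  show ?case
    unfolding C_k.simps
  proof (intro conjI allI ballI)
    show "(\<lambda>x. f (x, t)) differentiable at x" for x using D differentiableI by blast
    show "C_k k (\<lambda>x. frechet_derivative (\<lambda>x. f (x, t)) (at x) b)" if "b \<in> Basis" for b
      unfolding eq by (rule Suc.IH[of "\<lambda>z. frechet_derivative f (at z) (b, 0)"])
        (use Suc.prems that in \<open>simp add: Basis_prod_def\<close>)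
  qed
qed

text \<open>\<open>\<gamma> b m\<close> is the m-th derivative of the factor in coordinate
  \<open>b\<close>, and the multi-index \<open>m\<close> records how often each factor has been
  differentiated. A partial derivative raises one entry of \<open>m\<close>, so the family of such
  products is closed under differentiation.\<close>

lemma C_k_prod:
  fixes \<gamma> :: "'a::euclidean_space \<Rightarrow> nat \<Rightarrow> real \<Rightarrow> real"
  assumes \<gamma>: "\<And>b m s. (\<gamma> b m has_real_derivative \<gamma> b (Suc m) s) (at s)"
  shows "C_k k (\<lambda>z. c * (\<Prod>b\<in>Basis. \<gamma> b (m b) (z \<bullet> b)))"
proof (induction k arbitrary: m)
  case 0
  have c: "continuous_on UNIV (\<gamma> b m)" for b m
    using \<gamma> by (intro continuous_at_imp_continuous_on ballI DERIV_isCont)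
  have "continuous_on UNIV (\<lambda>z. \<gamma> b (m b) (z \<bullet> b))" for b
    by (rule continuous_on_compose2[OF c]) (auto intro: continuous_on_inner continuous_on_id continuous_on_const)
  then show ?case
    unfolding C_k.simps by (intro continuous_on_mult continuous_on_const continuous_on_prod)
next
  case (Suc k)
  have D: "((\<lambda>z. c * (\<Prod>b\<in>Basis. \<gamma> b (m b) (z \<bullet> b))) has_derivative
     (\<lambda>h. c * (\<Sum>i\<in>Basis. (\<gamma> i (Suc (m i)) (z \<bullet> i) * (h \<bullet> i)) * (\<Prod>j\<in>Basis - {i}. \<gamma> j (m j) (z \<bullet> j))))) (at z)" for z
  proof (intro has_derivative_mult_right has_derivative_prod)
    fix i :: 'a assume "i \<in> Basis"
    have "(\<gamma> i (m i) has_derivative (\<lambda>h. \<gamma> i (Suc (m i)) (z \<bullet> i) * h)) (at (z \<bullet> i))"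
      using \<gamma> unfolding has_field_derivative_def .
    moreover have "((\<lambda>z. z \<bullet> i) has_derivative (\<lambda>h. h \<bullet> i)) (at z)"
      by (auto intro!: derivative_eq_intros)
    ultimately show "((\<lambda>z. \<gamma> i (m i) (z \<bullet> i)) has_derivative (\<lambda>h. \<gamma> i (Suc (m i)) (z \<bullet> i) * (h \<bullet> i))) (at z)"
      by (rule has_derivative_compose[rotated])
  qed
  have eq: "frechet_derivative (\<lambda>z. c * (\<Prod>b\<in>Basis. \<gamma> b (m b) (z \<bullet> b))) (at z) b
     = c * (\<Prod>j\<in>Basis. \<gamma> j ((m(b := Suc (m b))) j) (z \<bullet> j))" if b: "b \<in> Basis" for z b
  proof -
    have "(\<Sum>i\<in>Basis. (\<gamma> i (Suc (m i)) (z \<bullet> i) * (b \<bullet> i)) * (\<Prod>j\<in>Basis - {i}. \<gamma> j (m j) (z \<bullet> j)))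
      = (\<Sum>i\<in>Basis. if i = b then \<gamma> b (Suc (m b)) (z \<bullet> b) * (\<Prod>j\<in>Basis - {b}. \<gamma> j (m j) (z \<bullet> j)) else 0)"
      by (rule sum.cong) (use b in \<open>auto simp: inner_Basis\<close>)
    also have "\<dots> = \<gamma> b (Suc (m b)) (z \<bullet> b) * (\<Prod>j\<in>Basis - {b}. \<gamma> j (m j) (z \<bullet> j))"
      using b by simp
    also have "\<dots> = (\<Prod>j\<in>Basis. \<gamma> j ((m(b := Suc (m b))) j) (z \<bullet> j))"
      by (subst (2) prod.remove[of _ b]) (use b in auto)
    finally show ?thesis using frechet_derivative_at[OF D, symmetric] by simp
  qed
  show ?case
    unfolding C_k.simps
  proof (intro conjI allI ballI)
    show "(\<lambda>z. c * (\<Prod>b\<in>Basis. \<gamma> b (m b) (z \<bullet> b))) differentiable at z" for z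
      using D differentiableI by blast
    show "C_k k (\<lambda>z. frechet_derivative (\<lambda>z. c * (\<Prod>b\<in>Basis. \<gamma> b (m b) (z \<bullet> b))) (at z) b)" if "b \<in> Basis" for b
      unfolding eq[OF that] by (rule Suc.IH)
  qed
qed

section \<open>The standard bump function and the existence of mollifiers\<close>

lemma DERIV_zero_if_quadratic:
  fixes f :: "real \<Rightarrow> real"
  assumes "\<And>t. \<bar>f t - f s\<bar> \<le> K * (t - s)\<^sup>2"
  shows "(f has_real_derivative 0) (at s)"
proof -
  have "((\<lambda>h. (f (s + h) - f s) / h) \<longlongrightarrow> 0) (at 0)"
  proof (rule Lim_null_comparison)
    show "\<forall>\<^sub>F h in at 0. norm ((f (s + h) - f s) / h) \<le> \<bar>K\<bar> * \<bar>h\<bar>"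
      unfolding eventually_at_filter
    proof (intro always_eventually allI impI)
      fix h :: real assume h: "h \<noteq> 0"
      have "\<bar>f (s + h) - f s\<bar> \<le> K * h\<^sup>2" using assms[of "s + h"] by simp
      also have "\<dots> \<le> \<bar>K\<bar> * h\<^sup>2" by (intro mult_right_mono) auto
      finally show "norm ((f (s + h) - f s) / h) \<le> \<bar>K\<bar> * \<bar>h\<bar>"
        using h by (simp add: divide_le_eq power2_eq_square)
    qed
    have "((\<lambda>h::real. \<bar>K\<bar> * \<bar>h\<bar>) \<longlongrightarrow> \<bar>K\<bar> * \<bar>0\<bar>) (at 0)" by (intro tendsto_intros)
    then show "((\<lambda>h::real. \<bar>K\<bar> * \<bar>h\<bar>) \<longlongrightarrow> 0) (at 0)" by simp
  qed
  then show ?thesis unfolding DERIV_def .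
qed

lemma power_mult_exp_neg_le_fact:
  fixes y :: real
  assumes "y \<ge> 0"
  shows "y ^ n * exp (- y) \<le> fact n"
proof -
  have "y ^ n /\<^sub>R fact n \<le> (\<Sum>k. y ^ k /\<^sub>R fact k)"
    using sum_le_suminf[OF summable_exp_generic[of y], of "{n}"] assms by simp
  then have "inverse (fact n) * y ^ n \<le> exp y" by (simp add: exp_def)
  then have "fact n * (inverse (fact n) * y ^ n) * exp (- y) \<le> fact n * exp y * exp (- y)"
    by (intro mult_right_mono mult_left_mono) auto
  also have "fact n * exp y * exp (- y) = fact n * (exp y * exp (- y))" by (rule mult.assoc)
  finally show ?thesis by (simp add: exp_minus_inverse mult.assoc[symmetric])
qed

text \<open>With y = 1 / (1 - s^2) these are the functions q(s) y^k exp(-y) on (-1, 1). The class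
  contains the standard bump (q = 1, k = 0) and is closed under differentiation, so all derivatives
  of the bump are explicit.\<close>

definition bump_fun :: "real poly \<Rightarrow> nat \<Rightarrow> real \<Rightarrow> real" where
  "bump_fun q k s = (if \<bar>s\<bar> < 1 then poly q s * (1 / (1 - s\<^sup>2)) ^ k * exp (- (1 / (1 - s\<^sup>2))) else 0)"

text \<open>Since y' = 2 s y^2 and y (1 - s^2) = 1, each term of the derivative of q y^k exp(-y) can
  be brought to the common factor y^(k+2) exp(-y); this polynomial is the other factor.\<close>

definition bump_poly :: "real poly \<Rightarrow> nat \<Rightarrow> real poly" where
  "bump_poly q k = pderiv q * [:1, 0, -1:] ^ 2 + [:0, 2 * real k:] * [:1, 0, -1:] * q - [:0, 2:] * q"

text \<open>Second-order vanishing at the end points is what gives derivative 0 where the pieces are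
  glued. It follows from y^k exp(-y) = y^(k+2) exp(-y) (1 - s^2)^2 and the bound (k+2)! for y^(k+2)
  exp(-y).\<close>

lemma bump_fun_quadratic: "\<exists>K. \<forall>s. \<bar>bump_fun q k s\<bar> \<le> K * (1 - \<bar>s\<bar>)\<^sup>2"
proof -
  have "compact (poly q ` cball 0 1)"
    by (rule compact_continuous_image) (auto intro!: continuous_intros)
  from compact_imp_bounded[OF this] obtain B where "\<forall>y\<in>poly q ` cball 0 1. norm y \<le> B"
    unfolding bounded_iff ..
  then have B: "\<And>x. \<bar>x\<bar> \<le> 1 \<Longrightarrow> \<bar>poly q x\<bar> \<le> B" by simp
  have B0: "B \<ge> 0" using B[of 0] by linarith
  have "\<bar>bump_fun q k s\<bar> \<le> (B * fact (k + 2) * 2\<^sup>2) * (1 - \<bar>s\<bar>)\<^sup>2" for s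
  proof (cases "\<bar>s\<bar> < 1")
    case True
    define y where "y = 1 / (1 - s\<^sup>2)"
    have s2: "1 - s\<^sup>2 > 0" using True by (simp add: abs_square_less_1)
    then have y: "y > 0" "y * (1 - s\<^sup>2) = 1" by (auto simp: y_def)
    have yk: "y ^ k = y ^ (k + 2) * (1 - s\<^sup>2)\<^sup>2"
    proof -
      have "y ^ (k + 2) * (1 - s\<^sup>2)\<^sup>2 = y ^ k * (y * (1 - s\<^sup>2))\<^sup>2"
        by (simp only: power_add power_mult_distrib mult.assoc)
      then show ?thesis using y by simp
    qed
    have le: "1 - s\<^sup>2 \<le> 2 * (1 - \<bar>s\<bar>)"
    proof -
      have "1 - s\<^sup>2 = (1 - \<bar>s\<bar>) * (1 + \<bar>s\<bar>)" by (simp add: algebra_simps power2_eq_square)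
      also have "\<dots> \<le> (1 - \<bar>s\<bar>) * 2" using True by (intro mult_left_mono) auto
      finally show ?thesis by simp
    qed
    have "\<bar>bump_fun q k s\<bar> = \<bar>poly q s\<bar> * (y ^ k * exp (- y))"
      using True y by (simp add: bump_fun_def y_def abs_mult)
    also have "\<dots> \<le> B * (y ^ k * exp (- y))"
      using True y by (intro mult_right_mono B) auto
    also have "\<dots> = B * (y ^ (k + 2) * exp (- y)) * (1 - s\<^sup>2)\<^sup>2" unfolding yk by (simp only: mult_ac)
    also have "\<dots> \<le> B * fact (k + 2) * (2 * (1 - \<bar>s\<bar>))\<^sup>2"
      by (intro mult_mono power_mono power_mult_exp_neg_le_fact le)
        (use s2 y B0 True in auto)
    finally show ?thesis by (simp only: power_mult_distrib mult.assoc)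
  next
    case False
    then show ?thesis using B0 by (simp add: bump_fun_def)
  qed
  then show ?thesis by blast
qed

lemma DERIV_bump_fun: "(bump_fun q k has_real_derivative bump_fun (bump_poly q k) (k + 2) s) (at s)"
proof -
  consider "\<bar>s\<bar> < 1" | "\<bar>s\<bar> = 1" | "\<bar>s\<bar> > 1" by linarith
  then show ?thesis
  proof cases
    case 1
    define y where "y = 1 / (1 - s\<^sup>2)"
    have s2: "1 - s\<^sup>2 > 0" using 1 by (simp add: abs_square_less_1)
    then have y: "y \<noteq> 0" "y * (1 - s\<^sup>2) = 1" by (auto simp: y_def)
    have dy: "((\<lambda>s. 1 / (1 - s\<^sup>2)) has_real_derivative 2 * s * y\<^sup>2) (at s)"
      using s2 by (auto intro!: derivative_eq_intros simp: y_def power2_eq_square)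
    have "((\<lambda>s. poly q s * (1 / (1 - s\<^sup>2)) ^ k * exp (- (1 / (1 - s\<^sup>2)))) has_real_derivative
       (poly (pderiv q) s * y ^ k + (real k * (2 * s * y\<^sup>2) * y ^ (k - 1)) * poly q s) * exp (- y)
        + (exp (- y) * - (2 * s * y\<^sup>2)) * (poly q s * y ^ k)) (at s)"
      unfolding y_def[symmetric]
      by (rule derivative_eq_intros dy poly_DERIV refl | simp add: y_def)+
    moreover have "(poly (pderiv q) s * y ^ k + (real k * (2 * s * y\<^sup>2) * y ^ (k - 1)) * poly q s) * exp (- y)
        + (exp (- y) * - (2 * s * y\<^sup>2)) * (poly q s * y ^ k) = bump_fun (bump_poly q k) (k + 2) s"
    proof -
      have k1: "y ^ k = y ^ (k + 2) * (1 - s\<^sup>2)\<^sup>2"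
      proof -
        have "y ^ (k + 2) * (1 - s\<^sup>2)\<^sup>2 = y ^ k * (y * (1 - s\<^sup>2))\<^sup>2"
          by (simp only: power_add power_mult_distrib mult.assoc)
        then show ?thesis using y by simp
      qed
      have k2: "real k * y\<^sup>2 * y ^ (k - 1) = real k * y ^ (k + 2) * (1 - s\<^sup>2)"
      proof (cases k)
        case (Suc j)
        have "y ^ (k + 2) * (1 - s\<^sup>2) = y\<^sup>2 * y ^ j * (y * (1 - s\<^sup>2))" by (simp add: Suc power_add power2_eq_square)
        then show ?thesis using y Suc by (simp add: power2_eq_square)
      qed simp
      have k3: "y\<^sup>2 * y ^ k = y ^ (k + 2)" by (simp only: power_add mult_ac)
      have "bump_fun (bump_poly q k) (k + 2) s
        = (poly (pderiv q) s * (1 - s\<^sup>2)\<^sup>2 + 2 * real k * s * (1 - s\<^sup>2) * poly q s - 2 * s * poly q s) * y ^ (k + 2) * exp (- y)"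
        using 1 by (simp add: bump_fun_def bump_poly_def y_def power2_eq_square algebra_simps)
      also have "\<dots> = (poly (pderiv q) s * (y ^ (k + 2) * (1 - s\<^sup>2)\<^sup>2)
          + 2 * s * poly q s * (real k * y ^ (k + 2) * (1 - s\<^sup>2)) - 2 * s * poly q s * y ^ (k + 2)) * exp (- y)"
        by (simp only: algebra_simps)
      also have "\<dots> = (poly (pderiv q) s * y ^ k
          + 2 * s * poly q s * (real k * y\<^sup>2 * y ^ (k - 1)) - 2 * s * poly q s * y ^ (k + 2)) * exp (- y)"
        unfolding k1[symmetric] k2[symmetric] ..
      finally show ?thesis unfolding k3[symmetric] by (simp add: algebra_simps)
    qed
    ultimately have "((\<lambda>s. poly q s * (1 / (1 - s\<^sup>2)) ^ k * exp (- (1 / (1 - s\<^sup>2)))) has_real_derivative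
       bump_fun (bump_poly q k) (k + 2) s) (at s)" by simp
    then show ?thesis
      by (rule has_field_derivative_transform_within_open[where S="{-1<..<1}"])
        (use 1 in \<open>auto simp: bump_fun_def abs_less_iff\<close>)
  next
    case 2
    obtain K where K: "\<And>s. \<bar>bump_fun q k s\<bar> \<le> K * (1 - \<bar>s\<bar>)\<^sup>2" using bump_fun_quadratic by blast
    have "\<bar>bump_fun q k t - bump_fun q k s\<bar> \<le> \<bar>K\<bar> * (t - s)\<^sup>2" for t
    proof -
      have "\<bar>bump_fun q k t - bump_fun q k s\<bar> = \<bar>bump_fun q k t\<bar>" using 2 by (simp add: bump_fun_def)
      also have "\<dots> \<le> K * (1 - \<bar>t\<bar>)\<^sup>2" by (rule K)
      also have "\<dots> \<le> \<bar>K\<bar> * (t - s)\<^sup>2"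
      proof (rule mult_mono)
        have "\<bar>1 - \<bar>t\<bar>\<bar> \<le> \<bar>t - s\<bar>" using 2 by linarith
        then show "(1 - \<bar>t\<bar>)\<^sup>2 \<le> (t - s)\<^sup>2" by (simp add: abs_le_square_iff)
      qed auto
      finally show ?thesis .
    qed
    then have "(bump_fun q k has_real_derivative 0) (at s)" by (rule DERIV_zero_if_quadratic)
    then show ?thesis using 2 by (simp add: bump_fun_def)
  next
    case 3
    have "((\<lambda>_. 0) has_real_derivative 0) (at s)" by simp
    then have "(bump_fun q k has_real_derivative 0) (at s)"
    proof (rule has_field_derivative_transform_within_open[where S="{s. \<bar>s\<bar> > 1}"])
      show "open {s::real. \<bar>s\<bar> > 1}" by (intro open_Collect_less continuous_intros)
    qed (use 3 in \<open>auto simp: bump_fun_def\<close>)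
    then show ?thesis using 3 by (simp add: bump_fun_def)
  qed
qed

lemma smooth_bump_real:
  obtains \<gamma> :: "nat \<Rightarrow> real \<Rightarrow> real" where
    "\<And>m s. (\<gamma> m has_real_derivative \<gamma> (Suc m) s) (at s)"
    "\<And>s. \<gamma> 0 s \<ge> 0" "\<gamma> 0 0 > 0" "\<And>s. \<bar>s\<bar> \<ge> 1 \<Longrightarrow> \<gamma> 0 s = 0"
proof
  \<comment> \<open>\<open>P m\<close> is the pair of polynomial and exponent that represents the
    m-th derivative of the bump.\<close>
  define P where "P = rec_nat (1, 0) (\<lambda>_ (q, k). (bump_poly q k, k + 2 :: nat))"
  define \<gamma> where "\<gamma> m = (case P m of (q, k) \<Rightarrow> bump_fun q k)" for m
  show "(\<gamma> m has_real_derivative \<gamma> (Suc m) s) (at s)" for m s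
    using DERIV_bump_fun by (simp add: \<gamma>_def P_def split: prod.splits)
  show "\<gamma> 0 s \<ge> 0" "\<gamma> 0 0 > 0" "\<bar>s\<bar> \<ge> 1 \<Longrightarrow> \<gamma> 0 s = 0" for s
    by (auto simp: \<gamma>_def P_def bump_fun_def)
qed

lemma mollifier_exists:
  assumes r: "r > 0"
  shows "\<exists>\<eta> :: 'a::euclidean_space \<Rightarrow> real. mollifier r \<eta>"
proof -
  obtain \<gamma> :: "nat \<Rightarrow> real \<Rightarrow> real" where
    \<gamma>: "\<And>m s. (\<gamma> m has_real_derivative \<gamma> (Suc m) s) (at s)"
    "\<And>s. \<gamma> 0 s \<ge> 0" "\<gamma> 0 0 > 0" "\<And>s. \<bar>s\<bar> \<ge> 1 \<Longrightarrow> \<gamma> 0 s = 0"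
    using smooth_bump_real by blast
  \<comment> \<open>With this scaling the product is supported where all |z_b| are below r / DIM,
    and the sum of these bounds puts that cube inside the ball of radius \<open>r\<close>.\<close>
  define K where "K = DIM('a) / r"
  have K: "K > 0" using r by (simp add: K_def)
  define f where "f z = (\<Prod>b\<in>Basis. \<gamma> 0 (K * (z \<bullet> b)))" for z :: 'a
  have d: "((\<lambda>s. K ^ m * \<gamma> m (K * s)) has_real_derivative K ^ Suc m * \<gamma> (Suc m) (K * s)) (at s)" for m s
  proof -
    have "((\<lambda>s. \<gamma> m (K * s)) has_real_derivative \<gamma> (Suc m) (K * s) * K) (at s)"
      by (rule DERIV_chain2[OF \<gamma>(1)]) (auto intro!: derivative_eq_intros)
    from DERIV_cmult[OF this, of "K ^ m"] show ?thesis by (simp add: mult_ac)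
  qed
  have Ck: "C_k k (\<lambda>z. c * f z)" for k c
    using C_k_prod[of "\<lambda>b m s. K ^ m * \<gamma> m (K * s)" k c "\<lambda>_. 0", OF d]
    by (simp add: f_def)
  have f0: "f z \<ge> 0" for z unfolding f_def by (intro prod_nonneg) (use \<gamma> in auto)
  have supp: "f z = 0" if "r \<le> norm z" for z
  proof (rule ccontr)
    assume "f z \<noteq> 0"
    then have lt: "\<bar>K * (z \<bullet> b)\<bar> < 1" if "b \<in> Basis" for b
      using that \<gamma>(4)[of "K * (z \<bullet> b)"] by (force simp: f_def)
    have "norm z \<le> (\<Sum>b\<in>Basis. \<bar>z \<bullet> b\<bar>)" by (rule norm_le_l1)
    also have "\<dots> < (\<Sum>b\<in>(Basis::'a set). r / DIM('a))"
    proof (rule sum_strict_mono)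
      fix b :: 'a assume "b \<in> Basis"
      then show "\<bar>z \<bullet> b\<bar> < r / DIM('a)" using lt[of b] r by (simp add: K_def abs_mult field_simps)
    qed auto
    also have "\<dots> = r" by simp
    finally show False using that by simp
  qed
  have cont: "continuous_on UNIV f" using Ck[of 0 1] by simp
  have [measurable]: "f \<in> borel_measurable borel" using cont by (rule borel_measurable_continuous_onI)
  obtain B where B: "\<And>z. \<bar>f z\<bar> \<le> B"
    using continuous_bounded_support[OF cont, of r] supp by force
  have fi: "integrable lborel f"
    by (rule integrable_bounded_support[where R=r, OF _ B]) (simp_all add: supp)
  have pos: "(\<integral>z. f z \<partial>lborel) > 0"
  proof -
    have "(\<integral>z. f z \<partial>lborel) \<noteq> 0"
    proof
      assume "(\<integral>z. f z \<partial>lborel) = 0"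
      then have "AE z in lborel. f z = 0"
        using integral_nonneg_eq_0_iff_AE[OF fi] f0 by simp
      moreover have op: "open {z. f z \<noteq> 0}"
        using cont by (intro open_Collect_neq continuous_on_const)
      moreover have "f 0 \<noteq> 0" using \<gamma>(3) by (simp add: f_def)
      ultimately show False
      proof -
        assume ae: "AE z in lborel. f z = 0"
        have "emeasure lborel {z. f z \<noteq> 0} = 0"
          using ae by (subst (asm) AE_iff_measurable[of "{z. f z \<noteq> 0}"]) (use op in auto)
        then have "negligible {z. f z \<noteq> 0}"
          using op by (simp add: negligible_iff_emeasure0)
        then show False using open_not_negligible[OF op] \<open>f 0 \<noteq> 0\<close> by auto
      qed
    qed
    moreover have "(\<integral>z. f z \<partial>lborel) \<ge> 0" using f0 by simp
    ultimately show ?thesis by simp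
  qed
  have "mollifier r (\<lambda>z. (1 / (\<integral>z. f z \<partial>lborel)) * f z)"
    unfolding mollifier_def
  proof (intro conjI allI impI)
    show "C_k k (\<lambda>z. (1 / (\<integral>z. f z \<partial>lborel)) * f z)" for k by (rule Ck)
  qed (use f0 supp fi pos in auto)
  then show ?thesis by blast
qed

subsection \<open>Mollified weak solutions\<close>

lemma borel_imp_lebesgue_on:
  "f \<in> borel_measurable borel \<Longrightarrow> f \<in> borel_measurable (lebesgue_on S)"
  by (rule measurable_restrict_space1) (rule measurable_completion, simp)

text \<open>The function spaces are defined with the completed Lebesgue measure on a set, while
  convolution and Fubini are carried out for Borel functions under \<open>lborel\<close>; this
  passes from one to the other.\<close>

lemma lebesgue_on_integral_eq:
  fixes f g :: "'a::euclidean_space \<Rightarrow> real"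
  assumes S: "S \<in> sets lebesgue" and f: "f \<in> borel_measurable (lebesgue_on S)"
    and g: "g \<in> borel_measurable borel" and eq: "AE x in lborel. indicator S x * f x = g x"
  shows "integral\<^sup>L (lebesgue_on S) f = integral\<^sup>L lborel g"
    "integrable (lebesgue_on S) f \<longleftrightarrow> integrable lborel g"
proof -
  have S': "S \<inter> space lebesgue \<in> sets lebesgue" using S by simp
  have fm: "(\<lambda>x. indicator S x * f x) \<in> borel_measurable lebesgue"
    using f by (simp add: borel_measurable_restrict_space_iff[OF S'])
  have gm: "g \<in> borel_measurable lebesgue" using g by (intro measurable_completion) simp
  have ae: "AE x in lebesgue. indicator S x * f x = g x" using eq by (simp add: AE_completion_iff)
  have "integral\<^sup>L (lebesgue_on S) f = integral\<^sup>L lebesgue (\<lambda>x. indicator S x * f x)"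
    by (simp add: integral_restrict_space[OF S'])
  also have "\<dots> = integral\<^sup>L lebesgue g" by (rule integral_cong_AE[OF fm gm ae])
  also have "\<dots> = integral\<^sup>L lborel g" using g by (intro integral_completion) simp
  finally show "integral\<^sup>L (lebesgue_on S) f = integral\<^sup>L lborel g" .
  have "integrable (lebesgue_on S) f \<longleftrightarrow> integrable lebesgue (\<lambda>x. indicator S x * f x)"
    by (simp add: integrable_restrict_space[OF S'])
  also have "\<dots> \<longleftrightarrow> integrable lebesgue g" by (rule integrable_cong_AE[OF fm gm ae])
  also have "\<dots> \<longleftrightarrow> integrable lborel g" using g by (intro integrable_completion) simp
  finally show "integrable (lebesgue_on S) f \<longleftrightarrow> integrable lborel g" .
qed

lemma powr_le_one_add_powr:
  fixes a :: real
  assumes "0 \<le> a" "0 \<le> q" "q \<le> p"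
  shows "a powr q \<le> 1 + a powr p"
proof (cases "a \<le> 1")
  case True
  then have "a powr q \<le> 1" using assms by (intro powr_le1) auto
  then show ?thesis using powr_ge_zero[of a p] by linarith
next
  case False
  then have "a powr q \<le> a powr p" using assms by (intro powr_mono) auto
  then show ?thesis by simp
qed

lemma borel_measurable_vec_lambda:
  fixes f :: "'n::finite \<Rightarrow> 'a \<Rightarrow> real"
  assumes "\<And>i. f i \<in> borel_measurable M"
  shows "(\<lambda>z. \<chi> i. f i z) \<in> borel_measurable M"
  using assms by (subst borel_measurable_euclidean_space) (auto simp: Basis_vec_def inner_axis)

lemma borel_measurable_vec_nth [measurable (raw)]:
  fixes f :: "'a \<Rightarrow> real ^ 'n"
  assumes "f \<in> borel_measurable M"
  shows "(\<lambda>z. f z $ i) \<in> borel_measurable M"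
  unfolding cart_eq_inner_axis by (intro borel_measurable_inner borel_measurable_const assms)

text \<open>A weak gradient is only Lebesgue measurable and only given on \<open>C\<close>. A Borel
  version, chosen component by component and extended by 0, can be convolved on the whole
  space.\<close>

lemma Lp_borel_representative:
  fixes G :: "'a::euclidean_space \<Rightarrow> real ^ 'n"
  assumes C: "open C" and G: "G \<in> Lp p C" and p: "p > 0"
  obtains G' where "G' \<in> borel_measurable borel" "\<And>z. z \<notin> C \<Longrightarrow> G' z = 0"
    "AE z in lborel. z \<in> C \<longrightarrow> G' z = G z" "integrable lborel (\<lambda>z. norm (G' z) powr p)"
proof -
  have CL: "C \<in> sets lebesgue" using C by simp
  have Gm: "G \<in> borel_measurable (lebesgue_on C)"
    and Gi: "integrable (lebesgue_on C) (\<lambda>x. norm (G x) powr p)"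
    using G by (auto simp: Lp_def)
  have "(\<lambda>x. indicator C x *\<^sub>R G x) \<in> borel_measurable lebesgue"
    using Gm by (subst (asm) borel_measurable_restrict_space_iff) (use CL in auto)
  then have "(\<lambda>x. (indicator C x *\<^sub>R G x) $ i) \<in> borel_measurable (completion lborel)" for i
    by (rule borel_measurable_vec_nth)
  then have "\<exists>g\<in>borel_measurable lborel. AE x in lborel. (indicator C x *\<^sub>R G x) $ i = g x" for i
    by (rule completion_ex_borel_measurable_real)
  then obtain g where g: "\<And>i. g i \<in> borel_measurable lborel"
    "\<And>i. AE x in lborel. (indicator C x *\<^sub>R G x) $ i = g i x" by metis
  define G' where "G' = (\<lambda>z. indicator C z *\<^sub>R (\<chi> i. g i z))"
  have G'm: "G' \<in> borel_measurable borel"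
  proof -
    have [measurable]: "g i \<in> borel_measurable borel" for i using g by simp
    have [measurable]: "C \<in> sets borel" using C by simp
    have "(\<lambda>z. \<chi> i. g i z) \<in> borel_measurable borel"
      by (rule borel_measurable_vec_lambda) simp
    then show ?thesis unfolding G'_def by measurable
  qed
  have "AE x in lborel. \<forall>i. (indicator C x *\<^sub>R G x) $ i = g i x"
    using g(2) by (intro AE_all_countable[THEN iffD2]) auto
  then have ae: "AE z in lborel. z \<in> C \<longrightarrow> G' z = G z"
    by eventually_elim (auto simp: G'_def vec_eq_iff)
  have "integrable (lebesgue_on C) (\<lambda>x. norm (G x) powr p) \<longleftrightarrow> integrable lborel (\<lambda>z. norm (G' z) powr p)"
  proof (rule lebesgue_on_integral_eq(2)[OF CL])
    show "AE x in lborel. indicator C x * norm (G x) powr p = norm (G' x) powr p"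
      using ae by eventually_elim (use p in \<open>auto simp: indicator_def G'_def\<close>)
    show "(\<lambda>z. norm (G' z) powr p) \<in> borel_measurable borel" using G'm by measurable
    show "(\<lambda>x. norm (G x) powr p) \<in> borel_measurable (lebesgue_on C)" using Gm by measurable
  qed
  then show ?thesis using that[OF G'm _ ae] Gi by (simp add: G'_def)
qed

definition flux :: "real \<Rightarrow> real ^ 'n \<Rightarrow> real ^ 'n" where
  "flux p v = norm v powr (p - 2) *\<^sub>R v"

lemma norm_flux: "norm (flux p v) = norm v powr (p - 1)"
  using powr_add[of "norm v" "p - 2" 1] by (cases "v = 0") (simp_all add: flux_def)

lemma flux_measurable [measurable (raw)]:
  "f \<in> borel_measurable M \<Longrightarrow> (\<lambda>x. flux p (f x)) \<in> borel_measurable M"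
  unfolding flux_def by measurable

lemma axis_0_in_Basis: "(axis i 1 :: real ^ 'n, 0 :: real) \<in> Basis"
  by (auto simp: Basis_prod_def Basis_vec_def)

lemma zero_1_in_Basis: "(0 :: real ^ 'n, 1 :: real) \<in> Basis"
  by (auto simp: Basis_prod_def)

text \<open>Testing with the reflected kernel turns the weak formulation into a pointwise identity
  between convolutions at \<open>z\<close>.\<close>

lemma mollifier_test_function:
  assumes m: "mollifier r \<eta>" and z: "cball z r \<subseteq> C"
  shows "(\<lambda>y. \<eta> (z - y)) \<in> test_functions C"
proof -
  have sub: "{y. \<eta> (z - y) \<noteq> 0} \<subseteq> cball z r"
    using mollifierD(3)[OF m] by (force simp: dist_norm)
  then have cl: "closure {y. \<eta> (z - y) \<noteq> 0} \<subseteq> cball z r" by (simp add: closure_minimal)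
  then have "compact (closure {y. \<eta> (z - y) \<noteq> 0})"
    by (meson bounded_cball bounded_subset compact_eq_bounded_closed closed_closure)
  moreover have "C_k k (\<lambda>y. \<eta> (z - y))" for k
    using C_k_reflect[OF mollifierD(1)[OF m], of k 1 z] by simp
  ultimately show ?thesis using cl z by (auto simp: test_functions_def compactly_contained_def)
qed

text \<open>The weak gradient is defined slice by slice in time, so it is tested with sections of
  the kernel. For \<open>t\<close> at distance at least \<open>r\<close> from \<open>t0\<close> the
  section is 0.\<close>

lemma mollifier_slice_test_function:
  fixes \<eta> :: "(real ^ 'n) \<times> real \<Rightarrow> real"
  assumes m: "mollifier r \<eta>" and z: "cball (x0, t0) r \<subseteq> U \<times> T"
  shows "(\<lambda>x. \<eta> ((x0, t0) - (x, t))) \<in> test_functions U"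
proof -
  let ?S = "{x. \<eta> ((x0, t0) - (x, t)) \<noteq> 0}" and ?K = "(\<lambda>x. (x, t)) -` cball (x0, t0) r"
  have sub: "?S \<subseteq> ?K"
    using mollifierD(3)[OF m] by (force simp: dist_norm)
  have "closed ?K"
    by (intro continuous_closed_vimage closed_cball continuous_intros)
  then have cl: "closure ?S \<subseteq> ?K" using sub by (rule closure_minimal[rotated])
  have "?K \<subseteq> cball x0 r"
  proof
    fix x assume "x \<in> ?K"
    then have "dist (x0, t0) (x, t) \<le> r" by simp
    then show "x \<in> cball x0 r" using dist_fst_le[of "(x0, t0)" "(x, t)"] by simp
  qed
  with cl have "compact (closure ?S)"
    by (meson bounded_cball bounded_subset compact_eq_bounded_closed closed_closure subset_trans)
  moreover have "closure ?S \<subseteq> U" using cl z by auto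
  moreover have "C_k k (\<lambda>x. \<eta> ((x0, t0) - (x, t)))" for k
    using C_k_slice[OF C_k_reflect[OF mollifierD(1)[OF m], of k 1 "(x0, t0)"], of t] by simp
  ultimately show ?thesis by (auto simp: test_functions_def compactly_contained_def)
qed

lemma lmeasurable_integrable_const:
  assumes "A \<in> lmeasurable"
  shows "integrable (lebesgue_on A) (\<lambda>x. c :: real)"
proof -
  have "integrable (lebesgue_on A) (\<lambda>x. 1 :: real)"
    using assms by (simp add: integrable_restrict_space fmeasurableD lmeasurable_iff_integrable)
  from integrable_mult_right[OF this, of c] show ?thesis by simp
qed

lemma Lp_imp_integrable:
  fixes f :: "'a::euclidean_space \<Rightarrow> 'b::euclidean_space"
  assumes f: "f \<in> Lp p A" and A: "A \<in> lmeasurable" and p: "p \<ge> 1"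
  shows "integrable (lebesgue_on A) f"
proof -
  have [measurable]: "f \<in> borel_measurable (lebesgue_on A)"
    and i: "integrable (lebesgue_on A) (\<lambda>x. norm (f x) powr p)" using f by (auto simp: Lp_def)
  have c: "integrable (lebesgue_on A) (\<lambda>x. 1 :: real)" by (rule lmeasurable_integrable_const[OF A])
  show ?thesis
  proof (rule Bochner_Integration.integrable_bound)
    show "integrable (lebesgue_on A) (\<lambda>x. 1 + norm (f x) powr p)" using i c by simp
    show "AE x in lebesgue_on A. norm (f x) \<le> norm (1 + norm (f x) powr p)"
      using powr_le_one_add_powr[of "norm (f _)" 1 p] p by (intro AE_I2) (auto intro: order_trans)
  qed simp
qed

text \<open>This is the definition of the weak gradient on one time slice, tested with a section of
  the reflected kernel: the sign of the reflection cancels the sign of the integration by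
  parts.\<close>

lemma slice_mollified:
  fixes h :: "(real ^ 'n) \<times> real \<Rightarrow> real"
  assumes U: "open U" "U \<in> lmeasurable" and p: "p \<ge> 1"
    and W: "W1p_grad p U (\<lambda>x. h (x, t)) (\<lambda>x. G (x, t))"
    and m: "mollifier r \<eta>" and z: "cball (x0, t0) r \<subseteq> U \<times> T"
    and hm: "(\<lambda>x. indicator U x * h (x, t)) \<in> borel_measurable borel"
    and Gm: "(\<lambda>x. G' (x, t)) \<in> borel_measurable borel"
    and eq: "AE x in lborel. indicator U x * G (x, t) $ i = G' (x, t) $ i"
  shows "(\<integral>x. frechet_derivative \<eta> (at ((x0, t0) - (x, t))) (axis i 1, 0) * (indicator U x * h (x, t)) \<partial>lborel)
    = (\<integral>x. \<eta> ((x0, t0) - (x, t)) * G' (x, t) $ i \<partial>lborel)"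
proof -
  let ?\<phi> = "\<lambda>x. \<eta> ((x0, t0) - (x, t))"
  let ?d = "\<lambda>x. frechet_derivative \<eta> (at ((x0, t0) - (x, t))) (axis i 1, 0)"
  have UL: "U \<in> sets lebesgue" using U by simp
  have c1: "C_k (Suc 0) \<eta>" using mollifierD(1)[OF m] .
  have gr: "grad ?\<phi> x $ j = - frechet_derivative \<eta> (at ((x0, t0) - (x, t))) (axis j 1, 0)" for x j
  proof -
    have "(\<lambda>y. \<eta> ((x0, t0) - y)) differentiable (at (x, t))"
      using C_k_reflect[OF c1, of 1 "(x0, t0)"] by simp
    from frechet_derivative_at[OF has_derivative_slice[OF this], symmetric]
    show ?thesis unfolding grad_def using frechet_derivative_reflect[OF c1, of "(x0, t0)" "(x, t)"] by simp
  qed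
  have dc: "continuous_on UNIV (\<lambda>x. frechet_derivative \<eta> (at ((x0, t0) - (x, t))) (axis j 1, 0))" for j
    by (rule continuous_on_compose2[OF mollifier_partial(1)[OF m axis_0_in_Basis]]) (auto intro!: continuous_intros)
  have dm [measurable]: "(\<lambda>x. frechet_derivative \<eta> (at ((x0, t0) - (x, t))) (axis j 1, 0)) \<in> borel_measurable borel" for j
    using dc by (rule borel_measurable_continuous_onI)
  have \<phi>c: "continuous_on UNIV ?\<phi>"
    by (rule continuous_on_compose2[OF mollifierD(6)[OF m]]) (auto intro!: continuous_intros)
  have \<phi>m [measurable]: "?\<phi> \<in> borel_measurable borel"
    using \<phi>c by (rule borel_measurable_continuous_onI)
  have hL: "(\<lambda>x. h (x, t)) \<in> Lp p U" and GL: "(\<lambda>x. G (x, t)) \<in> Lp p U"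
    using W by (auto simp: W1p_grad_def)
  have hi: "integrable (lebesgue_on U) (\<lambda>x. h (x, t))" and Gi: "integrable (lebesgue_on U) (\<lambda>x. G (x, t))"
    using Lp_imp_integrable[OF hL U(2) p] Lp_imp_integrable[OF GL U(2) p] by auto
  have hgm: "(\<lambda>x. h (x, t)) \<in> borel_measurable (lebesgue_on U)" "(\<lambda>x. G (x, t)) \<in> borel_measurable (lebesgue_on U)"
    using hi Gi by auto
  have "grad ?\<phi> = (\<lambda>x. \<chi> j. - frechet_derivative \<eta> (at ((x0, t0) - (x, t))) (axis j 1, 0))"
    by (rule ext) (simp only: vec_eq_iff vec_lambda_beta gr simp_thms)
  then have grm: "grad ?\<phi> \<in> borel_measurable borel"
    using borel_measurable_vec_lambda[OF borel_measurable_uminus[OF dm]] by simp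
  obtain B where B: "\<And>z. \<bar>\<eta> z\<bar> \<le> B" using mollifierD(8)[OF m] by blast
  have "\<exists>L. \<forall>z. \<bar>frechet_derivative \<eta> (at z) (axis j 1, 0)\<bar> \<le> L" for j
    using mollifier_partial(4)[OF m axis_0_in_Basis] .
  then obtain L where L: "\<And>j z. \<bar>frechet_derivative \<eta> (at z) (axis j 1, 0)\<bar> \<le> L j" by metis
  have grb: "norm (grad ?\<phi> x) \<le> (\<Sum>j\<in>UNIV. L j)" for x
    using norm_le_l1_cart[of "grad ?\<phi> x"]
    by (rule order_trans) (intro sum_mono, unfold gr abs_minus_cancel, rule L)
  have i1: "integrable (lebesgue_on U) (\<lambda>x. h (x, t) *\<^sub>R grad ?\<phi> x)"
  proof (rule Bochner_Integration.integrable_bound)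
    show "integrable (lebesgue_on U) (\<lambda>x. (\<Sum>j\<in>UNIV. L j) * h (x, t))" using hi by simp
    show "(\<lambda>x. h (x, t) *\<^sub>R grad ?\<phi> x) \<in> borel_measurable (lebesgue_on U)"
      using hgm borel_imp_lebesgue_on[OF grm] by measurable
    show "AE x in lebesgue_on U. norm (h (x, t) *\<^sub>R grad ?\<phi> x) \<le> norm ((\<Sum>j\<in>UNIV. L j) * h (x, t))"
    proof (intro AE_I2)
      fix x
      have "norm (h (x, t) *\<^sub>R grad ?\<phi> x) = \<bar>h (x, t)\<bar> * norm (grad ?\<phi> x)" by simp
      also have "\<dots> \<le> \<bar>h (x, t)\<bar> * \<bar>\<Sum>j\<in>UNIV. L j\<bar>"
        by (rule mult_left_mono) (use grb[of x] in auto)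
      finally show "norm (h (x, t) *\<^sub>R grad ?\<phi> x) \<le> norm ((\<Sum>j\<in>UNIV. L j) * h (x, t))"
        by (simp add: abs_mult mult.commute)
    qed
  qed
  have i2: "integrable (lebesgue_on U) (\<lambda>x. ?\<phi> x *\<^sub>R G (x, t))"
  proof (rule Bochner_Integration.integrable_bound)
    show "integrable (lebesgue_on U) (\<lambda>x. B *\<^sub>R G (x, t))" using Gi by simp
    show "(\<lambda>x. ?\<phi> x *\<^sub>R G (x, t)) \<in> borel_measurable (lebesgue_on U)"
      using hgm borel_imp_lebesgue_on[OF \<phi>m] by measurable
    show "AE x in lebesgue_on U. norm (?\<phi> x *\<^sub>R G (x, t)) \<le> norm (B *\<^sub>R G (x, t))"
      using B order_trans[OF B abs_ge_self] by (intro AE_I2) (auto intro!: mult_right_mono)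
  qed
  have "(\<integral>x. h (x, t) *\<^sub>R grad ?\<phi> x \<partial>lebesgue_on U) = - (\<integral>x. ?\<phi> x *\<^sub>R G (x, t) \<partial>lebesgue_on U)"
    using W mollifier_slice_test_function[OF m z, of t] unfolding W1p_grad_def by blast
  then have "(\<integral>x. h (x, t) *\<^sub>R grad ?\<phi> x \<partial>lebesgue_on U) $ i = - ((\<integral>x. ?\<phi> x *\<^sub>R G (x, t) \<partial>lebesgue_on U) $ i)"
    by simp
  also have "(\<integral>x. h (x, t) *\<^sub>R grad ?\<phi> x \<partial>lebesgue_on U) $ i = (\<integral>x. h (x, t) * grad ?\<phi> x $ i \<partial>lebesgue_on U)"
    using integral_bounded_linear[OF bounded_linear_vec_nth i1, of i] by simp
  also have "(\<integral>x. ?\<phi> x *\<^sub>R G (x, t) \<partial>lebesgue_on U) $ i = (\<integral>x. ?\<phi> x * G (x, t) $ i \<partial>lebesgue_on U)"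
    using integral_bounded_linear[OF bounded_linear_vec_nth i2, of i] by simp
  also have "(\<integral>x. h (x, t) * grad ?\<phi> x $ i \<partial>lebesgue_on U) = (\<integral>x. - (?d x * (indicator U x * h (x, t))) \<partial>lborel)"
  proof (rule lebesgue_on_integral_eq(1)[OF UL])
    show "(\<lambda>x. h (x, t) * grad ?\<phi> x $ i) \<in> borel_measurable (lebesgue_on U)"
      unfolding gr using hgm(1) borel_imp_lebesgue_on[OF dm] by measurable
    show "(\<lambda>x. - (?d x * (indicator U x * h (x, t)))) \<in> borel_measurable borel"
      using hm by measurable
    show "AE x in lborel. indicator U x * (h (x, t) * grad ?\<phi> x $ i) = - (?d x * (indicator U x * h (x, t)))"
      unfolding gr by simp
  qed
  also have "(\<integral>x. ?\<phi> x * G (x, t) $ i \<partial>lebesgue_on U) = (\<integral>x. ?\<phi> x * G' (x, t) $ i \<partial>lborel)"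
  proof (rule lebesgue_on_integral_eq(1)[OF UL])
    show "(\<lambda>x. ?\<phi> x * G (x, t) $ i) \<in> borel_measurable (lebesgue_on U)"
      using hgm(2) borel_imp_lebesgue_on[OF \<phi>m] by measurable
    show "(\<lambda>x. ?\<phi> x * G' (x, t) $ i) \<in> borel_measurable borel"
      using Gm by measurable
    show "AE x in lborel. indicator U x * (?\<phi> x * G (x, t) $ i) = ?\<phi> x * G' (x, t) $ i"
      using eq
    proof eventually_elim
      case (elim x)
      show ?case unfolding elim[symmetric] by simp
    qed
  qed
  finally show ?thesis by simp
qed

lemma integral_lborel_prod_snd:
  fixes f :: "'a::euclidean_space \<times> 'b::euclidean_space \<Rightarrow> real"
  assumes "integrable lborel f"
  shows "(\<integral>z. f z \<partial>lborel) = (\<integral>t. (\<integral>x. f (x, t) \<partial>lborel) \<partial>lborel)"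
    "(\<lambda>t. \<integral>x. f (x, t) \<partial>lborel) \<in> borel_measurable lborel"
proof -
  have i: "integrable (lborel \<Otimes>\<^sub>M lborel) (case_prod (\<lambda>x t. f (x, t)))"
    using assms by (simp add: lborel_prod)
  show "(\<integral>z. f z \<partial>lborel) = (\<integral>t. (\<integral>x. f (x, t) \<partial>lborel) \<partial>lborel)"
    using lborel_pair.integral_snd[OF i] by (simp add: lborel_prod)
  show "(\<lambda>t. \<integral>x. f (x, t) \<partial>lborel) \<in> borel_measurable lborel"
    using lborel_pair.integrable_snd[OF i] by auto
qed

lemma AE_lborel_prod_swap:
  fixes P :: "'a::euclidean_space \<times> 'b::euclidean_space \<Rightarrow> bool"
  assumes "AE z in lborel. P z"
  shows "AE t in lborel. AE x in lborel. P (x, t)"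
proof -
  \<comment> \<open>\<open>P\<close> may fail to be measurable, so an enclosing Borel null set is
    sliced instead.\<close>
  obtain N where N: "{z \<in> space lborel. \<not> P z} \<subseteq> N" "emeasure lborel N = 0" "N \<in> sets lborel"
    using AE_E[OF assms] .
  then have "AE z in lborel. z \<notin> N" by (intro AE_not_in null_setsI)
  then have "AE z in lborel \<Otimes>\<^sub>M lborel. z \<notin> N" unfolding lborel_prod .
  then have "AE x in lborel. AE t in lborel. (x, t) \<notin> N" by (rule lborel_pair.AE_pair)
  moreover have "{z \<in> space (lborel \<Otimes>\<^sub>M lborel). (fst z, snd z) \<notin> N} \<in> sets (lborel \<Otimes>\<^sub>M lborel)"
  proof -
    have "{z \<in> space (lborel \<Otimes>\<^sub>M lborel). (fst z, snd z) \<notin> N} = - N" by (auto simp: lborel_prod)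
    moreover have "- N \<in> sets (lborel \<Otimes>\<^sub>M lborel)"
      unfolding lborel_prod using N(3) by (simp add: borel_comp)
    ultimately show ?thesis by (simp only:)
  qed
  ultimately have "AE t in lborel. AE x in lborel. (x, t) \<notin> N"
    using lborel_pair.AE_commute[of "\<lambda>x t. (x, t) \<notin> N"] by blast
  then show ?thesis
  proof eventually_elim
    case (elim t)
    then show ?case by eventually_elim (use N(1) in auto)
  qed
qed

text \<open>The last two conclusions say, with all derivatives on the kernel, that the divergence of
  the mollified flux is the time derivative of the mollified solution, and that the spatial gradient
  of the mollified solution is the mollified \<open>G\<close>. One Borel field \<open>G\<close>
  serves for all kernels, so the radius can tend to 0 afterwards. The gradient identity is
  integrated over the time slices, of which almost every one lies in the Sobolev space.\<close>

lemma weak_solution_mollified: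
  fixes h :: "(real ^ 'n) \<times> real \<Rightarrow> real"
  assumes p: "p > 1" and w: "weak_solution p \<Theta> (\<lambda>z. ereal (h z))" and c: "continuous_on \<Theta> h"
    and U: "open U" "t1 < t2" and C: "C = U \<times> {t1<..<t2}" "C \<Subset> \<Theta>"
  obtains G :: "(real ^ 'n) \<times> real \<Rightarrow> real ^ 'n"
  where "G \<in> borel_measurable borel" "integrable lborel (\<lambda>z. norm (G z) powr p)" "\<And>z. z \<notin> C \<Longrightarrow> G z = 0"
    "\<And>i. integrable lborel (\<lambda>z. G z $ i)" "\<And>i. integrable lborel (\<lambda>z. flux p (G z) $ i)"
    "integrable lborel (\<lambda>z. indicator C z * h z)"
    "\<And>r \<eta> z. mollifier r \<eta> \<Longrightarrow> cball z r \<subseteq> C \<Longrightarrow>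
       (\<Sum>i\<in>UNIV. conv (\<lambda>y. frechet_derivative \<eta> (at y) (axis i 1, 0)) (\<lambda>y. flux p (G y) $ i) z)
       = conv (\<lambda>y. frechet_derivative \<eta> (at y) (0, 1)) (\<lambda>y. indicator C y * h y) z"
    "\<And>r \<eta> z i. mollifier r \<eta> \<Longrightarrow> cball z r \<subseteq> C \<Longrightarrow>
       conv (\<lambda>y. frechet_derivative \<eta> (at y) (axis i 1, 0)) (\<lambda>y. indicator C y * h y) z
       = conv \<eta> (\<lambda>y. G y $ i) z"
proof -
  have "\<exists>G. LpW1p_grad p U t1 t2 h G \<and> (\<forall>\<phi>\<in>test_functions C.
                (\<integral>z. (norm (G z) powr (p - 2) *\<^sub>R G z) \<bullet> grad_x \<phi> z \<partial>lebesgue_on C)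
                - (\<integral>z. h z * deriv_t \<phi> z \<partial>lebesgue_on C) = 0)"
    using w[unfolded weak_solution_def, rule_format, OF U C(2)[unfolded C(1)]]
    by (simp only: Let_def C(1) real_of_ereal.simps)
  then obtain G0 where G0: "LpW1p_grad p U t1 t2 h G0" and weak: "\<And>\<phi>. \<phi> \<in> test_functions C \<Longrightarrow>
                (\<integral>z. (norm (G0 z) powr (p - 2) *\<^sub>R G0 z) \<bullet> grad_x \<phi> z \<partial>lebesgue_on C)
                - (\<integral>z. h z * deriv_t \<phi> z \<partial>lebesgue_on C) = 0"
    by blast
  have openC: "open C" unfolding C(1) using U by (intro open_Times) auto
  then have CL: "C \<in> sets lebesgue" and Cb [measurable]: "C \<in> sets borel" by auto
  have compC: "compact (closure C)" "closure C \<subseteq> \<Theta>" using C(2) by (auto simp: compactly_contained_def)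
  have bC: "bounded C" using compC(1) compact_imp_bounded bounded_subset closure_subset by blast
  have UL: "U \<in> lmeasurable"
  proof -
    have "U \<subseteq> fst ` C" using U(2) by (auto simp: C(1) image_iff intro!: bexI[of _ "(t1+t2)/2"])
    then have "bounded U" using bC bounded_fst bounded_subset by blast
    then show ?thesis using U(1) by (rule lmeasurable_open)
  qed
  define v where "v = (\<lambda>z. indicator C z * h z)"
  have v0: "v (x, t) = indicator {t1<..<t2} t * (indicator U x * h (x, t))" for x t
    by (auto simp: v_def C(1) indicator_def)
  have vm [measurable]: "v \<in> borel_measurable borel"
  proof -
    have "continuous_on C h" using compC(2) closure_subset[of C] by (intro continuous_on_subset[OF c]) auto
    then have "(\<lambda>z. indicator C z *\<^sub>R h z) \<in> borel_measurable borel"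
      using Cb by (intro borel_measurable_continuous_on_indicator) auto
    then show ?thesis by (simp add: v_def)
  qed
  have indC: "integrable lborel (indicator C :: _ \<Rightarrow> real)"
    using emeasure_bounded_finite[OF bC] by (intro integrable_real_indicator) auto
  have vi: "integrable lborel v"
  proof -
    have "compact (h ` closure C)"
      using compC c by (intro compact_continuous_image) (auto intro: continuous_on_subset)
    from compact_imp_bounded[OF this] obtain B where "\<forall>y\<in>h ` closure C. norm y \<le> B" unfolding bounded_iff ..
    then have B: "\<And>z. z \<in> C \<Longrightarrow> \<bar>h z\<bar> \<le> B" using closure_subset by force
    show ?thesis
    proof (rule Bochner_Integration.integrable_bound)
      show "integrable lborel (\<lambda>z. B * indicator C z)" using indC by simp
      show "AE z in lborel. norm (v z) \<le> norm (B * indicator C z)"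
        by (intro AE_I2) (use B in \<open>force simp: v_def indicator_def\<close>)
    qed simp
  qed
  have G0L: "G0 \<in> Lp p C" using G0 by (simp add: LpW1p_grad_def C(1))
  obtain G where G: "G \<in> borel_measurable borel" "\<And>z. z \<notin> C \<Longrightarrow> G z = 0"
    "AE z in lborel. z \<in> C \<longrightarrow> G z = G0 z" "integrable lborel (\<lambda>z. norm (G z) powr p)"
    by (rule Lp_borel_representative[OF openC G0L]) (use p in simp, blast)
  note [measurable] = G(1)
  \<comment> \<open>\<open>C\<close> has finite measure, so every power of |G| between 0 and p is
    integrable: exponent 1 is needed for the gradient, p - 1 for the flux.\<close>
  have intq: "integrable lborel f"
    if f: "f \<in> borel_measurable borel" "\<And>z. \<bar>f z\<bar> \<le> norm (G z) powr q" and q: "q > 0" "q \<le> p"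
    for q and f :: "(real ^ 'n) \<times> real \<Rightarrow> real"
  proof (rule Bochner_Integration.integrable_bound)
    show "integrable lborel (\<lambda>z. indicator C z + norm (G z) powr p)" using indC G(4) by simp
    show "AE z in lborel. norm (f z) \<le> norm (indicator C z + norm (G z) powr p)"
    proof (intro AE_I2)
      fix z
      have "\<bar>f z\<bar> \<le> indicator C z + norm (G z) powr p"
        using f(2)[of z] powr_le_one_add_powr[of "norm (G z)" q p] q G(2)[of z]
        by (cases "z \<in> C") auto
      then show "norm (f z) \<le> norm (indicator C z + norm (G z) powr p)" by simp
    qed
  qed (use f in simp)
  have Gi: "integrable lborel (\<lambda>z. G z $ i)" for i
    by (rule intq[where q=1]) (use component_le_norm_cart p in auto)
  have Fi: "integrable lborel (\<lambda>z. flux p (G z) $ i)" for i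
    by (rule intq[where q="p-1"]) (use component_le_norm_cart[of "flux p (G _)"] p in \<open>auto simp: norm_flux\<close>)
  show ?thesis
  proof (rule that[OF G(1,4,2) Gi Fi])
    show "integrable lborel (\<lambda>z. indicator C z * h z)" using vi by (simp add: v_def)
  next
    fix r :: real and \<eta> :: "(real ^ 'n) \<times> real \<Rightarrow> real" and z assume m: "mollifier r \<eta>" and z: "cball z r \<subseteq> C"
    let ?\<phi> = "\<lambda>y. \<eta> (z - y)"
    have c1: "C_k (Suc 0) \<eta>" using mollifierD(1)[OF m] .
    have gr: "grad_x ?\<phi> y = (\<chi> i. - frechet_derivative \<eta> (at (z - y)) (axis i 1, 0))" for y
      unfolding grad_x_def using frechet_derivative_reflect[OF c1] by simp
    have dt: "deriv_t ?\<phi> y = - frechet_derivative \<eta> (at (z - y)) (0, 1)" for y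
      unfolding deriv_t_def using frechet_derivative_reflect[OF c1] by simp
    have dm [measurable]: "(\<lambda>y. frechet_derivative \<eta> (at (z - y)) e) \<in> borel_measurable borel" if "e \<in> Basis" for e
      by (rule measurable_compose[OF _ mollifier_partial(2)[OF m that]]) simp
    note dmi = dm[OF axis_0_in_Basis] note dmt = dm[OF zero_1_in_Basis]
    note [measurable] = dmi dmt
    have G0m: "G0 \<in> borel_measurable (lebesgue_on C)" using G0L by (simp add: Lp_def)
    have hm: "h \<in> borel_measurable (lebesgue_on C)"
      using G0 by (simp add: LpW1p_grad_def C(1) Lp_def)
    have grm: "grad_x ?\<phi> \<in> borel_measurable borel"
      unfolding gr[abs_def] by (intro borel_measurable_vec_lambda borel_measurable_uminus dmi)
    have ki: "integrable lborel (\<lambda>y. frechet_derivative \<eta> (at (z - y)) (axis i 1, 0) * flux p (G y) $ i)" for i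
    proof -
      obtain L where L: "\<And>z. \<bar>frechet_derivative \<eta> (at z) (axis i 1, 0)\<bar> \<le> L"
        using mollifier_partial(4)[OF m axis_0_in_Basis] by blast
      show ?thesis by (rule integrable_conv_kernel[OF Fi mollifier_partial(2)[OF m axis_0_in_Basis] L])
    qed
    have "(\<integral>y. flux p (G0 y) \<bullet> grad_x ?\<phi> y \<partial>lebesgue_on C)
      = (\<integral>y. - (\<Sum>i\<in>UNIV. frechet_derivative \<eta> (at (z - y)) (axis i 1, 0) * flux p (G y) $ i) \<partial>lborel)"
    proof (rule lebesgue_on_integral_eq(1)[OF CL])
      show "(\<lambda>y. flux p (G0 y) \<bullet> grad_x ?\<phi> y) \<in> borel_measurable (lebesgue_on C)"
        using G0m borel_imp_lebesgue_on[OF grm] by measurable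
      show "(\<lambda>y. - (\<Sum>i\<in>UNIV. frechet_derivative \<eta> (at (z - y)) (axis i 1, 0) * flux p (G y) $ i)) \<in> borel_measurable borel"
        by measurable
      show "AE y in lborel. indicator C y * (flux p (G0 y) \<bullet> grad_x ?\<phi> y) =
             - (\<Sum>i\<in>UNIV. frechet_derivative \<eta> (at (z - y)) (axis i 1, 0) * flux p (G y) $ i)"
        using G(3)
      proof eventually_elim
        case (elim y)
        show ?case
        proof (cases "y \<in> C")
          case True
          then show ?thesis using elim by (simp add: gr inner_vec_def sum_negf mult.commute)
        next
          case False
          then show ?thesis using G(2) by (simp add: flux_def)
        qed
      qed
    qed
    also have "\<dots> = - (\<Sum>i\<in>UNIV. conv (\<lambda>y. frechet_derivative \<eta> (at y) (axis i 1, 0)) (\<lambda>y. flux p (G y) $ i) z)"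
      using ki by (simp add: conv_def)
    finally have 1: "(\<integral>y. flux p (G0 y) \<bullet> grad_x ?\<phi> y \<partial>lebesgue_on C)
      = - (\<Sum>i\<in>UNIV. conv (\<lambda>y. frechet_derivative \<eta> (at y) (axis i 1, 0)) (\<lambda>y. flux p (G y) $ i) z)" .
    have "(\<integral>y. h y * deriv_t ?\<phi> y \<partial>lebesgue_on C) = (\<integral>y. - (frechet_derivative \<eta> (at (z - y)) (0, 1) * v y) \<partial>lborel)"
    proof (rule lebesgue_on_integral_eq(1)[OF CL])
      show "(\<lambda>y. h y * deriv_t ?\<phi> y) \<in> borel_measurable (lebesgue_on C)"
        unfolding dt using hm borel_imp_lebesgue_on[OF dmt] by measurable
      show "(\<lambda>y. - (frechet_derivative \<eta> (at (z - y)) (0, 1) * v y)) \<in> borel_measurable borel"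
        by measurable
    qed (simp add: dt v_def)
    then have 2: "(\<integral>y. h y * deriv_t ?\<phi> y \<partial>lebesgue_on C) = - conv (\<lambda>y. frechet_derivative \<eta> (at y) (0, 1)) v z"
      by (simp add: conv_def)
    show "(\<Sum>i\<in>UNIV. conv (\<lambda>y. frechet_derivative \<eta> (at y) (axis i 1, 0)) (\<lambda>y. flux p (G y) $ i) z)
       = conv (\<lambda>y. frechet_derivative \<eta> (at y) (0, 1)) (\<lambda>y. indicator C y * h y) z"
      using weak[OF mollifier_test_function[OF m z]] 1 2 unfolding flux_def v_def by simp
  next
    fix r :: real and \<eta> :: "(real ^ 'n) \<times> real \<Rightarrow> real" and z i assume m: "mollifier r \<eta>" and z: "cball z r \<subseteq> C"
    obtain x0 t0 where z0: "z = (x0, t0)" by (cases z)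
    let ?d = "\<lambda>y. frechet_derivative \<eta> (at y) (axis i 1, 0)"
    note dm [measurable] = mollifier_partial(2)[OF m axis_0_in_Basis, of i]
    note \<eta>m [measurable] = mollifierD(7)[OF m]
    obtain L where L: "\<And>z. \<bar>frechet_derivative \<eta> (at z) (axis i 1, 0)\<bar> \<le> L"
      using mollifier_partial(4)[OF m axis_0_in_Basis] by blast
    have i1: "integrable lborel (\<lambda>y. ?d (z - y) * v y)" by (rule integrable_conv_kernel[OF vi dm L])
    have i2: "integrable lborel (\<lambda>y. \<eta> (z - y) * G y $ i)" by (rule integrable_mollifier_kernel[OF m Gi])
    have W: "AE t in lborel. t \<in> {t1<..<t2} \<longrightarrow> W1p_grad p U (\<lambda>x. h (x, t)) (\<lambda>x. G0 (x, t))"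
    proof -
      have "AE t in lebesgue_on {t1<..<t2}. W1p_grad p U (\<lambda>x. h (x, t)) (\<lambda>x. G0 (x, t))"
        using G0 by (simp add: LpW1p_grad_def)
      then show ?thesis by (subst (asm) AE_restrict_space_iff) (auto simp: AE_completion_iff)
    qed
    have E: "AE t in lborel. AE x in lborel. (x, t) \<in> C \<longrightarrow> G (x, t) = G0 (x, t)"
      by (rule AE_lborel_prod_swap[OF G(3)])
    have "conv ?d v z = (\<integral>t. (\<integral>x. ?d (z - (x, t)) * v (x, t) \<partial>lborel) \<partial>lborel)"
      unfolding conv_def by (rule integral_lborel_prod_snd(1)[OF i1])
    also have "\<dots> = (\<integral>t. (\<integral>x. \<eta> (z - (x, t)) * G (x, t) $ i \<partial>lborel) \<partial>lborel)"
    proof (rule integral_cong_AE)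
      show "AE t in lborel. (\<integral>x. ?d (z - (x, t)) * v (x, t) \<partial>lborel) = (\<integral>x. \<eta> (z - (x, t)) * G (x, t) $ i \<partial>lborel)"
        using W E
      proof eventually_elim
        case (elim t)
        show ?case
        proof (cases "t \<in> {t1<..<t2}")
          case True
          have "(\<integral>x. ?d (z - (x, t)) * v (x, t) \<partial>lborel)
            = (\<integral>x. frechet_derivative \<eta> (at ((x0, t0) - (x, t))) (axis i 1, 0) * (indicator U x * h (x, t)) \<partial>lborel)"
            using True by (simp add: z0 v0)
          also have "\<dots> = (\<integral>x. \<eta> ((x0, t0) - (x, t)) * G (x, t) $ i \<partial>lborel)"
          proof (rule slice_mollified[OF U(1) UL _ _ m])
            show "1 \<le> p" using p by simp
            show "W1p_grad p U (\<lambda>x. h (x, t)) (\<lambda>x. G0 (x, t))" using elim(1) True by simp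
            show "cball (x0, t0) r \<subseteq> U \<times> {t1<..<t2}" using z by (simp add: z0 C(1))
            have "(\<lambda>x. v (x, t)) \<in> borel_measurable borel"
              by (rule measurable_compose[OF _ vm]) simp
            then show "(\<lambda>x. indicator U x * h (x, t)) \<in> borel_measurable borel" using True by (simp add: v0)
            show "(\<lambda>x. G (x, t)) \<in> borel_measurable borel"
              by (rule measurable_compose[OF _ G(1)]) simp
            show "AE x in lborel. indicator U x * G0 (x, t) $ i = G (x, t) $ i"
              using elim(2)
            proof eventually_elim
              case (elim x)
              show ?case using elim G(2)[of "(x, t)"] True by (cases "x \<in> U") (auto simp: C(1))
            qed
          qed
          finally show ?thesis by (simp add: z0)
        next
          case False
          then have "(x, t) \<notin> C" for x by (auto simp: C(1))
          then show ?thesis using False G(2) by (simp add: v0)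
        qed
      qed
    qed (use integral_lborel_prod_snd(2)[OF i1] integral_lborel_prod_snd(2)[OF i2] in auto)
    also have "\<dots> = conv \<eta> (\<lambda>y. G y $ i) z"
      unfolding conv_def by (rule integral_lborel_prod_snd(1)[OF i2, symmetric])
    finally show "conv ?d (\<lambda>y. indicator C y * h y) z = conv \<eta> (\<lambda>y. G y $ i) z" by (simp add: v_def)
  qed
qed

subsection \<open>Estimates for the \<open>p\<close>-flux\<close>

text \<open>By Cauchy-Schwarz the mixed terms are bounded through the norms, and what remains is the
  product of |a|^(p-1) - |b|^(p-1) and |a| - |b|, two factors of equal sign.\<close>

lemma flux_monotone:
  fixes a b :: "real ^ 'n"
  assumes p: "p > 1"
  shows "0 \<le> (flux p a - flux p b) \<bullet> (a - b)"
proof -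
  have n: "flux p v \<bullet> v = norm v powr (p - 1) * norm v" for v :: "real ^ 'n"
    using powr_add[of "norm v" "p - 2" 1]
    by (cases "v = 0") (simp_all add: flux_def dot_square_norm power2_eq_square)
  have "flux p a \<bullet> b \<le> norm a powr (p - 1) * norm b"
    using norm_cauchy_schwarz[of "flux p a" b] by (simp add: norm_flux)
  moreover have "flux p b \<bullet> a \<le> norm b powr (p - 1) * norm a"
    using norm_cauchy_schwarz[of "flux p b" a] by (simp add: norm_flux)
  moreover have "0 \<le> (norm a powr (p - 1) - norm b powr (p - 1)) * (norm a - norm b)"
  proof (cases "norm a \<le> norm b")
    case True
    then have "norm a powr (p - 1) \<le> norm b powr (p - 1)" using p by (intro powr_mono2) auto
    then show ?thesis using True by (intro mult_nonpos_nonpos) auto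
  next
    case False
    then have "norm b powr (p - 1) \<le> norm a powr (p - 1)" using p by (intro powr_mono2) auto
    then show ?thesis using False by (intro mult_nonneg_nonneg) auto
  qed
  ultimately show ?thesis by (simp add: inner_diff_left inner_diff_right n algebra_simps)
qed

section \<open>Domination of products of convolutions\<close>

lemma conv_nonneg:
  assumes "mollifier r \<eta>" "\<And>y. 0 \<le> u y"
  shows "0 \<le> conv \<eta> u z"
  unfolding conv_def
  by (intro Bochner_Integration.integral_nonneg mult_nonneg_nonneg mollifierD(2)[OF assms(1)] assms(2))

text \<open>Averaging against a probability density preserves affine bounds. The factor
  \<open>c\<close> may depend on \<open>z\<close>: in \<open>conv_product_bound\<close> it is built
  from another convolution at the same point.\<close>

lemma conv_abs_le:
  assumes m: "mollifier r \<eta>" and u: "integrable lborel u" and w: "integrable lborel w"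
    and c: "0 \<le> c" and le: "\<And>y. \<bar>u y\<bar> * c \<le> A + B * w y"
  shows "\<bar>conv \<eta> u z\<bar> * c \<le> A + B * conv \<eta> w z"
proof -
  note iu = integrable_mollifier_kernel[OF m u, of z] and iw = integrable_mollifier_kernel[OF m w, of z]
  note i1 = mollifier_integral_reflect[OF m, of z]
  have "norm (\<integral>y. (\<eta> (z - y) * u y) * c \<partial>lborel) \<le> (\<integral>y. A * \<eta> (z - y) + B * (\<eta> (z - y) * w y) \<partial>lborel)"
  proof (rule Bochner_Integration.integral_norm_bound_integral)
    fix y
    have "norm (\<eta> (z - y) * u y * c) = \<eta> (z - y) * (\<bar>u y\<bar> * c)"
      using mollifierD(2)[OF m, of "z - y"] c by (simp add: abs_mult)
    also have "\<dots> \<le> \<eta> (z - y) * (A + B * w y)" by (intro mult_left_mono le mollifierD(2)[OF m])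
    finally show "norm (\<eta> (z - y) * u y * c) \<le> A * \<eta> (z - y) + B * (\<eta> (z - y) * w y)"
      by (simp add: algebra_simps)
  qed (use iu iw i1 in auto)
  also have "\<dots> = A + B * conv \<eta> w z" using iw i1 by (simp add: conv_def)
  finally show ?thesis using c by (simp add: conv_def abs_mult)
qed

text \<open>Young's inequality with coefficient 1/2 on b^p, small enough to be absorbed on the left
  in \<open>conv_product_bound\<close>. Comparing 2a with b decides which term dominates.\<close>

lemma young_half:
  fixes a b p :: real
  assumes a: "0 \<le> a" and b: "0 \<le> b" and p: "p > 1"
  shows "a * b powr (p - 1) \<le> b powr p / 2 + 2 powr p / 2 * a powr p"
proof -
  have bp: "b powr (p - 1) * b = b powr p"
    using b powr_add[of b "p - 1" 1] by (cases "b = 0") auto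
  show ?thesis
  proof (cases "2 * a \<le> b")
    case True
    have "a * b powr (p - 1) \<le> (b / 2) * b powr (p - 1)" using True by (intro mult_right_mono) auto
    also have "\<dots> = b powr p / 2" using bp by (simp add: mult.commute)
    also have "\<dots> \<le> b powr p / 2 + 2 powr p / 2 * a powr p" by simp
    finally show ?thesis .
  next
    case False
    have "a * b powr (p - 1) \<le> a * (2 * a) powr (p - 1)"
      using False a b p by (intro mult_left_mono powr_mono2) auto
    also have "\<dots> = (2 * a) powr (p - 1) * (2 * a) / 2" by simp
    also have "\<dots> = (2 * a) powr p / 2"
      using a powr_add[of "2 * a" "p - 1" 1] by (cases "a = 0") auto
    also have "\<dots> = 2 powr p / 2 * a powr p" using a by (simp add: powr_mult)
    also have "\<dots> \<le> b powr p / 2 + 2 powr p / 2 * a powr p" by simp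
    finally show ?thesis .
  qed
qed

lemma young_one:
  fixes a b p :: real
  assumes a: "0 \<le> a" and b: "0 \<le> b" and p: "p > 1"
  shows "a powr (p - 1) * b \<le> a powr p + b powr p"
proof (cases "a \<le> b")
  case True
  have "a powr (p - 1) * b \<le> b powr (p - 1) * b" using True a p by (intro mult_right_mono powr_mono2 b) auto
  also have "\<dots> = b powr p" using b powr_add[of b "p - 1" 1] by (cases "b = 0") auto
  finally show ?thesis using powr_ge_zero[of a p] by linarith
next
  case False
  have "a powr (p - 1) * b \<le> a powr (p - 1) * a" using False by (intro mult_left_mono) auto
  also have "\<dots> = a powr p" using a powr_add[of a "p - 1" 1] by (cases "a = 0") auto
  finally show ?thesis using powr_ge_zero[of b p] by linarith
qed

text \<open>The product of a mollified flux component and a mollified gradient component is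
  dominated by \<open>g\<close>, the mollified |G|^p, which converges in L^1. With b = |conv v z|,
  averaging \<open>young_half\<close> gives b^p at most b^p / 2 + 2^p g / 2; absorbing the half
  yields b^p at most 2^p g, in place of Jensen's inequality. Then \<open>young_one\<close>, averaged
  with b fixed, bounds the product.\<close>

lemma conv_product_bound:
  fixes G :: "'a::euclidean_space \<Rightarrow> real ^ 'n"
  assumes m: "mollifier r \<eta>" and p: "p > 1" and G: "integrable lborel (\<lambda>z. norm (G z) powr p)"
    and u: "integrable lborel u" "\<And>z. \<bar>u z\<bar> \<le> norm (G z) powr (p - 1)"
    and v: "integrable lborel v" "\<And>z. \<bar>v z\<bar> \<le> norm (G z)"
  defines "g \<equiv> conv \<eta> (\<lambda>z. norm (G z) powr p)"
  shows "\<bar>conv \<eta> u z\<bar> * \<bar>conv \<eta> v z\<bar> \<le> (1 + 2 powr p) * g z"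
    "\<bar>conv \<eta> u z\<bar> \<le> 1 + g z" "\<bar>conv \<eta> v z\<bar> \<le> 1 + g z" "0 \<le> g z"
proof -
  let ?b = "\<bar>conv \<eta> v z\<bar>"
  show "\<bar>conv \<eta> u z\<bar> \<le> 1 + g z"
  proof -
    have "\<bar>u y\<bar> * 1 \<le> 1 + 1 * norm (G y) powr p" for y
      using u(2)[of y] powr_le_one_add_powr[of "norm (G y)" "p - 1" p] p by simp
    from conv_abs_le[OF m u(1) G zero_le_one this] show ?thesis by (simp add: g_def)
  qed
  show "\<bar>conv \<eta> v z\<bar> \<le> 1 + g z"
  proof -
    have "\<bar>v y\<bar> * 1 \<le> 1 + 1 * norm (G y) powr p" for y
      using v(2)[of y] powr_le_one_add_powr[of "norm (G y)" 1 p] p by simp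
    from conv_abs_le[OF m v(1) G zero_le_one this] show ?thesis by (simp add: g_def)
  qed
  show "0 \<le> g z"
    unfolding g_def by (rule conv_nonneg[OF m]) simp
  have "?b * ?b powr (p - 1) \<le> ?b powr p / 2 + 2 powr p / 2 * g z"
    unfolding g_def
  proof (rule conv_abs_le[OF m v(1) G])
    fix y
    have "\<bar>v y\<bar> * ?b powr (p - 1) \<le> norm (G y) * ?b powr (p - 1)" by (intro mult_right_mono v) auto
    also have "\<dots> \<le> ?b powr p / 2 + 2 powr p / 2 * norm (G y) powr p" by (rule young_half) (use p in auto)
    finally show "\<bar>v y\<bar> * ?b powr (p - 1) \<le> ?b powr p / 2 + 2 powr p / 2 * norm (G y) powr p" .
  qed simp
  moreover have "?b * ?b powr (p - 1) = ?b powr p"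
    using powr_add[of ?b "p - 1" 1] by (cases "conv \<eta> v z = 0") (auto simp: mult.commute)
  ultimately have bp: "?b powr p \<le> 2 powr p * g z" by simp
  have "\<bar>conv \<eta> u z\<bar> * ?b \<le> ?b powr p + 1 * g z"
    unfolding g_def
  proof (rule conv_abs_le[OF m u(1) G])
    fix y
    have "\<bar>u y\<bar> * ?b \<le> norm (G y) powr (p - 1) * ?b" by (intro mult_right_mono u) auto
    also have "\<dots> \<le> norm (G y) powr p + ?b powr p" by (rule young_one) (use p in auto)
    finally show "\<bar>u y\<bar> * ?b \<le> ?b powr p + 1 * norm (G y) powr p" by simp
  qed simp
  with bp show "\<bar>conv \<eta> u z\<bar> * \<bar>conv \<eta> v z\<bar> \<le> (1 + 2 powr p) * g z" by (simp add: algebra_simps)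
qed

lemma DERIV_pos_part_power:
  "((\<lambda>s::real. (max 0 s) ^ Suc (Suc k)) has_real_derivative real (Suc (Suc k)) * (max 0 s) ^ Suc k) (at s)"
proof -
  consider "s < 0" | "s = 0" | "s > 0" by linarith
  then show ?thesis
  proof cases
    case 1
    have "((\<lambda>_. 0) has_real_derivative 0) (at s)" by simp
    then have "((\<lambda>s::real. (max 0 s) ^ Suc (Suc k)) has_real_derivative 0) (at s)"
      by (rule has_field_derivative_transform_within_open[where S="{..<0}"]) (use 1 in auto)
    then show ?thesis using 1 by simp
  next
    case 2
    have "((\<lambda>h. (max 0 (0 + h) ^ Suc (Suc k) - max 0 0 ^ Suc (Suc k)) / h) \<longlongrightarrow> 0) (at (0::real))"
    proof (rule Lim_null_comparison)
      show "\<forall>\<^sub>F h in at (0::real). norm ((max 0 (0 + h) ^ Suc (Suc k) - max 0 0 ^ Suc (Suc k)) / h) \<le> \<bar>h\<bar> ^ Suc k"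
        unfolding eventually_at_filter
      proof (intro always_eventually allI impI)
        fix h :: real assume "h \<noteq> 0"
        then show "norm ((max 0 (0 + h) ^ Suc (Suc k) - max 0 0 ^ Suc (Suc k)) / h) \<le> \<bar>h\<bar> ^ Suc k"
          by (cases "h > 0") (simp_all del: power_Suc, simp)
      qed
      have "((\<lambda>h::real. \<bar>h\<bar> ^ Suc k) \<longlongrightarrow> \<bar>0\<bar> ^ Suc k) (at 0)" by (intro tendsto_intros)
      then show "((\<lambda>h::real. \<bar>h\<bar> ^ Suc k) \<longlongrightarrow> 0) (at 0)" by simp
    qed
    then show ?thesis unfolding DERIV_def using 2 by simp
  next
    case 3
    have "((\<lambda>s. s ^ Suc (Suc k)) has_real_derivative real (Suc (Suc k)) * s ^ Suc k) (at s)"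
      using DERIV_pow[of "Suc (Suc k)" s UNIV] by simp
    then have "((\<lambda>s::real. (max 0 s) ^ Suc (Suc k)) has_real_derivative real (Suc (Suc k)) * s ^ Suc k) (at s)"
      by (rule has_field_derivative_transform_within_open[where S="{0<..}"]) (use 3 in auto)
    then show ?thesis using 3 by simp
  qed
qed

section \<open>The radial potential and its flux\<close>

lemma has_derivative_norm_powr:
  fixes x :: "'a::euclidean_space"
  assumes q: "q > 1"
  shows "((\<lambda>x. norm x powr q) has_derivative (\<lambda>h. q * norm x powr (q - 2) * (x \<bullet> h))) (at x)"
proof (cases "x = 0")
  case True
  have "((\<lambda>x::'a. norm x powr q) has_derivative (\<lambda>h. 0)) (at 0)"
    unfolding has_derivative_at
  proof (intro conjI bounded_linear_zero)
    show "((\<lambda>h::'a. norm (norm (0 + h) powr q - norm (0::'a) powr q - 0) / norm h) \<longlongrightarrow> 0) (at 0)"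
    proof (rule Lim_null_comparison)
      show "\<forall>\<^sub>F h in at (0::'a). norm (norm (norm (0 + h) powr q - norm (0::'a) powr q - 0) / norm h) \<le> norm h powr (q - 1)"
        unfolding eventually_at_filter
      proof (intro always_eventually allI impI)
        fix h :: 'a assume "h \<noteq> 0"
        then show "norm (norm (norm (0 + h) powr q - norm (0::'a) powr q - 0) / norm h) \<le> norm h powr (q - 1)"
          using powr_diff[of "norm h" q 1] by simp
      qed
      have "((\<lambda>h::'a. norm h powr (q - 1)) \<longlongrightarrow> norm (0::'a) powr (q - 1)) (at 0)"
        by (intro tendsto_powr' tendsto_intros) (use q in auto)
      then show "((\<lambda>h::'a. norm h powr (q - 1)) \<longlongrightarrow> 0) (at 0)" by simp
    qed
  qed
  then show ?thesis using True by simp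
next
  case False
  have "((\<lambda>x. norm x powr q) has_derivative (\<lambda>h. (h \<bullet> sgn x) * (q * norm x powr (q - 1)))) (at x)"
  proof -
    have "((\<lambda>r. r powr q) has_real_derivative q * norm x powr (q - 1)) (at (norm x))"
      using False by (auto intro!: derivative_eq_intros)
    moreover have "(*) (q * norm x powr (q - 1)) = (\<lambda>h. h * (q * norm x powr (q - 1)))"
      by (rule ext) (rule mult.commute)
    ultimately have "((\<lambda>r. r powr q) has_derivative (\<lambda>h. h * (q * norm x powr (q - 1)))) (at (norm x))"
      unfolding has_field_derivative_def by (simp only:)
    then show ?thesis
      by (rule has_derivative_compose[rotated]) (rule has_derivative_norm[OF False])
  qed
  moreover have "(h \<bullet> sgn x) * (q * norm x powr (q - 1)) = q * norm x powr (q - 2) * (x \<bullet> h)" for h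
    using False powr_diff[of "norm x" "q - 1" 1]
    by (simp add: sgn_div_norm inner_commute field_simps)
  ultimately show ?thesis by simp
qed

text \<open>It is applied with the exponent p/(p-1) - 2, which is negative for p > 2: the factor x
  has to compensate the singularity of the power at 0, and above -1 it does.\<close>

lemma continuous_norm_powr_scale:
  assumes q: "q > -1"
  shows "continuous_on UNIV (\<lambda>x::'a::euclidean_space. norm x powr q *\<^sub>R x)"
proof (intro continuous_at_imp_continuous_on ballI)
  fix x :: 'a
  show "isCont (\<lambda>x. norm x powr q *\<^sub>R x) x"
  proof (cases "x = 0")
    case True
    have "((\<lambda>x::'a. norm x powr q *\<^sub>R x) \<longlongrightarrow> 0) (at 0)"
    proof (rule Lim_null_comparison)
      show "\<forall>\<^sub>F x in at (0::'a). norm (norm x powr q *\<^sub>R x) \<le> norm x powr (q + 1)"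
        unfolding eventually_at_filter
        by (intro always_eventually allI impI) (simp add: powr_add)
      have "((\<lambda>h::'a. norm h powr (q + 1)) \<longlongrightarrow> norm (0::'a) powr (q + 1)) (at 0)"
        by (intro tendsto_powr' tendsto_intros) (use q in auto)
      then show "((\<lambda>h::'a. norm h powr (q + 1)) \<longlongrightarrow> 0) (at 0)" by simp
    qed
    then show ?thesis using True by (simp add: isCont_def)
  next
    case False
    then show ?thesis by (intro continuous_intros) auto
  qed
qed

text \<open>\<open>pot_grad p a\<close> is the gradient of \<open>a |x|\<^bsup>p/(p-1)\<^esup>\<close>, the potential whose \<open>p\<close>-flux is linear in \<open>x\<close>.\<close>

definition pot_grad :: "real \<Rightarrow> real \<Rightarrow> real ^ 'n \<Rightarrow> real ^ 'n" where
  "pot_grad p a x = (a * (p / (p - 1)) * norm x powr (p / (p - 1) - 2)) *\<^sub>R x"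

lemma has_derivative_potential:
  fixes x :: "real ^ 'n"
  assumes p: "p > 1"
  shows "((\<lambda>x. a * norm x powr (p / (p - 1))) has_derivative (\<lambda>h. pot_grad p a x \<bullet> h)) (at x)"
proof -
  have "p / (p - 1) > 1" using p by simp
  from has_derivative_mult_right[OF has_derivative_norm_powr[OF this], of a x]
  show ?thesis by (simp add: pot_grad_def mult.assoc)
qed

lemma continuous_pot_grad:
  assumes p: "p > 1"
  shows "continuous_on UNIV (pot_grad p a)"
proof -
  have "p / (p - 1) - 2 > -1" using p by simp
  from continuous_norm_powr_scale[OF this]
  have "continuous_on UNIV (\<lambda>x. (a * (p / (p - 1))) *\<^sub>R (norm x powr (p / (p - 1) - 2) *\<^sub>R (x :: real ^ 'n)))"
    by (rule continuous_on_scaleR[OF continuous_on_const])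
  then show ?thesis by (simp add: pot_grad_def[abs_def])
qed

text \<open>The factor in \<open>flux p (pot_grad p a x) = pot_flux p a *\<^sub>R x\<close>. Thus
  the p-Laplacian of a |x|^(p/(p-1)) is the constant n times this number, and a linear term in t
  balances it.\<close>

definition pot_flux :: "real \<Rightarrow> real \<Rightarrow> real" where
  "pot_flux p a = (a * (p / (p - 1))) powr (p - 1)"

lemma flux_pot_grad:
  assumes p: "p > 1" and a: "a \<ge> 0"
  shows "flux p (pot_grad p a x) = pot_flux p a *\<^sub>R x"
proof (cases "x = 0 \<or> a = 0")
  case True
  then show ?thesis by (auto simp: flux_def pot_grad_def pot_flux_def)
next
  case False
  define A where "A = a * (p / (p - 1))"
  have A: "A > 0" using False a p by (simp add: A_def)
  have nx: "norm x > 0" using False by simp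
  have pg: "pot_grad p a x = (A * norm x powr (p / (p - 1) - 2)) *\<^sub>R x"
    by (simp only: pot_grad_def A_def)
  have "norm x powr (p / (p - 1) - 1) = norm x powr (p / (p - 1) - 2) * norm x"
    using nx powr_add[of "norm x" "p / (p - 1) - 2" 1] by simp
  then have n: "norm (pot_grad p a x) = A * norm x powr (p / (p - 1) - 1)"
    using A by (simp only: pg norm_scaleR abs_mult abs_of_pos abs_of_nonneg[OF powr_ge_zero] mult.assoc)
  \<comment> \<open>With q = p/(p-1) this says (q - 1)(p - 1) = 1: all powers of the norm cancel and
    x alone is left.\<close>
  have e: "(p / (p - 1) - 1) * (p - 2) + (p / (p - 1) - 2) = 0"
  proof -
    have "p / (p - 1) - 1 = 1 / (p - 1)" "p / (p - 1) - 2 = (2 - p) / (p - 1)"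
      using p by (simp_all add: field_simps)
    then show ?thesis using p by (simp add: diff_divide_distrib)
  qed
  have "flux p (pot_grad p a x) = ((A * norm x powr (p / (p - 1) - 1)) powr (p - 2) * (A * norm x powr (p / (p - 1) - 2))) *\<^sub>R x"
    unfolding flux_def n by (simp add: pg)
  also have "(A * norm x powr (p / (p - 1) - 1)) powr (p - 2) * (A * norm x powr (p / (p - 1) - 2))
      = (A powr (p - 2) * A) * (norm x powr ((p / (p - 1) - 1) * (p - 2)) * norm x powr (p / (p - 1) - 2))"
    using A by (simp add: powr_mult powr_powr)
  also have "norm x powr ((p / (p - 1) - 1) * (p - 2)) * norm x powr (p / (p - 1) - 2) = 1"
    unfolding powr_add[symmetric] e using nx by simp
  also have "A powr (p - 2) * A = A powr (p - 1)"
    using A powr_add[of A "p - 2" 1] by simp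
  finally show ?thesis by (simp add: pot_flux_def A_def)
qed

lemma continuous_potential:
  assumes p: "p > 1"
  shows "continuous_on S (\<lambda>x :: real ^ 'n. a * norm x powr (p / (p - 1)))"
  by (intro continuous_at_imp_continuous_on ballI has_derivative_continuous[OF has_derivative_potential[OF p]])

lemma fst_borel: "fst \<in> borel_measurable (borel :: ('a::euclidean_space \<times> 'b::euclidean_space) measure)"
  by (intro borel_measurable_continuous_onI continuous_intros)

lemma snd_borel: "snd \<in> borel_measurable (borel :: ('a::euclidean_space \<times> 'b::euclidean_space) measure)"
  by (intro borel_measurable_continuous_onI continuous_intros)

subsection \<open>Comparison of weak solutions with explicit supersolutions\<close>

lemma has_dderiv_cong:
  assumes "open X" "z \<in> X" "\<And>y. y \<in> X \<Longrightarrow> f y = g y" "has_dderiv f d e z"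
  shows "has_dderiv g d e z"
  unfolding has_dderiv_def
proof (rule has_field_derivative_transform_within_open)
  show "((\<lambda>s. f (z + s *\<^sub>R e)) has_real_derivative d) (at 0)" using assms(4) by (simp add: has_dderiv_def)
  show "open ((\<lambda>s. z + s *\<^sub>R e) -` X)"
    by (intro continuous_open_vimage assms(1) continuous_intros)
qed (use assms in auto)

lemma has_dderiv_mult:
  assumes "has_dderiv f d e z" "has_dderiv g d' e z"
  shows "has_dderiv (\<lambda>z. f z * g z) (d * g z + f z * d') e z"
  using DERIV_mult[OF assms[unfolded has_dderiv_def]] unfolding has_dderiv_def by (simp add: mult.commute)

lemma has_dderiv_diff:
  assumes "has_dderiv f d e z" "has_dderiv g d' e z"
  shows "has_dderiv (\<lambda>z. f z - g z) (d - d') e z"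
  using DERIV_diff[OF assms[unfolded has_dderiv_def]] unfolding has_dderiv_def .

lemma has_dderiv_add:
  assumes "has_dderiv f d e z" "has_dderiv g d' e z"
  shows "has_dderiv (\<lambda>z. f z + g z) (d + d') e z"
  using DERIV_add[OF assms[unfolded has_dderiv_def]] unfolding has_dderiv_def .

lemma has_dderiv_compose:
  assumes "has_dderiv f d e z" "(g has_real_derivative g') (at (f z))"
  shows "has_dderiv (\<lambda>z. g (f z)) (g' * d) e z"
proof -
  have "(g has_real_derivative g') (at (f (z + 0 *\<^sub>R e)))" using assms(2) by simp
  from DERIV_chain2[OF this assms(1)[unfolded has_dderiv_def]] show ?thesis unfolding has_dderiv_def .
qed

text \<open>\<open>A\<close> and the complement of \<open>S\<close> are open and cover the space; on
  the first the extension is \<open>F\<close>, on the second it is 0.\<close>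

lemma has_dderiv_cutoff:
  assumes O: "open A" and S: "closed S" "S \<subseteq> A" and z0: "\<And>z. z \<in> A - S \<Longrightarrow> F z = 0"
    and d: "\<And>z. z \<in> A \<Longrightarrow> has_dderiv F (F' z) e z"
  shows "has_dderiv (\<lambda>z. if z \<in> A then F z else 0) (if z \<in> A then F' z else 0) e z"
proof (cases "z \<in> A")
  case True
  have "has_dderiv (\<lambda>z. if z \<in> A then F z else 0) (F' z) e z"
    by (rule has_dderiv_cong[OF O True _ d[OF True]]) simp
  then show ?thesis using True by simp
next
  case False
  have "has_dderiv (\<lambda>z. 0) 0 e z" by (simp add: has_dderiv_def)
  then have "has_dderiv (\<lambda>z. if z \<in> A then F z else 0) 0 e z"
    by (rule has_dderiv_cong[rotated -1, where X="- S"]) (use S z0 False in auto)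
  then show ?thesis using False by simp
qed

section \<open>Bounded functions and integrals of cut-off derivatives\<close>

definition bounded_fun_on :: "'a set \<Rightarrow> ('a \<Rightarrow> real) \<Rightarrow> bool" where
  "bounded_fun_on S f \<longleftrightarrow> (\<exists>B. \<forall>z\<in>S. \<bar>f z\<bar> \<le> B)"

named_theorems bounded_fun_intros

lemma bounded_fun_on_const [bounded_fun_intros]: "bounded_fun_on S (\<lambda>_. c)"
  unfolding bounded_fun_on_def by blast

lemma bounded_fun_onE:
  assumes "bounded_fun_on S f"
  obtains B where "B \<ge> 0" "\<And>z. z \<in> S \<Longrightarrow> \<bar>f z\<bar> \<le> B"
proof -
  obtain B where "\<And>z. z \<in> S \<Longrightarrow> \<bar>f z\<bar> \<le> B" using assms unfolding bounded_fun_on_def by blast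
  then have "\<bar>f z\<bar> \<le> \<bar>B\<bar>" if "z \<in> S" for z using that by force
  then show ?thesis using that[of "\<bar>B\<bar>"] by simp
qed

lemma bounded_fun_on_add [bounded_fun_intros]:
  assumes "bounded_fun_on S f" "bounded_fun_on S g"
  shows "bounded_fun_on S (\<lambda>z. f z + g z)"
proof -
  obtain A where A: "\<And>z. z \<in> S \<Longrightarrow> \<bar>f z\<bar> \<le> A" using bounded_fun_onE[OF assms(1)] by metis
  obtain B where B: "\<And>z. z \<in> S \<Longrightarrow> \<bar>g z\<bar> \<le> B" using bounded_fun_onE[OF assms(2)] by metis
  have "\<bar>f z + g z\<bar> \<le> A + B" if "z \<in> S" for z using A[OF that] B[OF that] by linarith
  then show ?thesis unfolding bounded_fun_on_def by blast
qed

lemma bounded_fun_on_diff [bounded_fun_intros]: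
  assumes "bounded_fun_on S f" "bounded_fun_on S g"
  shows "bounded_fun_on S (\<lambda>z. f z - g z)"
proof -
  obtain A where A: "\<And>z. z \<in> S \<Longrightarrow> \<bar>f z\<bar> \<le> A" using bounded_fun_onE[OF assms(1)] by metis
  obtain B where B: "\<And>z. z \<in> S \<Longrightarrow> \<bar>g z\<bar> \<le> B" using bounded_fun_onE[OF assms(2)] by metis
  have "\<bar>f z - g z\<bar> \<le> A + B" if "z \<in> S" for z using A[OF that] B[OF that] by linarith
  then show ?thesis unfolding bounded_fun_on_def by blast
qed

lemma bounded_fun_on_mult [bounded_fun_intros]:
  assumes "bounded_fun_on S f" "bounded_fun_on S g"
  shows "bounded_fun_on S (\<lambda>z. f z * g z)"
proof -
  obtain A where A: "A \<ge> 0" "\<And>z. z \<in> S \<Longrightarrow> \<bar>f z\<bar> \<le> A" using bounded_fun_onE[OF assms(1)] by metis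
  obtain B where B: "B \<ge> 0" "\<And>z. z \<in> S \<Longrightarrow> \<bar>g z\<bar> \<le> B" using bounded_fun_onE[OF assms(2)] by metis
  have "\<bar>f z * g z\<bar> \<le> A * B" if "z \<in> S" for z
    unfolding abs_mult using A(1) A(2)[OF that] B(1) B(2)[OF that] by (intro mult_mono) auto
  then show ?thesis unfolding bounded_fun_on_def by blast
qed

lemma bounded_fun_on_power [bounded_fun_intros]:
  "bounded_fun_on S f \<Longrightarrow> bounded_fun_on S (\<lambda>z. f z ^ k)"
  by (induction k) (auto intro!: bounded_fun_intros)

lemma bounded_fun_on_max0 [bounded_fun_intros]:
  assumes "bounded_fun_on S f"
  shows "bounded_fun_on S (\<lambda>z. max 0 (f z))"
proof -
  obtain A where A: "A \<ge> 0" "\<And>z. z \<in> S \<Longrightarrow> \<bar>f z\<bar> \<le> A" using bounded_fun_onE[OF assms(1)] by metis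
  have "\<bar>max 0 (f z)\<bar> \<le> A" if "z \<in> S" for z using A(1) A(2)[OF that] by linarith
  then show ?thesis unfolding bounded_fun_on_def by blast
qed

lemma bounded_fun_on_sum [bounded_fun_intros]:
  "finite I \<Longrightarrow> (\<And>i. i \<in> I \<Longrightarrow> bounded_fun_on S (f i)) \<Longrightarrow> bounded_fun_on S (\<lambda>z. \<Sum>i\<in>I. f i z)"
  by (induction I rule: finite_induct) (auto intro!: bounded_fun_intros)

lemma bounded_fun_on_compact:
  assumes "compact K" "continuous_on K f" "S \<subseteq> K"
  shows "bounded_fun_on S f"
proof -
  from compact_imp_bounded[OF compact_continuous_image[OF assms(2,1)]]
  obtain B where "\<forall>y\<in>f ` K. norm y \<le> B" unfolding bounded_iff ..
  then show ?thesis unfolding bounded_fun_on_def using assms(3) by (intro exI[of _ B]) auto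
qed

lemma integrable_cutoff:
  fixes F :: "'a::euclidean_space \<Rightarrow> real"
  assumes [measurable]: "A \<in> sets borel" "F \<in> borel_measurable borel" and A: "bounded A" and b: "bounded_fun_on A F"
  shows "integrable lborel (\<lambda>z. if z \<in> A then F z else 0)"
proof -
  obtain B where B: "B \<ge> 0" "\<And>z. z \<in> A \<Longrightarrow> \<bar>F z\<bar> \<le> B" using bounded_fun_onE[OF b] by metis
  have i: "integrable lborel (indicator A :: 'a \<Rightarrow> real)"
    using emeasure_bounded_finite[OF A] by (intro integrable_real_indicator) auto
  show ?thesis
  proof (rule Bochner_Integration.integrable_bound)
    show "integrable lborel (\<lambda>z. B * indicator A z)" using i by simp
    show "AE z in lborel. norm (if z \<in> A then F z else 0) \<le> norm (B * indicator A z)"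
      by (intro AE_I2) (use B in \<open>auto simp: indicator_def\<close>)
  qed measurable
qed

lemma integral_cutoff_dderiv:
  fixes F :: "'a::euclidean_space \<Rightarrow> real"
  assumes A: "open A" "bounded A" and S: "closed S" "S \<subseteq> A" and z0: "\<And>z. z \<in> A - S \<Longrightarrow> F z = 0"
    and d: "\<And>z. z \<in> A \<Longrightarrow> has_dderiv F (F' z) e z"
    and m [measurable]: "F \<in> borel_measurable borel" "F' \<in> borel_measurable borel"
    and b: "bounded_fun_on A F" "bounded_fun_on A F'"
  shows "(\<integral>z. (if z \<in> A then F' z else 0) \<partial>lborel) = 0"
proof -
  have [measurable]: "A \<in> sets borel" using A by simp
  obtain B where B: "B \<ge> 0" "\<And>z. z \<in> A \<Longrightarrow> \<bar>F z\<bar> \<le> B" using bounded_fun_onE[OF b(1)] by metis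
  obtain L where L: "L \<ge> 0" "\<And>z. z \<in> A \<Longrightarrow> \<bar>F' z\<bar> \<le> L" using bounded_fun_onE[OF b(2)] by metis
  obtain R where R: "\<And>z. z \<in> A \<Longrightarrow> norm z \<le> R" using A(2) unfolding bounded_iff by metis
  show ?thesis
  proof (rule integral_dderiv_eq_0[OF _ _ has_dderiv_cutoff[OF A(1) S z0 d]])
    show "\<bar>if z \<in> A then F' z else 0\<bar> \<le> L" "\<bar>if z \<in> A then F z else 0\<bar> \<le> B" for z
      using B L by auto
    show "R < norm z \<Longrightarrow> (if z \<in> A then F z else 0) = 0" for z using R[of z] by auto
  qed auto
qed

text \<open>The situation around the set where a solution \<open>v\<close> might exceed a
  |x|^(p/(p-1)) + \<tau>(t). \<open>A\<close> is a neighbourhood on which the mollified identities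
  hold for all radii up to \<open>r0\<close>, and \<open>S\<close> is a closed part of
  \<open>A\<close> outside which the excess will be assumed to vanish. The time profile
  \<open>\<tau>\<close> stays general to admit a term that blows up at the final time.\<close>

locale mollified_comparison =
  fixes p a r0 :: real and \<tau> \<tau>' :: "real \<Rightarrow> real" and v :: "(real ^ 'n) \<times> real \<Rightarrow> real"
    and G :: "(real ^ 'n) \<times> real \<Rightarrow> real ^ 'n" and A S :: "((real ^ 'n) \<times> real) set"
  assumes p: "p > 1" and a: "a \<ge> 0"
    and G: "G \<in> borel_measurable borel" "integrable lborel (\<lambda>z. norm (G z) powr p)"
      "\<And>i. integrable lborel (\<lambda>z. G z $ i)" "\<And>i. integrable lborel (\<lambda>z. flux p (G z) $ i)"
    and v: "integrable lborel v"
    and weak: "\<And>r \<eta> z. mollifier r \<eta> \<Longrightarrow> r \<le> r0 \<Longrightarrow> z \<in> A \<Longrightarrow>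
       (\<Sum>i\<in>UNIV. conv (\<lambda>y. frechet_derivative \<eta> (at y) (axis i 1, 0)) (\<lambda>y. flux p (G y) $ i) z)
       = conv (\<lambda>y. frechet_derivative \<eta> (at y) (0, 1)) v z"
    and grad: "\<And>r \<eta> z i. mollifier r \<eta> \<Longrightarrow> r \<le> r0 \<Longrightarrow> z \<in> A \<Longrightarrow>
       conv (\<lambda>y. frechet_derivative \<eta> (at y) (axis i 1, 0)) v z = conv \<eta> (\<lambda>y. G y $ i) z"
    and A: "open A" "bounded A" and S: "closed S" "S \<subseteq> A"
    and \<tau>m [measurable]: "\<tau> \<in> borel_measurable borel" "\<tau>' \<in> borel_measurable borel"
    and \<tau>: "\<And>z. z \<in> A \<Longrightarrow> (\<tau> has_real_derivative \<tau>' (snd z)) (at (snd z))"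
    and \<tau>b: "bounded_fun_on A (\<lambda>z. \<tau> (snd z))" "bounded_fun_on A (\<lambda>z. \<tau>' (snd z))"
begin

definition \<psi> :: "(real ^ 'n) \<times> real \<Rightarrow> real" where
  "\<psi> z = a * norm (fst z) powr (p / (p - 1)) + \<tau> (snd z)"

abbreviation "\<alpha> \<equiv> pot_flux p a"

text \<open>The monotonicity term of the energy identity, with mollified flux and mollified
  gradient; the factor in front is the derivative of 3 (excess)^2. A mollified flux is not the flux
  of a mollified gradient, so this term has no sign before the limit.\<close>

definition mono_term :: "((real ^ 'n) \<times> real \<Rightarrow> real) \<Rightarrow> (real ^ 'n) \<times> real \<Rightarrow> real" where
  "mono_term \<eta> z = 6 * max 0 (conv \<eta> v z - \<psi> z) *
     (\<Sum>i\<in>UNIV. (conv \<eta> (\<lambda>y. flux p (G y) $ i) z - \<alpha> * fst z $ i) * (conv \<eta> (\<lambda>y. G y $ i) z - pot_grad p a (fst z) $ i))"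

lemma A_cball: "\<exists>K. compact K \<and> A \<subseteq> K"
  using A(2) bounded_subset_cball compact_cball by metis

lemma \<psi>_measurable [measurable]: "\<psi> \<in> borel_measurable borel"
proof -
  have "(\<lambda>z :: (real ^ 'n) \<times> real. a * norm (fst z) powr (p / (p - 1))) \<in> borel_measurable borel"
    by (rule measurable_compose[OF fst_borel borel_measurable_continuous_onI[OF continuous_potential[OF p]]])
  moreover have "(\<lambda>z :: (real ^ 'n) \<times> real. \<tau> (snd z)) \<in> borel_measurable borel"
    by (rule measurable_compose[OF snd_borel \<tau>m(1)])
  ultimately show ?thesis unfolding \<psi>_def[abs_def] by (rule borel_measurable_add)
qed

lemma \<tau>'_measurable [measurable]: "(\<lambda>z :: (real ^ 'n) \<times> real. \<tau>' (snd z)) \<in> borel_measurable borel"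
  by (rule measurable_compose[OF snd_borel \<tau>m(2)])

lemma pot_grad_measurable [measurable]:
  "(\<lambda>z :: (real ^ 'n) \<times> real. pot_grad p a (fst z) $ i) \<in> borel_measurable borel"
proof -
  have "pot_grad p a \<in> borel_measurable (borel :: (real ^ 'n) measure)"
    by (rule borel_measurable_continuous_onI[OF continuous_pot_grad[OF p]])
  then have "(\<lambda>z. pot_grad p a (fst z)) \<in> borel_measurable (borel :: ((real ^ 'n) \<times> real) measure)"
    by (rule measurable_compose[OF fst_borel])
  then show ?thesis by (rule borel_measurable_vec_nth)
qed

lemma coord_measurable [measurable]: "(\<lambda>z :: (real ^ 'n) \<times> real. fst z $ i) \<in> borel_measurable borel"
  by (intro borel_measurable_continuous_onI continuous_intros)

lemma bounded_pot_grad [bounded_fun_intros]: "bounded_fun_on A (\<lambda>z. pot_grad p a (fst z) $ i)"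
proof -
  obtain K where K: "compact K" "A \<subseteq> K" using A_cball by blast
  show ?thesis
  proof (rule bounded_fun_on_compact[OF K(1) _ K(2)])
    show "continuous_on K (\<lambda>z. pot_grad p a (fst z) $ i)"
      by (intro continuous_on_component continuous_on_compose2[OF continuous_pot_grad[OF p]] continuous_on_fst continuous_on_id) auto
  qed
qed

lemma bounded_coord [bounded_fun_intros]: "bounded_fun_on A (\<lambda>z. fst z $ i)"
proof -
  obtain K where K: "compact K" "A \<subseteq> K" using A_cball by blast
  show ?thesis by (rule bounded_fun_on_compact[OF K(1) _ K(2)]) (intro continuous_intros)
qed

lemma bounded_\<psi> [bounded_fun_intros]: "bounded_fun_on A \<psi>"
proof -
  obtain K where K: "compact K" "A \<subseteq> K" using A_cball by blast
  have "bounded_fun_on A (\<lambda>z. a * norm (fst z) powr (p / (p - 1)))"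
    by (rule bounded_fun_on_compact[OF K(1) _ K(2)])
      (rule continuous_on_compose2[OF continuous_potential[OF p, of UNIV]], auto intro: continuous_on_fst continuous_on_id)
  from bounded_fun_on_add[OF this \<tau>b(1)] show ?thesis unfolding \<psi>_def[abs_def] .
qed

lemma bounded_conv:
  assumes "integrable lborel u" "\<eta> \<in> borel_measurable borel" "\<exists>B. \<forall>z. \<bar>\<eta> z\<bar> \<le> B"
  shows "bounded_fun_on A (conv \<eta> u)"
proof -
  obtain B where "\<And>z. \<bar>\<eta> z\<bar> \<le> B" using assms(3) by blast
  from conv_bounded[OF assms(1,2) this] show ?thesis unfolding bounded_fun_on_def by blast
qed

lemma dderiv_\<psi>_x:
  assumes "z \<in> A"
  shows "has_dderiv \<psi> (pot_grad p a (fst z) $ i) (axis i 1, 0) z"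
proof -
  have "((\<lambda>z. a * norm (fst z) powr (p / (p - 1))) has_derivative (\<lambda>h. pot_grad p a (fst z) \<bullet> fst h)) (at z)"
    by (rule has_derivative_compose[OF _ has_derivative_potential[OF p], of fst fst])
      (rule has_derivative_fst, rule has_derivative_ident)
  from has_derivative_imp_dderiv[OF this, of "(axis i 1, 0)"]
  have 1: "has_dderiv (\<lambda>z. a * norm (fst z) powr (p / (p - 1))) (pot_grad p a (fst z) $ i) (axis i 1, 0) z"
    by (simp add: inner_axis)
  have 2: "has_dderiv (\<lambda>z. \<tau> (snd z)) 0 (axis i 1, 0) z" by (simp add: has_dderiv_def)
  show ?thesis using has_dderiv_add[OF 1 2] unfolding \<psi>_def[abs_def] by simp
qed

lemma dderiv_\<psi>_t:
  assumes "z \<in> A"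
  shows "has_dderiv \<psi> (\<tau>' (snd z)) (0, 1) z"
proof -
  have 1: "has_dderiv (\<lambda>z. a * norm (fst z) powr (p / (p - 1))) 0 (0, 1) z" by (simp add: has_dderiv_def)
  have "has_dderiv snd 1 (0, 1) z"
    unfolding has_dderiv_def by (auto intro!: derivative_eq_intros)
  from has_dderiv_compose[OF this \<tau>[OF assms]]
  have 2: "has_dderiv (\<lambda>z. \<tau> (snd z)) (\<tau>' (snd z)) (0, 1) z" by simp
  show ?thesis using has_dderiv_add[OF 1 2] unfolding \<psi>_def[abs_def] by simp
qed

text \<open>\<open>\<Phi>\<close> is a sum of total derivatives: the spatial ones of (mollified flux
  - \<alpha> x) times 3 (excess)^2, minus the time derivative of (excess)^3, where the excess is the
  positive part of \<open>conv \<eta> v - \<psi>\<close>. By \<open>neg\<close> the excess vanishes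
  on \<open>A - S\<close>, so each of them integrates to 0. In the sum the mollified equation
  cancels the divergence of the flux against the time derivative of the solution. The square keeps
  the test factor continuously differentiable.\<close>

lemma mollified_identity:
  assumes m: "mollifier r \<eta>" and r: "r \<le> r0" and neg: "\<And>z. z \<in> A - S \<Longrightarrow> conv \<eta> v z \<le> \<psi> z"
  defines "\<Phi> \<equiv> \<lambda>z. (\<tau>' (snd z) - real CARD('n) * \<alpha>) * (3 * (max 0 (conv \<eta> v z - \<psi> z))\<^sup>2) + mono_term \<eta> z"
  shows "integrable lborel (\<lambda>z. if z \<in> A then \<Phi> z else 0)" "(\<integral>z. (if z \<in> A then \<Phi> z else 0) \<partial>lborel) = 0"
    "\<Phi> \<in> borel_measurable borel"
proof -
  note \<eta>m [measurable] = mollifierD(7)[OF m]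
  define H where "H = conv \<eta> v"
  define V where "V i = conv \<eta> (\<lambda>y. flux p (G y) $ i)" for i
  define g where "g i = conv \<eta> (\<lambda>y. G y $ i)" for i
  define W where "W i = conv (\<lambda>y. frechet_derivative \<eta> (at y) (axis i 1, 0)) (\<lambda>y. flux p (G y) $ i)" for i
  define T where "T = conv (\<lambda>y. frechet_derivative \<eta> (at y) (0, 1)) v"
  have um [measurable]: "v \<in> borel_measurable borel" "G \<in> borel_measurable borel" using v G by auto
  have dmx [measurable]: "(\<lambda>y. frechet_derivative \<eta> (at y) (axis i 1, 0)) \<in> borel_measurable borel" for i
    by (rule mollifier_partial(2)[OF m axis_0_in_Basis])
  have dmt [measurable]: "(\<lambda>y. frechet_derivative \<eta> (at y) (0, 1)) \<in> borel_measurable borel"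
    by (rule mollifier_partial(2)[OF m zero_1_in_Basis])
  have [measurable]: "H \<in> borel_measurable borel" "V i \<in> borel_measurable borel" "g i \<in> borel_measurable borel"
    "W i \<in> borel_measurable borel" "T \<in> borel_measurable borel" for i
    unfolding H_def V_def g_def W_def T_def by (intro conv_measurable; measurable)+
  have bds [bounded_fun_intros]: "bounded_fun_on A H" "bounded_fun_on A (V i)" "bounded_fun_on A (g i)"
    "bounded_fun_on A (W i)" "bounded_fun_on A T" for i
    unfolding H_def V_def g_def W_def T_def
    by (intro bounded_conv v G mollifierD(7,8)[OF m] dmx dmt mollifier_partial(4)[OF m] axis_0_in_Basis zero_1_in_Basis)+
  have sets [measurable]: "A \<in> sets borel" using A by simp
  have dHx: "has_dderiv H (g i z) (axis i 1, 0) z" if "z \<in> A" for i z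
    using conv_mollifier_dderiv[OF m v axis_0_in_Basis] grad[OF m r that] unfolding H_def g_def by metis
  have dHt: "has_dderiv H (T z) (0, 1) z" for z
    using conv_mollifier_dderiv[OF m v zero_1_in_Basis] unfolding H_def T_def .
  have dV: "has_dderiv (V i) (W i z) (axis i 1, 0) z" for i z
    using conv_mollifier_dderiv[OF m G(4) axis_0_in_Basis] unfolding V_def W_def .
  have WT: "(\<Sum>i\<in>UNIV. W i z) = T z" if "z \<in> A" for z
    using weak[OF m r that] unfolding W_def T_def .
  define Fx where "Fx i z = (V i z - \<alpha> * fst z $ i) * (3 * (max 0 (H z - \<psi> z))\<^sup>2)" for i z
  define Fx' where "Fx' i z = (W i z - \<alpha>) * (3 * (max 0 (H z - \<psi> z))\<^sup>2)
      + (V i z - \<alpha> * fst z $ i) * (6 * max 0 (H z - \<psi> z) * (g i z - pot_grad p a (fst z) $ i))" for i z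
  define Ft where "Ft z = (max 0 (H z - \<psi> z)) ^ 3" for z
  define Ft' where "Ft' z = 3 * (max 0 (H z - \<psi> z))\<^sup>2 * (T z - \<tau>' (snd z))" for z
  have neg': "max 0 (H z - \<psi> z) = 0" if "z \<in> A - S" for z using neg[OF that] by (simp add: H_def)
  have ms [measurable]: "Fx i \<in> borel_measurable borel" "Fx' i \<in> borel_measurable borel"
    "Ft \<in> borel_measurable borel" "Ft' \<in> borel_measurable borel" for i
    unfolding Fx_def Fx'_def Ft_def Ft'_def by measurable
  have bs: "bounded_fun_on A (Fx i)" "bounded_fun_on A (Fx' i)" "bounded_fun_on A Ft" "bounded_fun_on A Ft'" for i
    unfolding Fx_def[abs_def] Fx'_def[abs_def] Ft_def[abs_def] Ft'_def[abs_def]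
    by (intro bounded_fun_intros bds \<tau>b)+
  have ix: "(\<integral>z. (if z \<in> A then Fx' i z else 0) \<partial>lborel) = 0" for i
  proof (rule integral_cutoff_dderiv[where F="Fx i" and e="(axis i 1, 0)", OF A S])
    show "Fx i z = 0" if "z \<in> A - S" for z using neg'[OF that] by (simp add: Fx_def)
    show "has_dderiv (Fx i) (Fx' i z) (axis i 1, 0) z" if z: "z \<in> A" for z
    proof -
      have "has_dderiv (\<lambda>z. \<alpha> * fst z $ i) \<alpha> (axis i 1, 0) z"
        unfolding has_dderiv_def by (auto intro!: derivative_eq_intros simp: axis_def)
      from has_dderiv_diff[OF dV this]
      have d1: "has_dderiv (\<lambda>z. V i z - \<alpha> * fst z $ i) (W i z - \<alpha>) (axis i 1, 0) z" .
      have "((\<lambda>s. 3 * (max 0 s)\<^sup>2) has_real_derivative 3 * (2 * max 0 s)) (at s)" for s :: real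
        using DERIV_cmult[OF DERIV_pos_part_power[of 0 s], of 3] by (simp add: numeral_2_eq_2)
      from has_dderiv_compose[OF has_dderiv_diff[OF dHx[OF z] dderiv_\<psi>_x[OF z]] this]
      have d2: "has_dderiv (\<lambda>z. 3 * (max 0 (H z - \<psi> z))\<^sup>2) (6 * max 0 (H z - \<psi> z) * (g i z - pot_grad p a (fst z) $ i)) (axis i 1, 0) z"
        by (simp add: mult.assoc)
      show ?thesis using has_dderiv_mult[OF d1 d2] unfolding Fx_def[abs_def] Fx'_def .
    qed
  qed (use ms bs in auto)
  have it: "(\<integral>z. (if z \<in> A then Ft' z else 0) \<partial>lborel) = 0"
  proof (rule integral_cutoff_dderiv[where F="Ft" and e="(0, 1)", OF A S])
    show "Ft z = 0" if "z \<in> A - S" for z using neg'[OF that] by (simp add: Ft_def)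
    show "has_dderiv Ft (Ft' z) (0, 1) z" if z: "z \<in> A" for z
    proof -
      have "((\<lambda>s. (max 0 s) ^ 3) has_real_derivative 3 * (max 0 s)\<^sup>2) (at s)" for s :: real
        using DERIV_pos_part_power[of 1 s] by (simp add: numeral_3_eq_3 numeral_2_eq_2)
      from has_dderiv_compose[OF has_dderiv_diff[OF dHt dderiv_\<psi>_t[OF z]] this]
      show ?thesis unfolding Ft_def[abs_def] Ft'_def .
    qed
  qed (use ms bs in auto)
  have eq: "(if z \<in> A then \<Phi> z else 0) = (\<Sum>i\<in>UNIV. (if z \<in> A then Fx' i z else 0)) - (if z \<in> A then Ft' z else 0)" for z
  proof (cases "z \<in> A")
    case True
    define B where "B = 3 * (max 0 (H z - \<psi> z))\<^sup>2"
    have "(\<Sum>i\<in>UNIV. Fx' i z) = (\<Sum>i\<in>UNIV. W i z - \<alpha>) * B + mono_term \<eta> z"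
      unfolding Fx'_def mono_term_def sum.distrib B_def[symmetric] sum_distrib_right[symmetric]
      by (simp add: H_def V_def g_def sum_distrib_left mult_ac)
    also have "(\<Sum>i\<in>UNIV. W i z - \<alpha>) = T z - real CARD('n) * \<alpha>"
      using WT[OF True] by (simp add: sum_subtractf)
    finally have "(\<Sum>i\<in>UNIV. Fx' i z) - Ft' z = (\<tau>' (snd z) - real CARD('n) * \<alpha>) * B + mono_term \<eta> z"
      unfolding Ft'_def B_def[symmetric] by (simp add: algebra_simps)
    then show ?thesis using True by (simp add: \<Phi>_def B_def H_def)
  qed simp
  have ii: "integrable lborel (\<lambda>z. if z \<in> A then Fx' i z else 0)" "integrable lborel (\<lambda>z. if z \<in> A then Ft' z else 0)" for i
    by (intro integrable_cutoff sets ms A bs)+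
  show "integrable lborel (\<lambda>z. if z \<in> A then \<Phi> z else 0)" unfolding eq using ii by auto
  show "(\<integral>z. (if z \<in> A then \<Phi> z else 0) \<partial>lborel) = 0" unfolding eq using ii ix it by simp
  show "\<Phi> \<in> borel_measurable borel"
    unfolding \<Phi>_def mono_term_def H_def[symmetric] V_def[symmetric] g_def[symmetric] by measurable
qed

end

text \<open>Fatou's lemma bounds the integral of B + Y by the limit of the integrals of
  \<open>\<Phi> j\<close>, which is the integral of Y. Cancelling this finite number leaves B with
  integral 0. In the application Y is the limit of the shift that makes the sequence
  nonnegative.\<close>

lemma fatou_sign:
  fixes \<Phi> :: "nat \<Rightarrow> 'a \<Rightarrow> real"
  assumes \<Phi>: "\<And>j. integrable M (\<Phi> j)" "\<And>j z. 0 \<le> \<Phi> j z"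
    and B: "B \<in> borel_measurable M" "\<And>z. 0 \<le> B z" and Y: "integrable M Y" "\<And>z. 0 \<le> Y z"
    and lim: "(\<lambda>j. \<integral>z. \<Phi> j z \<partial>M) \<longlonglongrightarrow> (\<integral>z. Y z \<partial>M)"
    and ae: "AE z in M. \<exists>L \<ge> B z + Y z. (\<lambda>j. \<Phi> j z) \<longlonglongrightarrow> L"
  shows "AE z in M. B z = 0"
proof -
  have [measurable]: "\<Phi> j \<in> borel_measurable M" "Y \<in> borel_measurable M" "B \<in> borel_measurable M" for j
    using \<Phi> Y B by auto
  have "(\<integral>\<^sup>+z. ennreal (B z + Y z) \<partial>M) \<le> (\<integral>\<^sup>+z. liminf (\<lambda>j. ennreal (\<Phi> j z)) \<partial>M)"
  proof (rule nn_integral_mono_AE)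
    show "AE z in M. ennreal (B z + Y z) \<le> liminf (\<lambda>j. ennreal (\<Phi> j z))"
      using ae
    proof eventually_elim
      case (elim z)
      then obtain L where L: "L \<ge> B z + Y z" "(\<lambda>j. \<Phi> j z) \<longlonglongrightarrow> L" by blast
      have "(\<lambda>j. ennreal (\<Phi> j z)) \<longlonglongrightarrow> ennreal L" using L(2) by (rule tendsto_ennrealI)
      then have "liminf (\<lambda>j. ennreal (\<Phi> j z)) = ennreal L" by (rule lim_imp_Liminf[rotated]) simp
      then show ?case using L(1) by (simp add: ennreal_leI)
    qed
  qed
  also have "\<dots> \<le> liminf (\<lambda>j. \<integral>\<^sup>+z. ennreal (\<Phi> j z) \<partial>M)"
    by (rule nn_integral_liminf) measurable
  also have "(\<lambda>j. \<integral>\<^sup>+z. ennreal (\<Phi> j z) \<partial>M) = (\<lambda>j. ennreal (\<integral>z. \<Phi> j z \<partial>M))"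
    using \<Phi> by (intro ext nn_integral_eq_integral) auto
  also have "liminf (\<lambda>j. ennreal (\<integral>z. \<Phi> j z \<partial>M)) = ennreal (\<integral>z. Y z \<partial>M)"
    by (rule lim_imp_Liminf[OF _ tendsto_ennrealI[OF lim]]) simp
  also have "\<dots> = (\<integral>\<^sup>+z. ennreal (Y z) \<partial>M)"
    using Y by (intro nn_integral_eq_integral[symmetric]) auto
  finally have le: "(\<integral>\<^sup>+z. ennreal (B z + Y z) \<partial>M) \<le> (\<integral>\<^sup>+z. ennreal (Y z) \<partial>M)" .
  have "(\<integral>\<^sup>+z. ennreal (B z + Y z) \<partial>M) = (\<integral>\<^sup>+z. ennreal (B z) + ennreal (Y z) \<partial>M)"
    using B Y by (intro nn_integral_cong) simp
  also have "\<dots> = (\<integral>\<^sup>+z. ennreal (B z) \<partial>M) + (\<integral>\<^sup>+z. ennreal (Y z) \<partial>M)"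
    by (rule nn_integral_add) measurable
  finally have "(\<integral>\<^sup>+z. ennreal (B z) \<partial>M) + (\<integral>\<^sup>+z. ennreal (Y z) \<partial>M) \<le> 0 + (\<integral>\<^sup>+z. ennreal (Y z) \<partial>M)"
    using le by simp
  moreover have "(\<integral>\<^sup>+z. ennreal (Y z) \<partial>M) \<noteq> top"
    using nn_integral_eq_integral[OF Y(1)] Y(2) by simp
  ultimately have "(\<integral>\<^sup>+z. ennreal (B z) \<partial>M) = 0"
    using ennreal_add_left_cancel_le[of "\<integral>\<^sup>+z. ennreal (Y z) \<partial>M"] by (simp add: add.commute)
  then have "AE z in M. ennreal (B z) = 0" by (subst (asm) nn_integral_0_iff_AE) measurable
  then show ?thesis
  proof eventually_elim
    case (elim z)
    then show ?case using B(2)[of z] by (simp add: ennreal_eq_0_iff)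
  qed
qed

context mollified_comparison
begin

text \<open>\<open>M\<close> does not depend on the kernel. The kernel enters the bound only through
  the mollified |G|^p, which converges in L^1 and can therefore be added as a shift before Fatou's
  lemma.\<close>

lemma mono_term_bound:
  assumes v0: "\<And>z. \<bar>v z\<bar> \<le> M0"
  obtains M where "M \<ge> 0" "\<And>r \<eta> z. mollifier r \<eta> \<Longrightarrow> z \<in> A \<Longrightarrow>
    \<bar>mono_term \<eta> z\<bar> \<le> M * (1 + conv \<eta> (\<lambda>z. norm (G z) powr p) z)"
proof -
  obtain M\<psi> where M\<psi>: "M\<psi> \<ge> 0" "\<And>z. z \<in> A \<Longrightarrow> \<bar>\<psi> z\<bar> \<le> M\<psi>" using bounded_fun_onE[OF bounded_\<psi>] by metis
  have "\<exists>B. B \<ge> 0 \<and> (\<forall>z\<in>A. \<bar>pot_grad p a (fst z) $ i\<bar> \<le> B)" for i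
    by (rule bounded_fun_onE[OF bounded_pot_grad[of i]]) blast
  then obtain Mp where Mp: "\<And>i. Mp i \<ge> 0" "\<And>i z. z \<in> A \<Longrightarrow> \<bar>pot_grad p a (fst z) $ i\<bar> \<le> Mp i"
    by metis
  have "\<exists>B. B \<ge> 0 \<and> (\<forall>z\<in>A. \<bar>fst z $ i\<bar> \<le> B)" for i
    by (rule bounded_fun_onE[OF bounded_coord[of i]]) blast
  then obtain R where R: "\<And>i. R i \<ge> 0" "\<And>i z. z \<in> A \<Longrightarrow> \<bar>fst z $ i\<bar> \<le> R i"
    by metis
  have \<alpha>0: "\<alpha> \<ge> 0" by (simp add: pot_flux_def)
  have M0: "M0 \<ge> 0" using v0[of 0] by linarith
  \<comment> \<open>The coefficients obtained by expanding (V + \<alpha> R)(W + Mp), where the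
    product V W and the single factors V and W are bounded by
    \<open>conv_product_bound\<close>.\<close>
  define c where "c i = (1 + 2 powr p) + Mp i + \<alpha> * R i + \<alpha> * R i * Mp i" for i
  have c0: "c i \<ge> 0" for i unfolding c_def using Mp(1)[of i] R(1)[of i] \<alpha>0 by simp
  show ?thesis
  proof (rule that[of "6 * (M0 + M\<psi>) * (\<Sum>i\<in>UNIV. c i)"])
    show "0 \<le> 6 * (M0 + M\<psi>) * (\<Sum>i\<in>UNIV. c i)" using M0 M\<psi> c0 by (simp add: sum_nonneg)
    fix r :: real and \<eta> :: "(real ^ 'n) \<times> real \<Rightarrow> real" and z
    assume m: "mollifier r \<eta>" and z: "z \<in> A"
    define g where "g = conv \<eta> (\<lambda>z. norm (G z) powr p) z"
    have vb: "\<bar>conv \<eta> v z\<bar> \<le> M0"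
      using conv_abs_le[OF m v v zero_le_one, of M0 0 z] v0 by simp
    have "max 0 (conv \<eta> v z - \<psi> z) \<le> M0 + M\<psi>"
      using vb M\<psi>(2)[OF z] M0 M\<psi>(1) by linarith
    then have "6 * max 0 (conv \<eta> v z - \<psi> z) \<le> 6 * (M0 + M\<psi>)" by (rule mult_left_mono) simp
    then have 1: "\<bar>6 * max 0 (conv \<eta> v z - \<psi> z)\<bar> \<le> 6 * (M0 + M\<psi>)" by simp
    have 2: "\<bar>(conv \<eta> (\<lambda>y. flux p (G y) $ i) z - \<alpha> * fst z $ i) * (conv \<eta> (\<lambda>y. G y $ i) z - pot_grad p a (fst z) $ i)\<bar>
        \<le> c i * (1 + g)" for i
    proof -
      define V where "V = \<bar>conv \<eta> (\<lambda>y. flux p (G y) $ i) z\<bar>"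
      define W where "W = \<bar>conv \<eta> (\<lambda>y. G y $ i) z\<bar>"
      have f1: "\<bar>flux p (G z) $ i\<bar> \<le> norm (G z) powr (p - 1)" for z
        using component_le_norm_cart[of "flux p (G z)" i] by (simp add: norm_flux)
      note b = conv_product_bound[OF m p G(2) G(4)[of i] f1 G(3)[of i] component_le_norm_cart, of z]
      have b': "V * W \<le> (1 + 2 powr p) * g" "V \<le> 1 + g" "W \<le> 1 + g" "0 \<le> g"
        using b unfolding V_def W_def g_def by auto
      have VW: "0 \<le> V" "0 \<le> W" by (auto simp: V_def W_def)
      have "\<bar>(conv \<eta> (\<lambda>y. flux p (G y) $ i) z - \<alpha> * fst z $ i) * (conv \<eta> (\<lambda>y. G y $ i) z - pot_grad p a (fst z) $ i)\<bar>
         \<le> (V + \<alpha> * R i) * (W + Mp i)"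
        unfolding abs_mult
      proof (rule mult_mono)
        have "\<bar>\<alpha> * fst z $ i\<bar> \<le> \<alpha> * R i" unfolding abs_mult using \<alpha>0 R(2)[OF z, of i] by (simp add: mult_left_mono)
        then show "\<bar>conv \<eta> (\<lambda>y. flux p (G y) $ i) z - \<alpha> * fst z $ i\<bar> \<le> V + \<alpha> * R i"
          unfolding V_def by linarith
        show "\<bar>conv \<eta> (\<lambda>y. G y $ i) z - pot_grad p a (fst z) $ i\<bar> \<le> W + Mp i"
          unfolding W_def using Mp(2)[OF z, of i] by linarith
      qed (use VW \<alpha>0 R(1)[of i] in auto)
      also have "\<dots> = V * W + Mp i * V + (\<alpha> * R i) * W + \<alpha> * R i * Mp i" by (simp add: algebra_simps)
      also have "\<dots> \<le> (1 + 2 powr p) * (1 + g) + Mp i * (1 + g) + (\<alpha> * R i) * (1 + g) + \<alpha> * R i * Mp i * (1 + g)"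
      proof (intro add_mono mult_left_mono b' Mp(1) mult_nonneg_nonneg \<alpha>0 R(1))
        show "V * W \<le> (1 + 2 powr p) * (1 + g)"
          by (rule order_trans[OF b'(1)]) (intro mult_left_mono, auto)
        have "0 \<le> \<alpha> * R i * Mp i" using \<alpha>0 R(1)[of i] Mp(1)[of i] by simp
        then show "\<alpha> * R i * Mp i \<le> \<alpha> * R i * Mp i * (1 + g)" using b'(4) by (simp add: mult_le_cancel_left1)
      qed
      also have "\<dots> = c i * (1 + g)" by (simp add: c_def algebra_simps)
      finally show ?thesis .
    qed
    have "\<bar>mono_term \<eta> z\<bar> \<le> (6 * (M0 + M\<psi>)) * (\<Sum>i\<in>UNIV. c i * (1 + g))"
      unfolding mono_term_def abs_mult[of "6 * max 0 _"]
      by (intro mult_mono 1 order_trans[OF sum_abs] sum_mono 2) (use M0 M\<psi>(1) in auto)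
    then show "\<bar>mono_term \<eta> z\<bar> \<le> 6 * (M0 + M\<psi>) * (\<Sum>i\<in>UNIV. c i) * (1 + conv \<eta> (\<lambda>z. norm (G z) powr p) z)"
      by (simp add: g_def sum_distrib_right mult.assoc)
  qed
qed

text \<open>
  The strong limit of the mollified fluxes is only needed through Fatou's lemma: \<open>mono_term\<close> is bounded
  below by an \<open>L\<^sup>1\<close>-convergent sequence and has a nonnegative limit, as the \<open>p\<close>-flux is monotone.
\<close>

lemma comparison_ae:
  assumes m: "\<And>j. mollifier (r j) (\<eta> j)" and r: "\<And>j. r j \<le> r0" "r \<longlonglongrightarrow> 0"
    and neg: "\<And>j z. z \<in> A - S \<Longrightarrow> conv (\<eta> j) v z \<le> \<psi> z"
    and v0: "\<And>z. \<bar>v z\<bar> \<le> M0"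
    and vlim: "\<And>z. z \<in> A \<Longrightarrow> (\<lambda>j. conv (\<eta> j) v z) \<longlonglongrightarrow> v z"
    and super: "\<And>z. z \<in> A \<Longrightarrow> real CARD('n) * \<alpha> < \<tau>' (snd z)"
  shows "AE z in lborel. z \<in> A \<longrightarrow> v z \<le> \<psi> z"
proof -
  obtain M where M: "M \<ge> 0" "\<And>r \<eta> z. mollifier r \<eta> \<Longrightarrow> z \<in> A \<Longrightarrow>
    \<bar>mono_term \<eta> z\<bar> \<le> M * (1 + conv \<eta> (\<lambda>z. norm (G z) powr p) z)"
    using mono_term_bound[OF v0] by metis
  have sets [measurable]: "A \<in> sets borel" using A by simp
  have um [measurable]: "v \<in> borel_measurable borel" "G \<in> borel_measurable borel" using v G by auto
  define g where "g j = conv (\<eta> j) (\<lambda>z. norm (G z) powr p)" for j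
  define V where "V j i = conv (\<eta> j) (\<lambda>y. flux p (G y) $ i)" for j i
  define W where "W j i = conv (\<eta> j) (\<lambda>y. G y $ i)" for j i
  note ci = conv_L1_bound(1)[OF m]
  have gi: "integrable lborel (g j)" and Vi: "integrable lborel (V j i)" and Wi: "integrable lborel (W j i)" for i j
    unfolding g_def V_def W_def using ci G by auto
  have g0: "g j z \<ge> 0" for j z
    unfolding g_def by (rule conv_nonneg[OF m]) simp
  \<comment> \<open>All errors are summed so that a single subsequence gives a.e. convergence of
    every mollified quantity.\<close>
  define E where "E j z = (\<Sum>i\<in>UNIV. \<bar>V j i z - flux p (G z) $ i\<bar>) + (\<Sum>i\<in>UNIV. \<bar>W j i z - G z $ i\<bar>) + \<bar>g j z - norm (G z) powr p\<bar>" for j z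
  have Ei: "integrable lborel (E j)" for j unfolding E_def using gi Vi Wi G by auto
  have E0: "E j z \<ge> 0" for j z unfolding E_def by (intro add_nonneg_nonneg sum_nonneg) auto
  have "(\<lambda>j. \<integral>z. norm (E j z) \<partial>lborel) \<longlonglongrightarrow> 0"
  proof -
    have "(\<integral>z. norm (E j z) \<partial>lborel) = (\<Sum>i\<in>UNIV. \<integral>z. \<bar>V j i z - flux p (G z) $ i\<bar> \<partial>lborel)
        + (\<Sum>i\<in>UNIV. \<integral>z. \<bar>W j i z - G z $ i\<bar> \<partial>lborel) + (\<integral>z. \<bar>g j z - norm (G z) powr p\<bar> \<partial>lborel)" for j
    proof -
      have "(\<integral>z. norm (E j z) \<partial>lborel) = (\<integral>z. E j z \<partial>lborel)" using E0 by simp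
      also have "\<dots> = (\<Sum>i\<in>UNIV. \<integral>z. \<bar>V j i z - flux p (G z) $ i\<bar> \<partial>lborel)
        + (\<Sum>i\<in>UNIV. \<integral>z. \<bar>W j i z - G z $ i\<bar> \<partial>lborel) + (\<integral>z. \<bar>g j z - norm (G z) powr p\<bar> \<partial>lborel)"
        unfolding E_def using gi Vi Wi G by (simp add: Bochner_Integration.integral_sum)
      finally show ?thesis .
    qed
    moreover have "(\<lambda>j. (\<Sum>i\<in>UNIV. \<integral>z. \<bar>V j i z - flux p (G z) $ i\<bar> \<partial>lborel)
        + (\<Sum>i\<in>UNIV. \<integral>z. \<bar>W j i z - G z $ i\<bar> \<partial>lborel) + (\<integral>z. \<bar>g j z - norm (G z) powr p\<bar> \<partial>lborel))
        \<longlonglongrightarrow> (\<Sum>i\<in>(UNIV::'n set). 0) + (\<Sum>i\<in>(UNIV::'n set). 0) + 0"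
      unfolding V_def W_def g_def
      by (intro tendsto_add tendsto_sum conv_L1_tendsto[OF _ m r(2)] G)
    ultimately show ?thesis by simp
  qed
  from tendsto_L1_AE_subseq[OF Ei this] obtain \<sigma> where \<sigma>: "strict_mono \<sigma>"
    and \<sigma>E: "AE z in lborel. (\<lambda>j. E (\<sigma> j) z) \<longlonglongrightarrow> 0" by blast
  define \<Phi> where "\<Phi> j z = (\<tau>' (snd z) - real CARD('n) * \<alpha>) * (3 * (max 0 (conv (\<eta> j) v z - \<psi> z))\<^sup>2) + mono_term (\<eta> j) z" for j z
  have \<Phi>: "integrable lborel (\<lambda>z. if z \<in> A then \<Phi> j z else 0)" "(\<integral>z. (if z \<in> A then \<Phi> j z else 0) \<partial>lborel) = 0" for j
    unfolding \<Phi>_def using mollified_identity[OF m r(1) neg] by auto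
  \<comment> \<open>Shifted by the majorant from \<open>mono_term_bound\<close> the integrand
    becomes nonnegative. As \<open>\<Phi> j\<close> has integral 0 over \<open>A\<close>, the
    integral of \<open>\<Psi> j\<close> is that of the shift and tends to that of
    \<open>Y\<close>.\<close>
  define \<Psi> where "\<Psi> j z = (if z \<in> A then \<Phi> j z else 0) + M * (indicator A z * (1 + g j z))" for j z
  define B where "B z = indicator A z * ((\<tau>' (snd z) - real CARD('n) * \<alpha>) * (3 * (max 0 (v z - \<psi> z))\<^sup>2))" for z
  define Y where "Y z = M * (indicator A z * (1 + norm (G z) powr p))" for z
  have Ai: "integrable lborel (indicator A :: _ \<Rightarrow> real)"
    using emeasure_bounded_finite[OF A(2)] by (intro integrable_real_indicator) auto
  have Agi: "integrable lborel (\<lambda>z. indicator A z * (1 + u z))" if "integrable lborel u" for u :: "(real ^ 'n) \<times> real \<Rightarrow> real"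
    unfolding distrib_left mult_1_right
    using Ai integrable_mult_indicator[OF _ that, of A] by (intro Bochner_Integration.integrable_add) auto
  have "AE z in lborel. B z = 0"
  proof (rule fatou_sign[where \<Phi>="\<lambda>j. \<Psi> (\<sigma> j)" and Y=Y])
    show "integrable lborel (\<Psi> (\<sigma> j))" for j
      unfolding \<Psi>_def by (intro Bochner_Integration.integrable_add \<Phi> integrable_mult_right Agi gi)
    show "0 \<le> \<Psi> (\<sigma> j) z" for j z
    proof (cases "z \<in> A")
      case True
      have "0 \<le> (\<tau>' (snd z) - real CARD('n) * \<alpha>) * (3 * (max 0 (conv (\<eta> (\<sigma> j)) v z - \<psi> z))\<^sup>2)"
        using super[OF True] by simp
      then show ?thesis using M(2)[OF m True, of "\<sigma> j"] True by (simp add: \<Psi>_def \<Phi>_def g_def)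
    qed (simp add: \<Psi>_def)
    show "B \<in> borel_measurable lborel" unfolding B_def by measurable
    show "0 \<le> B z" for z unfolding B_def using super[of z] by (auto simp: indicator_def)
    show "integrable lborel Y" unfolding Y_def by (intro integrable_mult_right Agi G)
    show "0 \<le> Y z" for z unfolding Y_def using M(1) by simp
    show "(\<lambda>j. \<integral>z. \<Psi> (\<sigma> j) z \<partial>lborel) \<longlonglongrightarrow> (\<integral>z. Y z \<partial>lborel)"
    proof -
      have "(\<integral>z. \<Psi> j z \<partial>lborel) = (\<integral>z. M * (indicator A z * (1 + g j z)) \<partial>lborel)" for j
        unfolding \<Psi>_def
        by (subst Bochner_Integration.integral_add[OF \<Phi>(1) integrable_mult_right[OF Agi[OF gi]]]) (simp add: \<Phi>(2))
      then have eq: "(\<integral>z. \<Psi> j z \<partial>lborel) - (\<integral>z. Y z \<partial>lborel) = M * (\<integral>z. indicator A z * (g j z - norm (G z) powr p) \<partial>lborel)" for j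
      proof -
        assume *: "\<And>j. (\<integral>z. \<Psi> j z \<partial>lborel) = (\<integral>z. M * (indicator A z * (1 + g j z)) \<partial>lborel)"
        have "(\<integral>z. \<Psi> j z \<partial>lborel) - (\<integral>z. Y z \<partial>lborel)
          = (\<integral>z. M * (indicator A z * (1 + g j z)) - M * (indicator A z * (1 + norm (G z) powr p)) \<partial>lborel)"
          unfolding * Y_def
          by (rule Bochner_Integration.integral_diff[symmetric]) (intro integrable_mult_right Agi gi G)+
        also have "\<dots> = (\<integral>z. M * (indicator A z * (g j z - norm (G z) powr p)) \<partial>lborel)"
          by (rule Bochner_Integration.integral_cong) (auto simp: algebra_simps)
        finally show ?thesis by simp
      qed
      have bd: "\<bar>(\<integral>z. \<Psi> j z \<partial>lborel) - (\<integral>z. Y z \<partial>lborel)\<bar> \<le> M * (\<integral>z. \<bar>g j z - norm (G z) powr p\<bar> \<partial>lborel)" for j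
      proof -
        have "norm (\<integral>z. indicator A z * (g j z - norm (G z) powr p) \<partial>lborel) \<le> (\<integral>z. \<bar>g j z - norm (G z) powr p\<bar> \<partial>lborel)"
        proof (rule Bochner_Integration.integral_norm_bound_integral)
          have "integrable lborel (\<lambda>z. g j z - norm (G z) powr p)" using gi G by auto
          from integrable_mult_indicator[OF _ this, of A]
          show "integrable lborel (\<lambda>z. indicator A z * (g j z - norm (G z) powr p))" by simp
          show "integrable lborel (\<lambda>z. \<bar>g j z - norm (G z) powr p\<bar>)" using gi G by auto
          show "norm (indicator A z * (g j z - norm (G z) powr p)) \<le> \<bar>g j z - norm (G z) powr p\<bar>" for z
            by (simp add: indicator_def)
        qed
        then show ?thesis unfolding eq abs_mult using M(1) by (simp add: mult_left_mono)
      qed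
      have "(\<lambda>j. M * (\<integral>z. \<bar>g j z - norm (G z) powr p\<bar> \<partial>lborel)) \<longlonglongrightarrow> M * 0"
        unfolding g_def by (intro tendsto_mult tendsto_const conv_L1_tendsto[OF G(2) m r(2)])
      then have M0: "(\<lambda>j. M * (\<integral>z. \<bar>g j z - norm (G z) powr p\<bar> \<partial>lborel)) \<longlonglongrightarrow> 0" by simp
      have "(\<lambda>j. (\<integral>z. \<Psi> j z \<partial>lborel) - (\<integral>z. Y z \<partial>lborel)) \<longlonglongrightarrow> 0"
        by (rule Lim_null_comparison[OF always_eventually M0]) (simp only: real_norm_def bd simp_thms)
      then have "(\<lambda>j. \<integral>z. \<Psi> j z \<partial>lborel) \<longlonglongrightarrow> (\<integral>z. Y z \<partial>lborel)" by (rule LIM_zero_cancel)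
      from LIMSEQ_subseq_LIMSEQ[OF this \<sigma>] show ?thesis by (simp add: comp_def)
    qed
    show "AE z in lborel. \<exists>L\<ge>B z + Y z. (\<lambda>j. \<Psi> (\<sigma> j) z) \<longlonglongrightarrow> L"
      using \<sigma>E
    proof eventually_elim
      case (elim z)
      show ?case
      proof (cases "z \<in> A")
        case False
        then show ?thesis by (auto simp: \<Psi>_def B_def Y_def intro!: exI[of _ 0])
      next
        case True
        have le: "\<bar>V j i z - flux p (G z) $ i\<bar> \<le> E j z" "\<bar>W j i z - G z $ i\<bar> \<le> E j z" "\<bar>g j z - norm (G z) powr p\<bar> \<le> E j z" for i j
        proof -
          have "\<bar>V j i z - flux p (G z) $ i\<bar> \<le> (\<Sum>i\<in>UNIV. \<bar>V j i z - flux p (G z) $ i\<bar>)"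
            by (rule member_le_sum) auto
          moreover have "\<bar>W j i z - G z $ i\<bar> \<le> (\<Sum>i\<in>UNIV. \<bar>W j i z - G z $ i\<bar>)"
            by (rule member_le_sum) auto
          moreover have "0 \<le> (\<Sum>i\<in>UNIV. \<bar>V j i z - flux p (G z) $ i\<bar>)" "0 \<le> (\<Sum>i\<in>UNIV. \<bar>W j i z - G z $ i\<bar>)"
            by (auto intro: sum_nonneg)
          ultimately show "\<bar>V j i z - flux p (G z) $ i\<bar> \<le> E j z" "\<bar>W j i z - G z $ i\<bar> \<le> E j z" "\<bar>g j z - norm (G z) powr p\<bar> \<le> E j z"
            unfolding E_def by linarith+
        qed
        have lims: "(\<lambda>j. V (\<sigma> j) i z) \<longlonglongrightarrow> flux p (G z) $ i" "(\<lambda>j. W (\<sigma> j) i z) \<longlonglongrightarrow> G z $ i"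
          "(\<lambda>j. g (\<sigma> j) z) \<longlonglongrightarrow> norm (G z) powr p" for i
          by (rule LIM_zero_cancel, rule Lim_null_comparison[OF always_eventually elim],
              intro allI, unfold real_norm_def, rule le)+
        have Hl: "(\<lambda>j. conv (\<eta> (\<sigma> j)) v z) \<longlonglongrightarrow> v z"
          using LIMSEQ_subseq_LIMSEQ[OF vlim[OF True] \<sigma>] by (simp add: comp_def)
        define Q where "Q = (\<Sum>i\<in>UNIV. (flux p (G z) $ i - \<alpha> * fst z $ i) * (G z $ i - pot_grad p a (fst z) $ i))"
        have "Q = (flux p (G z) - flux p (pot_grad p a (fst z))) \<bullet> (G z - pot_grad p a (fst z))"
          by (simp add: Q_def inner_vec_def flux_pot_grad[OF p a])
        then have Q0: "Q \<ge> 0" using flux_monotone[OF p] by metis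
        have "(\<lambda>j. \<Psi> (\<sigma> j) z) \<longlonglongrightarrow> (\<tau>' (snd z) - real CARD('n) * \<alpha>) * (3 * (max 0 (v z - \<psi> z))\<^sup>2)
            + 6 * max 0 (v z - \<psi> z) * Q + M * (1 * (1 + norm (G z) powr p))"
          unfolding \<Psi>_def \<Phi>_def mono_term_def Q_def V_def[symmetric] W_def[symmetric]
          using True by (auto intro!: tendsto_intros lims Hl)
        moreover have "B z + Y z \<le> (\<tau>' (snd z) - real CARD('n) * \<alpha>) * (3 * (max 0 (v z - \<psi> z))\<^sup>2)
            + 6 * max 0 (v z - \<psi> z) * Q + M * (1 * (1 + norm (G z) powr p))"
          using True Q0 by (simp add: B_def Y_def)
        ultimately show ?thesis by blast
      qed
    qed
  qed
  then show ?thesis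
  proof eventually_elim
    case (elim z)
    show ?case
    proof
      assume z: "z \<in> A"
      \<comment> \<open>Here the supersolution has to be strict: the square of the excess carries
        the positive coefficient \<tau>' - n \<alpha>.\<close>
      then have "(max 0 (v z - \<psi> z))\<^sup>2 = 0" using elim super[OF z] by (simp add: B_def)
      then show "v z \<le> \<psi> z" by (simp add: max_def split: if_splits)
    qed
  qed
qed

end

lemma open_AE_imp_all:
  fixes f :: "'a::euclidean_space \<Rightarrow> real"
  assumes A: "open A" and f: "continuous_on A f" and ae: "AE z in lborel. z \<in> A \<longrightarrow> f z \<le> 0" and z: "z \<in> A"
  shows "f z \<le> 0"
proof (rule ccontr)
  assume "\<not> f z \<le> 0"
  let ?S = "{z \<in> A. 0 < f z}"
  have "?S = f -` {0<..} \<inter> A" by auto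
  then have op: "open ?S" using continuous_on_open_vimage[OF A, of f] f by auto
  have "emeasure lborel ?S = 0"
    using ae by (subst (asm) AE_iff_measurable[of ?S]) (use op in \<open>auto simp: not_le\<close>)
  then have "negligible ?S" using op by (simp add: negligible_iff_emeasure0)
  then have "?S = {}" using open_not_negligible[OF op] by blast
  then show False using z \<open>\<not> f z \<le> 0\<close> by auto
qed

lemma compact_infdist_nbhd:
  fixes K :: "'a::euclidean_space set"
  assumes "compact K" "K \<noteq> {}" "open B" "K \<subseteq> B"
  obtains e where "e > 0" "{x. infdist x K \<le> e} \<subseteq> B" "\<And>r. r > 0 \<Longrightarrow> compact {x. infdist x K \<le> r}"
proof -
  obtain e where "e > 0" "{x. infdist x K \<le> e} \<subseteq> B"
    using compact_in_open_separated[OF assms(2,1,3,4)] by blast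
  then show ?thesis using that compact_infdist_le[OF assms(2,1)] by blast
qed

lemma continuous_on_infdist_open: "open {x. infdist x K < r}"
  by (intro open_Collect_less continuous_intros)

text \<open>Compactness of the contact set inside the open set \<open>D\<close> stands in for a
  boundary condition: it leaves a shell around the contact set, still within \<open>D\<close>, on
  which \<open>h\<close> lies strictly below the supersolution. The excess of a sufficiently fine
  mollification then vanishes on that shell, and \<open>mollified_comparison\<close> applies inside
  it.\<close>

lemma weak_comparison:
  fixes h :: "(real ^ 'n) \<times> real \<Rightarrow> real"
  assumes p: "p > 1" and Q: "open Q" and h: "p_parabolic p (Q \<times> {t1<..<t2}) h" and a: "a \<ge> 0"
    and \<tau>m: "\<tau> \<in> borel_measurable borel" "\<tau>' \<in> borel_measurable borel"
    and \<tau>: "\<And>t. t \<in> {t1<..<t2} \<Longrightarrow> (\<tau> has_real_derivative \<tau>' t) (at t)"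
    and \<tau>c: "continuous_on {t1<..<t2} \<tau>'"
    and super: "\<And>t. t \<in> {t1<..<t2} \<Longrightarrow> real CARD('n) * pot_flux p a < \<tau>' t"
    and D: "open D" "D \<subseteq> Q \<times> {t1<..<t2}"
    and K: "compact {z \<in> D. a * norm (fst z) powr (p / (p - 1)) + \<tau> (snd z) \<le> h z}"
    and z: "z \<in> D"
  shows "h z \<le> a * norm (fst z) powr (p / (p - 1)) + \<tau> (snd z)"
proof -
  define \<psi> where "\<psi> z = a * norm (fst z) powr (p / (p - 1)) + \<tau> (snd z)" for z :: "(real ^ 'n) \<times> real"
  define K where "K = {z \<in> D. \<psi> z \<le> h z}"
  have compK: "compact K" using K unfolding K_def \<psi>_def .
  have KD: "K \<subseteq> D" by (auto simp: K_def)
  show ?thesis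
  proof (cases "K = {}")
    case True
    then have "z \<notin> K" by simp
    then show ?thesis using z by (simp add: K_def \<psi>_def)
  next
    case False
    define \<Theta> where "\<Theta> = Q \<times> {t1<..<t2}"
    have hc: "continuous_on \<Theta> h" and hw: "weak_solution p \<Theta> (\<lambda>z. ereal (h z))"
      using h by (auto simp: p_parabolic_def \<Theta>_def)
    have D\<Theta>: "D \<subseteq> \<Theta>" using D(2) by (simp add: \<Theta>_def)
    have \<tau>cont: "continuous_on {t1<..<t2} \<tau>"
      using \<tau> by (intro continuous_at_imp_continuous_on ballI) (blast intro: DERIV_isCont)
    have \<psi>c: "continuous_on \<Theta> \<psi>"
      unfolding \<psi>_def
      by (intro continuous_on_add continuous_on_compose2[OF continuous_potential[OF p, of UNIV]]
          continuous_on_compose2[OF \<tau>cont] continuous_on_fst continuous_on_snd continuous_on_id)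
        (auto simp: \<Theta>_def)
    have compK1: "compact (fst ` K)" and compK2: "compact (snd ` K)"
      by (intro compact_continuous_image compK continuous_on_fst continuous_on_snd continuous_on_id)+
    have K1Q: "fst ` K \<subseteq> Q" and K2t: "snd ` K \<subseteq> {t1<..<t2}" using KD D(2) by force+
    obtain e1 where e1: "e1 > 0" "{x. infdist x (fst ` K) \<le> e1} \<subseteq> Q" "compact {x. infdist x (fst ` K) \<le> e1}"
      using compact_infdist_nbhd[OF compK1 _ Q K1Q] False by (metis image_is_empty)
    \<comment> \<open>The weak formulation is available on cylinders, so \<open>K\<close> is
      enclosed in a product of neighbourhoods of its two projections.\<close>
    define U where "U = {x. infdist x (fst ` K) < e1}"
    have U: "open U" unfolding U_def by (rule continuous_on_infdist_open)
    have clU: "closure U \<subseteq> {x. infdist x (fst ` K) \<le> e1}"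
      by (rule closure_minimal) (use e1(3) in \<open>auto simp: U_def compact_imp_closed\<close>)
    have compU: "compact (closure U)"
      using closed_Int_compact[OF closed_closure[of U] e1(3)] clU by (simp add: Int_absorb2)
    obtain m where m: "m \<in> snd ` K" "\<And>t. t \<in> snd ` K \<Longrightarrow> m \<le> t"
      using compact_attains_inf[OF compK2] False by auto
    obtain M where M: "M \<in> snd ` K" "\<And>t. t \<in> snd ` K \<Longrightarrow> t \<le> M"
      using compact_attains_sup[OF compK2] False by auto
    define s1 where "s1 = (t1 + m) / 2"
    define s2 where "s2 = (M + t2) / 2"
    have mM: "t1 < m" "M < t2" "m \<le> M" using m M K2t by auto
    have s: "t1 < s1" "s1 < m" "M < s2" "s2 < t2" "s1 < s2" using mM by (auto simp: s1_def s2_def)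
    define C where "C = U \<times> {s1<..<s2}"
    have clC: "closure C = closure U \<times> {s1..s2}" using s by (simp add: C_def closure_Times)
    have C\<Theta>: "closure C \<subseteq> \<Theta>" using clU e1(2) s by (auto simp: clC \<Theta>_def)
    have compC: "compact (closure C)" unfolding clC by (intro compact_Times compU) simp
    have CC: "C \<Subset> \<Theta>" using C\<Theta> compC by (simp add: compactly_contained_def)
    have openC: "open C" unfolding C_def by (intro open_Times U) simp
    have KC: "K \<subseteq> C"
    proof
      fix z assume z: "z \<in> K"
      then have "infdist (fst z) (fst ` K) = 0" "m \<le> snd z" "snd z \<le> M" using m(2) M(2) by (auto intro: infdist_zero)
      then show "z \<in> C" using e1(1) s by (cases z) (auto simp: C_def U_def)
    qed
    have CsubTheta: "C \<subseteq> \<Theta>" using C\<Theta> closure_subset by blast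
    obtain R where R: "R > 0" "{z. infdist z K \<le> R} \<subseteq> C \<inter> D" "\<And>r. r > 0 \<Longrightarrow> compact {z. infdist z K \<le> r}"
      using compact_infdist_nbhd[OF compK False, of "C \<inter> D"] openC D(1) KC KD by (metis Int_greatest open_Int)
    \<comment> \<open>A point within r0 = R/4 of \<open>A\<close> has distance less than 3R/4 from
      \<open>K\<close>, so kernels of radius up to \<open>r0\<close> centred in \<open>A\<close> see
      only \<open>C\<close> and \<open>D\<close>.\<close>
    define A where "A = {z. infdist z K < R / 2}"
    define S where "S = {z. infdist z K \<le> R / 4}"
    define r0 where "r0 = R / 4"
    have openA: "open A" unfolding A_def by (rule continuous_on_infdist_open)
    have ball: "infdist y K \<le> R" if "z \<in> A" "dist y z \<le> r0" for y z
    proof -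
      have "infdist y K \<le> infdist z K + dist y z" by (rule infdist_triangle)
      then show ?thesis using that R(1) unfolding A_def r0_def by simp
    qed
    have Asub: "A \<subseteq> {z. infdist z K \<le> R}" unfolding A_def using R(1) by auto
    have bA: "bounded A" using R(3)[OF R(1)] Asub compact_imp_bounded bounded_subset by metis
    have ballC: "cball z r \<subseteq> C" if "z \<in> A" "r \<le> r0" for z r
      using ball[OF that(1)] that(2) R(2) by (force simp: dist_commute)
    have AD: "A \<subseteq> D" "A \<subseteq> C" using Asub R(2) by blast+
    define v where "v = (\<lambda>z. indicator C z * h z)"
    have vC: "v z = h z" if "z \<in> C" for z using that by (simp add: v_def)
    obtain M0 where M0: "\<And>z. \<bar>v z\<bar> \<le> M0"
    proof -
      have "bounded_fun_on C h"
        by (rule bounded_fun_on_compact[OF compC continuous_on_subset[OF hc C\<Theta>] closure_subset])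
      then obtain B where B: "B \<ge> 0" "\<And>z. z \<in> C \<Longrightarrow> \<bar>h z\<bar> \<le> B" by (rule bounded_fun_onE) blast
      then have "\<bar>v z\<bar> \<le> B" for z by (simp add: v_def indicator_def)
      then show ?thesis using that by blast
    qed
    obtain G :: "(real ^ 'n) \<times> real \<Rightarrow> real ^ 'n" where
      G: "G \<in> borel_measurable borel" "integrable lborel (\<lambda>z. norm (G z) powr p)"
      "\<And>i. integrable lborel (\<lambda>z. G z $ i)" "\<And>i. integrable lborel (\<lambda>z. flux p (G z) $ i)"
      and vi: "integrable lborel v"
      and weak: "\<And>r \<eta> z. mollifier r \<eta> \<Longrightarrow> cball z r \<subseteq> C \<Longrightarrow>
         (\<Sum>i\<in>UNIV. conv (\<lambda>y. frechet_derivative \<eta> (at y) (axis i 1, 0)) (\<lambda>y. flux p (G y) $ i) z)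
         = conv (\<lambda>y. frechet_derivative \<eta> (at y) (0, 1)) v z"
      and grad: "\<And>r \<eta> z i. mollifier r \<eta> \<Longrightarrow> cball z r \<subseteq> C \<Longrightarrow>
         conv (\<lambda>y. frechet_derivative \<eta> (at y) (axis i 1, 0)) v z = conv \<eta> (\<lambda>y. G y $ i) z"
      unfolding v_def
      by (rule weak_solution_mollified[OF p hw hc U s(5) C_def CC]) blast
    \<comment> \<open>The compact shell containing \<open>A - S\<close>. It misses \<open>K\<close>,
      so \<open>h - \<psi>\<close> is at most some -c < 0 there, and a mollification error of at
      most \<open>c\<close> keeps the mollified solution below \<open>\<psi>\<close>.\<close>
    define N where "N = {z. R / 4 \<le> infdist z K} \<inter> {z. infdist z K \<le> R / 2}"
    have compN: "compact N"
      unfolding N_def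
      by (intro closed_Int_compact closed_Collect_le continuous_intros R(3)) (use R(1) in simp)
    have ND: "N \<subseteq> D" using R(1,2) by (auto simp: N_def)
    have Nneg: "h z - \<psi> z < 0" if "z \<in> N" for z
    proof -
      have "z \<notin> K" using that R(1) infdist_zero[of z K] by (auto simp: N_def)
      then show ?thesis using that ND by (auto simp: K_def not_le)
    qed
    obtain c where c: "c > 0" "\<And>z. z \<in> N \<Longrightarrow> h z - \<psi> z \<le> - c"
    proof (cases "N = {}")
      case True
      then show ?thesis using that[of 1] by simp
    next
      case False
      have "continuous_on N (\<lambda>z. h z - \<psi> z)"
        using ND D\<Theta> by (intro continuous_on_diff continuous_on_subset[OF hc] continuous_on_subset[OF \<psi>c]) auto
      from continuous_attains_sup[OF compN False this] obtain z0 where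
        "z0 \<in> N" "\<And>z. z \<in> N \<Longrightarrow> h z - \<psi> z \<le> h z0 - \<psi> z0" by blast
      then show ?thesis using that[of "- (h z0 - \<psi> z0)"] Nneg[of z0] by auto
    qed
    have uc: "uniformly_continuous_on {z. infdist z K \<le> R} h"
      using R(2) CsubTheta by (intro compact_uniformly_continuous continuous_on_subset[OF hc] R(3)[OF R(1)]) auto
    have unif: "\<exists>d>0. \<forall>y z. infdist y K \<le> R \<longrightarrow> infdist z K \<le> R \<longrightarrow> dist y z < d \<longrightarrow> \<bar>h y - h z\<bar> \<le> e"
      if epos: "e > 0" for e
    proof -
      obtain d where "d > 0" and d: "\<And>z y. z \<in> {z. infdist z K \<le> R} \<Longrightarrow> y \<in> {z. infdist z K \<le> R} \<Longrightarrow> dist y z < d \<Longrightarrow> dist (h y) (h z) < e"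
        by (rule uniformly_continuous_onE[OF uc epos]) blast
      then show ?thesis
        by (intro exI[of _ d]) (auto simp: dist_real_def intro!: less_imp_le)
    qed
    have close: "\<exists>d>0. \<forall>r \<eta> z. mollifier r \<eta> \<longrightarrow> r \<le> r0 \<longrightarrow> r \<le> d \<longrightarrow> z \<in> A \<longrightarrow> \<bar>conv \<eta> v z - v z\<bar> \<le> e"
      if e: "e > 0" for e
    proof -
      from unif[OF e] obtain d where d: "d > 0"
        "\<And>y z. infdist y K \<le> R \<Longrightarrow> infdist z K \<le> R \<Longrightarrow> dist y z < d \<Longrightarrow> \<bar>h y - h z\<bar> \<le> e" by blast
      show ?thesis
      proof (intro exI[of _ d] conjI d(1) allI impI)
        fix r :: real and \<eta> :: "(real ^ 'n) \<times> real \<Rightarrow> real" and z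
        assume m: "mollifier r \<eta>" and r: "r \<le> r0" "r \<le> d" and z: "z \<in> A"
        show "\<bar>conv \<eta> v z - v z\<bar> \<le> e"
        proof (rule conv_close[OF m vi])
          fix y assume y: "dist y z < r"
          have yR: "infdist y K \<le> R" using ball[OF z, of y] y r by simp
          have zR: "infdist z K \<le> R" using z Asub by blast
          have "y \<in> C" "z \<in> C" using yR zR R(2) by blast+
          then show "\<bar>v y - v z\<bar> \<le> e" using d(2)[OF yR zR] y r by (simp add: vC)
        qed
      qed
    qed
    have r0: "r0 > 0" using R(1) by (simp add: r0_def)
    from close[OF c(1)] obtain dc where dc: "dc > 0"
      "\<And>r \<eta> z. mollifier r \<eta> \<Longrightarrow> r \<le> r0 \<Longrightarrow> r \<le> dc \<Longrightarrow> z \<in> A \<Longrightarrow> \<bar>conv \<eta> v z - v z\<bar> \<le> c" by blast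
    define r where "r j = min r0 dc / real (Suc j)" for j
    have rpos: "r j > 0" for j using r0 dc(1) by (simp add: r_def)
    have rle: "r j \<le> r0" "r j \<le> dc" for j
    proof -
      have "r j \<le> min r0 dc / 1" unfolding r_def by (rule divide_left_mono) (use r0 dc(1) in auto)
      then show "r j \<le> r0" "r j \<le> dc" by auto
    qed
    have rlim: "r \<longlonglongrightarrow> 0"
    proof -
      have "(\<lambda>j. min r0 dc * (1 / real (Suc j))) \<longlonglongrightarrow> min r0 dc * 0"
        by (intro tendsto_mult tendsto_const LIMSEQ_Suc[OF lim_1_over_n])
      then show ?thesis by (simp add: r_def[abs_def])
    qed
    have "\<exists>\<eta> :: (real ^ 'n) \<times> real \<Rightarrow> real. mollifier (r j) \<eta>" for j
      by (rule mollifier_exists[OF rpos])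
    then obtain \<eta> :: "nat \<Rightarrow> (real ^ 'n) \<times> real \<Rightarrow> real" where \<eta>: "\<And>j. mollifier (r j) (\<eta> j)"
      by metis
    have \<tau>sub: "snd z \<in> {t1<..<t2}" if "z \<in> A" for z using that AD D(2) by auto
    interpret MC: mollified_comparison p a r0 \<tau> \<tau>' v G A S
    proof
      show "closed S" unfolding S_def by (intro closed_Collect_le continuous_intros)
      show "S \<subseteq> A" unfolding S_def A_def using R(1) by auto
      have cc: "compact {z. infdist z K \<le> R / 2}" using R(1) by (intro R(3)) simp
      have tt: "snd z \<in> {t1<..<t2}" if "infdist z K \<le> R / 2" for z
      proof -
        have "z \<in> D" using that R(1,2) by auto
        then show ?thesis using D(2) by auto
      qed
      have im: "snd ` {z. infdist z K \<le> R / 2} \<subseteq> {t1<..<t2}" using tt by blast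
      have Acc: "A \<subseteq> {z. infdist z K \<le> R / 2}" by (auto simp: A_def)
      show "bounded_fun_on A (\<lambda>z. \<tau> (snd z))"
        by (rule bounded_fun_on_compact[OF cc continuous_on_compose2[OF \<tau>cont continuous_on_snd[OF continuous_on_id] im] Acc])
      show "bounded_fun_on A (\<lambda>z. \<tau>' (snd z))"
        by (rule bounded_fun_on_compact[OF cc continuous_on_compose2[OF \<tau>c continuous_on_snd[OF continuous_on_id] im] Acc])
    qed (use p a G vi weak grad ballC openA bA \<tau>m \<tau> \<tau>sub in auto)
    have MC\<psi>: "MC.\<psi> = \<psi>" by (rule ext) (simp add: MC.\<psi>_def \<psi>_def)
    have ae: "AE z in lborel. z \<in> A \<longrightarrow> v z \<le> MC.\<psi> z"
    proof (rule MC.comparison_ae[OF \<eta> rle(1) rlim])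
      show "conv (\<eta> j) v z \<le> MC.\<psi> z" if "z \<in> A - S" for j z
      proof -
        have "z \<in> N" "z \<in> A" using that by (auto simp: A_def S_def N_def)
        then show ?thesis
          using c(2)[of z] dc(2)[OF \<eta> rle, of z j] vC[of z] AD unfolding MC\<psi> by (auto simp: abs_le_iff)
      qed
      show "\<bar>v z\<bar> \<le> M0" for z by (rule M0)
      show "(\<lambda>j. conv (\<eta> j) v z) \<longlonglongrightarrow> v z" if z: "z \<in> A" for z
      proof (rule LIMSEQ_I)
        fix e :: real assume "e > 0"
        then have e2: "e / 2 > 0" by simp
        from close[OF this] obtain d where d: "d > 0"
          "\<And>r \<eta> z. mollifier r \<eta> \<Longrightarrow> r \<le> r0 \<Longrightarrow> r \<le> d \<Longrightarrow> z \<in> A \<Longrightarrow> \<bar>conv \<eta> v z - v z\<bar> \<le> e / 2" by blast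
        from order_tendstoD(2)[OF rlim d(1)] obtain j0 where j0: "\<And>j. j \<ge> j0 \<Longrightarrow> r j < d"
          unfolding eventually_sequentially by blast
        show "\<exists>no. \<forall>n\<ge>no. norm (conv (\<eta> n) v z - v z) < e"
        proof (intro exI allI impI)
          fix n assume "n \<ge> j0"
          then have "\<bar>conv (\<eta> n) v z - v z\<bar> \<le> e / 2" using d(2)[OF \<eta> rle(1) _ z] j0 by (simp add: less_imp_le)
          then show "norm (conv (\<eta> n) v z - v z) < e" using e2 by simp
        qed
      qed
      show "real CARD('n) * pot_flux p a < \<tau>' (snd z)" if "z \<in> A" for z
        by (rule super[OF \<tau>sub[OF that]])
    qed
    have ae': "AE z in lborel. z \<in> A \<longrightarrow> h z - \<psi> z \<le> 0"
      using ae by eventually_elim (use AD vC in \<open>auto simp: MC\<psi>\<close>)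
    have "continuous_on A (\<lambda>z. h z - \<psi> z)"
      using AD D\<Theta> by (intro continuous_on_diff continuous_on_subset[OF hc] continuous_on_subset[OF \<psi>c]) auto
    note all = open_AE_imp_all[OF openA this ae']
    have "h z \<le> \<psi> z"
    proof (cases "z \<in> A")
      case True
      then show ?thesis using all[of z] by simp
    next
      case False
      then have "z \<notin> K" using R(1) infdist_zero[of z K] by (auto simp: A_def)
      then show ?thesis using z by (simp add: K_def)
    qed
    then show ?thesis by (simp add: \<psi>_def)
  qed
qed

subsection \<open>Explicit solutions\<close>

lemma open_in_sets_lebesgue: "open S \<Longrightarrow> S \<in> sets lebesgue"
  by auto

lemma test_functionD:
  fixes \<phi> :: "'a::euclidean_space \<Rightarrow> real"
  assumes \<phi>: "\<phi> \<in> test_functions U"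
  shows "C_k k \<phi>" "x \<notin> U \<Longrightarrow> \<phi> x = 0" "x \<notin> U \<Longrightarrow> frechet_derivative \<phi> (at x) = (\<lambda>h. 0)"
    "\<exists>R. \<forall>z. R \<le> norm z \<longrightarrow> \<phi> z = 0"
proof -
  let ?K = "closure {x. \<phi> x \<noteq> 0}"
  have K: "compact ?K" "?K \<subseteq> U" using \<phi> by (auto simp: test_functions_def compactly_contained_def)
  show "C_k k \<phi>" using \<phi> by (simp add: test_functions_def)
  have nz: "\<phi> y = 0" if "y \<notin> ?K" for y using that closure_subset[of "{x. \<phi> x \<noteq> 0}"] by auto
  show "\<phi> x = 0" if "x \<notin> U" using that K(2) by (intro nz) auto
  show "frechet_derivative \<phi> (at x) = (\<lambda>h. 0)" if "x \<notin> U"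
  proof -
    have "((\<lambda>_. 0) has_derivative (\<lambda>h. 0)) (at x)" by simp
    then have "(\<phi> has_derivative (\<lambda>h. 0)) (at x)"
    proof (rule has_derivative_transform_within_open)
      show "open (- ?K)" by (intro open_Compl closed_closure)
      show "x \<in> - ?K" using that K(2) by auto
      show "0 = \<phi> y" if "y \<in> - ?K" for y using nz[of y] that by simp
    qed
    then show ?thesis by (rule frechet_derivative_at[symmetric])
  qed
  obtain R where R: "\<forall>x\<in>?K. norm x \<le> R" using compact_imp_bounded[OF K(1)] unfolding bounded_iff ..
  show "\<exists>R. \<forall>z. R \<le> norm z \<longrightarrow> \<phi> z = 0"
  proof (intro exI[of _ "R + 1"] allI impI)
    fix z :: 'a assume "R + 1 \<le> norm z"
    then have "z \<notin> ?K" using R by force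
    then show "\<phi> z = 0" by (rule nz)
  qed
qed

lemma integration_by_parts_test:
  fixes f :: "'a::euclidean_space \<Rightarrow> real"
  assumes \<phi>: "\<phi> \<in> test_functions U" and e: "e \<in> Basis" and U: "U \<in> sets lebesgue"
    and d: "\<And>z. has_dderiv f (f' z) e z" and c: "continuous_on UNIV f" "continuous_on UNIV f'"
  shows "(\<integral>z. f z * frechet_derivative \<phi> (at z) e \<partial>lebesgue_on U) = - (\<integral>z. \<phi> z * f' z \<partial>lebesgue_on U)"
    "integrable (lebesgue_on U) (\<lambda>z. f z * frechet_derivative \<phi> (at z) e)"
    "integrable (lebesgue_on U) (\<lambda>z. \<phi> z * f' z)"
proof -
  let ?d = "\<lambda>z. frechet_derivative \<phi> (at z) e"
  have c1: "C_k (Suc 0) \<phi>" using test_functionD(1)[OF \<phi>] .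
  have \<phi>c: "continuous_on UNIV \<phi>" using test_functionD(1)[OF \<phi>, of 0] by simp
  have dc: "continuous_on UNIV ?d" using C_k_imp_partial(1)[OF c1 e] .
  have \<phi>d: "has_dderiv \<phi> (?d z) e z" for z using C_k_imp_partial(2)[OF c1 e] .
  obtain R where R: "\<And>z. R \<le> norm z \<Longrightarrow> \<phi> z = 0" using test_functionD(4)[OF \<phi>] by blast
  have dR: "?d z = 0" if "R < norm z" for z using frechet_derivative_outside_support[OF R that] by simp
  have m [measurable]: "f \<in> borel_measurable borel" "f' \<in> borel_measurable borel" "\<phi> \<in> borel_measurable borel" "?d \<in> borel_measurable borel"
    using c \<phi>c dc by (auto intro: borel_measurable_continuous_onI)
  have cs: "continuous_on UNIV (\<lambda>z. f z * ?d z)" "continuous_on UNIV (\<lambda>z. \<phi> z * f' z)" "continuous_on UNIV (\<lambda>z. f z * \<phi> z)"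
    "continuous_on UNIV (\<lambda>z. f' z * \<phi> z + f z * ?d z)"
    using c \<phi>c dc by (auto intro!: continuous_on_mult continuous_on_add)
  have i: "integrable lborel g" if g: "continuous_on UNIV g" "\<And>z. R < norm z \<Longrightarrow> g z = 0" for g :: "'a \<Rightarrow> real"
  proof -
    obtain B where B: "\<And>z. \<bar>g z\<bar> \<le> B" using continuous_bounded_support[OF g(1), of R] g(2) by blast
    show ?thesis by (rule integrable_bounded_support[OF borel_measurable_continuous_onI[OF g(1)] B g(2)])
  qed
  have i1: "integrable lborel (\<lambda>z. f z * ?d z)" by (rule i[OF cs(1)]) (simp add: dR)
  have i2: "integrable lborel (\<lambda>z. \<phi> z * f' z)" by (rule i[OF cs(2)]) (simp add: R)
  obtain L where L: "\<And>z. \<bar>f' z * \<phi> z + f z * ?d z\<bar> \<le> L"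
    using continuous_bounded_support[OF cs(4), of R] dR R by fastforce
  obtain B where B: "\<And>z. \<bar>f z * \<phi> z\<bar> \<le> B"
    using continuous_bounded_support[OF cs(3), of R] R by fastforce
  have "(\<integral>z. f' z * \<phi> z + f z * ?d z \<partial>lborel) = 0"
    by (rule integral_dderiv_eq_0[OF _ _ has_dderiv_mult[OF d \<phi>d] L B, of R]) (auto simp: R)
  then have 0: "(\<integral>z. f z * ?d z \<partial>lborel) = - (\<integral>z. \<phi> z * f' z \<partial>lborel)"
    using i1 i2 by (simp add: mult.commute[of "f' _"])
  have ae1: "AE x in lborel. indicator U x * (f x * ?d x) = f x * ?d x"
    using test_functionD(3)[OF \<phi>] by (intro AE_I2) (auto simp: indicator_def)
  have ae2: "AE x in lborel. indicator U x * (\<phi> x * f' x) = \<phi> x * f' x"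
    using test_functionD(2)[OF \<phi>] by (intro AE_I2) (auto simp: indicator_def)
  have m1: "(\<lambda>z. f z * ?d z) \<in> borel_measurable borel" and m2: "(\<lambda>z. \<phi> z * f' z) \<in> borel_measurable borel" by measurable
  note r1 = lebesgue_on_integral_eq[OF U borel_imp_lebesgue_on[OF m1] m1 ae1]
  note r2 = lebesgue_on_integral_eq[OF U borel_imp_lebesgue_on[OF m2] m2 ae2]
  show "(\<integral>z. f z * ?d z \<partial>lebesgue_on U) = - (\<integral>z. \<phi> z * f' z \<partial>lebesgue_on U)"
    "integrable (lebesgue_on U) (\<lambda>z. f z * ?d z)" "integrable (lebesgue_on U) (\<lambda>z. \<phi> z * f' z)"
    using r1 r2 0 i1 i2 by auto
qed

lemma continuous_imp_Lp:
  fixes f :: "'a::euclidean_space \<Rightarrow> 'b::euclidean_space"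
  assumes f: "continuous_on UNIV f" and S: "bounded S" "S \<in> sets lebesgue" and p: "p > 0"
  shows "f \<in> Lp p S"
proof -
  have fm: "f \<in> borel_measurable borel" using f by (rule borel_measurable_continuous_onI)
  have m: "f \<in> borel_measurable (lebesgue_on S)" by (rule borel_imp_lebesgue_on[OF fm])
  obtain R where "\<forall>x\<in>S. norm x \<le> R" using S(1) unfolding bounded_iff ..
  then have R: "S \<subseteq> cball 0 R" by auto
  have "bounded (f ` cball 0 R)"
    by (intro compact_imp_bounded compact_continuous_image continuous_on_subset[OF f]) auto
  then obtain B where "\<forall>y\<in>f ` cball 0 R. norm y \<le> B" unfolding bounded_iff ..
  then have B: "\<And>x. x \<in> S \<Longrightarrow> norm (f x) \<le> B" using R by blast
  have c: "integrable (lebesgue_on S) (\<lambda>x. B powr p)"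
    by (rule lmeasurable_integrable_const[OF bounded_set_imp_lmeasurable[OF S]])
  have "integrable (lebesgue_on S) (\<lambda>x. norm (f x) powr p)"
  proof (rule Bochner_Integration.integrable_bound[OF c])
    show "(\<lambda>x. norm (f x) powr p) \<in> borel_measurable (lebesgue_on S)" using m by measurable
    show "AE x in lebesgue_on S. norm (norm (f x) powr p) \<le> norm (B powr p)"
      using B p by (intro AE_I2) (auto intro!: powr_mono2)
  qed
  then show ?thesis using m by (simp add: Lp_def)
qed

text \<open>The copies of -w with centre \<open>y\<close> and height \<open>c\<close>. They are
  verified to be p-parabolic and serve as the functions that touch from below; w itself enters only
  as a comparison function.\<close>

definition pot_sol :: "real \<Rightarrow> real \<Rightarrow> real ^ 'n \<Rightarrow> real \<Rightarrow> (real ^ 'n) \<times> real \<Rightarrow> real" where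
  "pot_sol p a y c z = c - (a * norm (fst z - y) powr (p / (p - 1)) + real CARD('n) * pot_flux p a * snd z)"

lemma has_derivative_pot_sol:
  fixes z :: "(real ^ 'n) \<times> real"
  assumes p: "p > 1"
  shows "(pot_sol p a y c has_derivative (\<lambda>h. - (pot_grad p a (fst z - y) \<bullet> fst h) - real CARD('n) * pot_flux p a * snd h)) (at z)"
proof -
  have "((\<lambda>z. fst z - y) has_derivative fst) (at z)" by (auto intro!: derivative_eq_intros)
  from has_derivative_compose[OF this has_derivative_potential[OF p]]
  have "((\<lambda>z. a * norm (fst z - y) powr (p / (p - 1))) has_derivative (\<lambda>h. pot_grad p a (fst z - y) \<bullet> fst h)) (at z)" .
  moreover have "((\<lambda>z. real CARD('n) * pot_flux p a * snd z) has_derivative (\<lambda>h. real CARD('n) * pot_flux p a * snd h)) (at z)"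
    by (intro has_derivative_mult_right has_derivative_snd has_derivative_ident)
  ultimately have "((\<lambda>z. c - (a * norm (fst z - y) powr (p / (p - 1)) + real CARD('n) * pot_flux p a * snd z)) has_derivative
      (\<lambda>h. 0 - (pot_grad p a (fst z - y) \<bullet> fst h + real CARD('n) * pot_flux p a * snd h))) (at z)"
    by (intro has_derivative_diff has_derivative_const has_derivative_add)
  then show ?thesis
    unfolding pot_sol_def[abs_def] by (rule has_derivative_eq_rhs) (simp add: fun_eq_iff)
qed

lemma continuous_pot_sol:
  assumes "p > 1" shows "continuous_on S (pot_sol p a y c)"
  by (intro continuous_at_imp_continuous_on ballI has_derivative_continuous[OF has_derivative_pot_sol[OF assms]])

lemma flux_minus: "flux p (- v) = - flux p v"
  by (simp add: flux_def)

lemma CL2_pot_sol: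
  assumes p: "p > 1" and U: "bounded U" "U \<in> sets lebesgue"
  shows "CL2 U t1 t2 (pot_sol p a y c)"
  unfolding CL2_def
proof (intro ballI conjI)
  fix t assume "t \<in> {t1..t2}"
  have "continuous_on UNIV (\<lambda>x. pot_sol p a y c (x, t))"
    by (rule continuous_on_compose2[OF continuous_pot_sol[OF p, of UNIV]]) (auto intro!: continuous_intros)
  then show "(\<lambda>x. pot_sol p a y c (x, t)) \<in> Lp 2 U" using U by (intro continuous_imp_Lp) auto
  define k where "k = real CARD('a) * pot_flux p a"
  define m where "m = measure (lebesgue_on U) (space (lebesgue_on U))"
  have "Lp_norm 2 U (\<lambda>x. pot_sol p a y c (x, s) - pot_sol p a y c (x, t)) = ((k * (s - t))\<^sup>2 * m) powr (1 / 2)" for s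
  proof -
    have "pot_sol p a y c (x, s) - pot_sol p a y c (x, t) = - (k * (s - t))" for x
      by (simp add: pot_sol_def k_def algebra_simps)
    then show ?thesis by (simp add: Lp_norm_def m_def abs_mult mult_ac power_mult_distrib)
  qed
  moreover have "((\<lambda>s. ((k * (s - t))\<^sup>2 * m) powr (1 / 2)) \<longlongrightarrow> ((k * (t - t))\<^sup>2 * m) powr (1 / 2)) (at t within {t1..t2})"
    by (intro tendsto_powr' tendsto_intros) (auto simp: m_def)
  ultimately show "((\<lambda>s. Lp_norm 2 U (\<lambda>x. pot_sol p a y c (x, s) - pot_sol p a y c (x, t))) \<longlongrightarrow> 0) (at t within {t1..t2})"
    by simp
qed

text \<open>The flux of the gradient is -\<alpha> (x - y), a smooth field. Integration by parts
  gives n \<alpha> times the integral of the test function for both terms of the weak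
  formulation.\<close>

lemma p_parabolic_pot_sol:
  fixes y :: "real ^ 'n"
  assumes p: "p > 1" and a: "a \<ge> 0"
  shows "p_parabolic p W (pot_sol p a y c)"
  unfolding p_parabolic_def weak_solution_def Let_def real_of_ereal.simps
proof (intro conjI allI impI ballI)
  show "continuous_on W (pot_sol p a y c)" by (rule continuous_pot_sol[OF p])
  fix U :: "(real ^ 'n) set" and t1 t2 :: real
  assume U: "open U" and t: "t1 < t2" and CW: "U \<times> {t1<..<t2} \<Subset> W"
  let ?C = "U \<times> {t1<..<t2}" and ?H = "pot_sol p a y c"
  define n\<alpha> where "n\<alpha> = real CARD('n) * pot_flux p a"
  have "bounded (closure ?C)" using CW by (auto simp: compactly_contained_def compact_imp_bounded)
  then have bC: "bounded ?C" using bounded_subset closure_subset by blast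
  have "U \<subseteq> fst ` ?C" using t by (auto simp: image_iff intro!: bexI[of _ "(t1+t2)/2"])
  then have bU: "bounded U" using bC bounded_fst bounded_subset by blast
  have UL: "U \<in> sets lebesgue" and CL: "?C \<in> sets lebesgue"
    by (intro open_in_sets_lebesgue U open_Times open_greaterThanLessThan)+
  show "CL2 U t1 t2 ?H" by (rule CL2_pot_sol[OF p bU UL])
  define G where "G z = - pot_grad p a (fst z - y)" for z :: "(real ^ 'n) \<times> real"
  have Gc: "continuous_on UNIV G"
    unfolding G_def[abs_def]
    by (intro continuous_on_minus continuous_on_compose2[OF continuous_pot_grad[OF p]]) (auto intro!: continuous_intros)
  have Hx: "has_dderiv ?H (G z $ i) (axis i 1, 0) z" for z i
    using has_derivative_imp_dderiv[OF has_derivative_pot_sol[OF p, of a y c z], of "(axis i 1, 0)"]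
    by (simp add: G_def inner_axis)
  have Ht: "has_dderiv ?H (- n\<alpha>) (0, 1) z" for z
    using has_derivative_imp_dderiv[OF has_derivative_pot_sol[OF p, of a y c z], of "(0, 1)"]
    by (simp add: n\<alpha>_def)
  have W: "W1p_grad p U (\<lambda>x. ?H (x, s)) (\<lambda>x. G (x, s))" for s
    unfolding W1p_grad_def
  proof (intro conjI ballI)
    have Hs: "continuous_on UNIV (\<lambda>x. ?H (x, s))"
      by (rule continuous_on_compose2[OF continuous_pot_sol[OF p, of UNIV]]) (auto intro!: continuous_intros)
    have Gs: "continuous_on UNIV (\<lambda>x. G (x, s))"
      by (rule continuous_on_compose2[OF Gc]) (auto intro!: continuous_intros)
    show "(\<lambda>x. ?H (x, s)) \<in> Lp p U" "(\<lambda>x. G (x, s)) \<in> Lp p U"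
      using Hs Gs bU UL p by (auto intro!: continuous_imp_Lp)
    fix \<phi> assume \<phi>: "\<phi> \<in> test_functions U"
    have Hd: "has_dderiv (\<lambda>x. ?H (x, s)) (G (x, s) $ i) (axis i 1) x" for x i
      using Hx[of "(x, s)" i] by (simp add: has_dderiv_def)
    have ax: "axis i 1 \<in> (Basis :: (real ^ 'n) set)" for i by (auto simp: Basis_vec_def)
    have Gsi: "continuous_on UNIV (\<lambda>x. G (x, s) $ i)" for i by (intro continuous_on_component Gs)
    note ibp = integration_by_parts_test[OF \<phi> ax UL Hd Hs Gsi]
    have vi: "integrable M f" if "\<And>i. integrable M (\<lambda>x. f x $ i)" for M and f :: "real ^ 'n \<Rightarrow> real ^ 'n"
    proof -
      have "integrable M (\<lambda>x. \<Sum>i\<in>UNIV. f x $ i *\<^sub>R axis i (1 :: real))"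
        using that by (intro Bochner_Integration.integrable_sum integrable_scaleR_left) auto
      moreover have "(\<Sum>i\<in>UNIV. f x $ i *\<^sub>R axis i 1) = f x" for x
        using basis_expansion[of "f x"] by (simp add: scalar_mult_eq_scaleR)
      ultimately show ?thesis by (simp only:)
    qed
    have i1: "integrable (lebesgue_on U) (\<lambda>x. ?H (x, s) *\<^sub>R grad \<phi> x)"
      by (rule vi) (use ibp(2) in \<open>simp add: grad_def\<close>)
    have i2: "integrable (lebesgue_on U) (\<lambda>x. \<phi> x *\<^sub>R G (x, s))"
      by (rule vi) (use ibp(3) in simp)
    show "(\<integral>x. ?H (x, s) *\<^sub>R grad \<phi> x \<partial>lebesgue_on U) = - (\<integral>x. \<phi> x *\<^sub>R G (x, s) \<partial>lebesgue_on U)"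
      unfolding vec_eq_iff
    proof
      fix i
      show "(\<integral>x. ?H (x, s) *\<^sub>R grad \<phi> x \<partial>lebesgue_on U) $ i = (- (\<integral>x. \<phi> x *\<^sub>R G (x, s) \<partial>lebesgue_on U)) $ i"
        using integral_bounded_linear[OF bounded_linear_vec_nth i1, of i]
          integral_bounded_linear[OF bounded_linear_vec_nth i2, of i] ibp(1)[of i]
        by (simp add: grad_def)
    qed
  qed
  show "\<exists>G. LpW1p_grad p U t1 t2 ?H G \<and>
             (\<forall>\<phi>\<in>test_functions ?C.
                (\<integral>z. (norm (G z) powr (p - 2) *\<^sub>R G z) \<bullet> grad_x \<phi> z \<partial>lebesgue_on ?C)
                - (\<integral>z. ?H z * deriv_t \<phi> z \<partial>lebesgue_on ?C) = 0)"
  proof (intro exI[of _ G] conjI ballI)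
    show "LpW1p_grad p U t1 t2 ?H G"
      unfolding LpW1p_grad_def
      using W continuous_imp_Lp[OF continuous_pot_sol[OF p] bC CL] continuous_imp_Lp[OF Gc bC CL] p by auto
    fix \<phi> assume \<phi>: "\<phi> \<in> test_functions ?C"
    define \<alpha> where "\<alpha> = pot_flux p a"
    have fl: "norm (G z) powr (p - 2) *\<^sub>R G z = - (\<alpha> *\<^sub>R (fst z - y))" for z
      using flux_minus[of p "pot_grad p a (fst z - y)"] flux_pot_grad[OF p a, of "fst z - y"]
      unfolding G_def \<alpha>_def flux_def by simp
    have cd: "has_dderiv (\<lambda>z. \<alpha> * (fst z - y) $ i) \<alpha> (axis i 1, 0) z" for i z
      unfolding has_dderiv_def by (auto intro!: derivative_eq_intros simp: axis_def)
    have cc: "continuous_on UNIV (\<lambda>z :: (real ^ 'n) \<times> real. \<alpha> * (fst z - y) $ i)" for i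
      by (intro continuous_intros)
    note b1 = integration_by_parts_test[OF \<phi> axis_0_in_Basis CL cd cc continuous_on_const]
    note b2 = integration_by_parts_test[OF \<phi> zero_1_in_Basis CL Ht continuous_pot_sol[OF p] continuous_on_const]
    have "(\<integral>z. (norm (G z) powr (p - 2) *\<^sub>R G z) \<bullet> grad_x \<phi> z \<partial>lebesgue_on ?C)
      = (\<integral>z. - (\<Sum>i\<in>UNIV. (\<alpha> * (fst z - y) $ i) * frechet_derivative \<phi> (at z) (axis i 1, 0)) \<partial>lebesgue_on ?C)"
      by (intro Bochner_Integration.integral_cong refl) (simp add: fl inner_vec_def grad_x_def sum_negf mult.assoc)
    also have "\<dots> = - (\<Sum>i\<in>(UNIV :: 'n set). - (\<integral>z. \<phi> z * \<alpha> \<partial>lebesgue_on ?C))"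
      using b1(1,2) by (simp add: Bochner_Integration.integral_sum)
    also have "\<dots> = real CARD('n) * (\<integral>z. \<phi> z * \<alpha> \<partial>lebesgue_on ?C)" by (simp add: sum_negf)
    finally have 1: "(\<integral>z. (norm (G z) powr (p - 2) *\<^sub>R G z) \<bullet> grad_x \<phi> z \<partial>lebesgue_on ?C)
      = n\<alpha> * (\<integral>z. \<phi> z \<partial>lebesgue_on ?C)" by (simp add: n\<alpha>_def \<alpha>_def)
    have 2: "(\<integral>z. ?H z * deriv_t \<phi> z \<partial>lebesgue_on ?C) = n\<alpha> * (\<integral>z. \<phi> z \<partial>lebesgue_on ?C)"
      unfolding deriv_t_def b2(1) by simp
    show "(\<integral>z. (norm (G z) powr (p - 2) *\<^sub>R G z) \<bullet> grad_x \<phi> z \<partial>lebesgue_on ?C)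
      - (\<integral>z. ?H z * deriv_t \<phi> z \<partial>lebesgue_on ?C) = 0" unfolding 1 2 by simp
  qed
qed auto

subsection \<open>Superparabolic functions\<close>

definition pot_super :: "real \<Rightarrow> real \<Rightarrow> (real ^ 'n) \<times> real \<Rightarrow> real" where
  "pot_super p a z = a * norm (fst z) powr (p / (p - 1)) + real CARD('n) * pot_flux p a * snd z"

definition trunc_super :: "real \<Rightarrow> real \<Rightarrow> real \<Rightarrow> real \<Rightarrow> (real ^ 'n) \<times> real \<Rightarrow> real" where
  "trunc_super p a \<delta> k z = (if norm (fst z) < \<delta> then min (pot_super p a z) k else k)"

lemma continuous_pot_super:
  assumes "p > 1"
  shows "continuous_on S (pot_super p a)"
  unfolding pot_super_def[abs_def]
  by (intro continuous_on_add continuous_on_compose2[OF continuous_potential[OF assms, of UNIV]]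
      continuous_on_mult continuous_on_const continuous_on_snd continuous_on_fst continuous_on_id) auto

text \<open>Where \<open>pot_super\<close> exceeds \<open>k\<close>, the minimum equals
  \<open>k\<close>. By \<open>sph\<close> this happens near every point of the sphere |x| = \<delta>
  in the domain, so the two branches are glued along overlapping open sets.\<close>

lemma continuous_trunc_super:
  fixes \<Theta> :: "((real ^ 'n) \<times> real) set"
  assumes p: "p > 1" and sph: "\<And>z. z \<in> \<Theta> \<Longrightarrow> norm (fst z) = \<delta> \<Longrightarrow> k < pot_super p a z"
  shows "continuous_on \<Theta> (trunc_super p a \<delta> k)"
proof -
  let ?X1 = "{z :: (real ^ 'n) \<times> real. norm (fst z) < \<delta>}"
  let ?X2 = "{z. \<delta> < norm (fst z)} \<union> {z. k < pot_super p a z}"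
  have o: "open ?X1" "open ?X2"
    by (intro open_Un open_Collect_less continuous_intros continuous_pot_super[OF p])+
  have c1: "continuous_on ?X1 (trunc_super p a \<delta> k)"
  proof (rule continuous_on_eq)
    show "continuous_on ?X1 (\<lambda>z. min (pot_super p a z) k)"
      by (intro continuous_on_min continuous_pot_super[OF p] continuous_on_const)
  qed (simp add: trunc_super_def)
  have c2: "continuous_on ?X2 (trunc_super p a \<delta> k)"
  proof (rule continuous_on_eq)
    show "continuous_on ?X2 (\<lambda>z. k)" by (rule continuous_on_const)
  qed (auto simp: trunc_super_def)
  have "continuous_on (?X1 \<union> ?X2) (trunc_super p a \<delta> k)"
    by (rule continuous_on_open_Un[OF o c1 c2])
  moreover have "\<Theta> \<subseteq> ?X1 \<union> ?X2" using sph by force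
  ultimately show ?thesis by (rule continuous_on_subset)
qed

text \<open>Adding e / (t2 - t) makes the comparison function a strict supersolution and keeps the
  contact set away from t = t2, so inequalities are required only below the final time; then e tends
  to 0. The sets \<open>B\<close> and \<open>D\<close> allow part of a box, such as its intersection
  with |x| < \<delta>.\<close>

lemma box_comparison:
  fixes h :: "(real ^ 'n) \<times> real \<Rightarrow> real"
  assumes p: "p > 1" and a: "a \<ge> 0" and t: "t1 < t2" and h: "p_parabolic p (Q \<times> {t1<..<t2}) h"
    and Q: "open Q" "bounded Q" and hc: "continuous_on (closure (Q \<times> {t1<..<t2})) h"
    and B: "closed B" and D: "open D" "D \<subseteq> (Q \<times> {t1<..<t2}) \<inter> B"
    and le: "\<And>z. z \<in> closure (Q \<times> {t1<..<t2}) \<inter> B - D \<Longrightarrow> snd z < t2 \<Longrightarrow> h z \<le> c + pot_super p a z"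
    and z: "z \<in> D"
  shows "h z \<le> c + pot_super p a z"
proof -
  let ?QT = "Q \<times> {t1<..<t2}"
  define k where "k = real CARD('n) * pot_flux p a"
  have z2: "snd z < t2" using z D(2) by auto
  have main: "h z \<le> c + pot_super p a z + e / (t2 - snd z)" if e: "e > 0" for e
  proof -
    let ?\<tau> = "\<lambda>t. c + k * t + e / (t2 - t)" and ?\<tau>' = "\<lambda>t. k + e / (t2 - t)\<^sup>2"
    have "h z \<le> a * norm (fst z) powr (p / (p - 1)) + ?\<tau> (snd z)"
    proof (rule weak_comparison[OF p Q(1) h a, where \<tau>' = ?\<tau>' and D=D])
      show "?\<tau> \<in> borel_measurable borel" "?\<tau>' \<in> borel_measurable borel" by measurable
      show "(?\<tau> has_real_derivative ?\<tau>' t) (at t)" if "t \<in> {t1<..<t2}" for t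
        using that by (auto intro!: derivative_eq_intros simp: power2_eq_square)
      show "continuous_on {t1<..<t2} ?\<tau>'" by (intro continuous_intros) auto
      show "real CARD('n) * pot_flux p a < ?\<tau>' t" if "t \<in> {t1<..<t2}" for t
        using that e by (simp add: k_def)
      show "open D" "D \<subseteq> ?QT" "z \<in> D" using D z by auto
      let ?K = "{z \<in> D. a * norm (fst z) powr (p / (p - 1)) + ?\<tau> (snd z) \<le> h z}"
      \<comment> \<open>The contact set with the denominator cleared: this form is closed up to t =
        t2, and since e > 0 it contains no point of that level. Points outside \<open>D\<close> are
        excluded by \<open>le\<close>.\<close>
      let ?K' = "(closure ?QT \<inter> B) \<inter> {z \<in> closure ?QT. e \<le> (t2 - snd z) * (h z - c - pot_super p a z)}"
      have "compact (closure ?QT)" using Q(2) by (simp add: bounded_Times)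
      then have "compact (closure ?QT \<inter> B)" using B by (rule compact_Int_closed)
      moreover have "closed {z \<in> closure ?QT. e \<le> (t2 - snd z) * (h z - c - pot_super p a z)}"
        by (intro continuous_on_closed_Collect_le closed_closure continuous_on_mult continuous_on_diff
            continuous_on_const continuous_on_snd continuous_on_id hc continuous_pot_super[OF p])
      ultimately have "compact ?K'" by (rule compact_Int_closed)
      moreover have "?K = ?K'"
      proof (intro set_eqI iffI)
        fix z assume "z \<in> ?K"
        then have zD: "z \<in> D" and ge: "c + pot_super p a z + e / (t2 - snd z) \<le> h z"
          by (auto simp: pot_super_def k_def algebra_simps)
        have zQ: "z \<in> ?QT" "z \<in> B" and pos: "t2 - snd z > 0" using zD D(2) by auto
        have "e / (t2 - snd z) \<le> h z - c - pot_super p a z" using ge by linarith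
        then have "e \<le> (t2 - snd z) * (h z - c - pot_super p a z)" using pos by (simp add: divide_le_eq mult.commute)
        then show "z \<in> ?K'" using zQ closure_subset[of ?QT] by auto
      next
        fix z assume "z \<in> ?K'"
        then have zc: "z \<in> closure ?QT" "z \<in> B" and ge: "e \<le> (t2 - snd z) * (h z - c - pot_super p a z)" by auto
        have "closure ?QT = closure Q \<times> {t1..t2}" using t by (simp add: closure_Times)
        then have "snd z \<le> t2" using zc by auto
        moreover have "snd z \<noteq> t2" using ge e by auto
        ultimately have lt: "snd z < t2" by simp
        have "z \<in> D"
        proof (rule ccontr)
          assume "z \<notin> D"
          then have "h z - c - pot_super p a z \<le> 0" using le[of z] zc lt by auto
          then have "(t2 - snd z) * (h z - c - pot_super p a z) \<le> 0" using lt by (simp add: mult_nonneg_nonpos)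
          then show False using ge e by linarith
        qed
        moreover have "e / (t2 - snd z) \<le> h z - c - pot_super p a z" using ge lt by (simp add: divide_le_eq mult.commute)
        ultimately show "z \<in> ?K" by (auto simp: pot_super_def k_def algebra_simps)
      qed
      ultimately show "compact ?K" by simp
    qed
    then show ?thesis by (simp add: pot_super_def k_def)
  qed
  show ?thesis
  proof (rule field_le_epsilon)
    fix e :: real assume e: "e > 0"
    have pos: "t2 - snd z > 0" using z2 by simp
    have "h z \<le> c + pot_super p a z + (e * (t2 - snd z)) / (t2 - snd z)"
      by (rule main) (use e pos in simp)
    then show "h z \<le> c + pot_super p a z + e" using pos by simp
  qed
qed

text \<open>The comparison is done twice. First h is compared with the constant c + k in the whole
  box. Then h is compared with c + \<open>pot_super\<close> in the part |x| < \<delta>; on the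
  sphere the first bound provides the boundary inequality, since \<open>pot_super\<close> exceeds
  \<open>k\<close> there.\<close>

lemma superparabolic_trunc_super:
  fixes \<Theta> :: "((real ^ 'n) \<times> real) set"
  assumes p: "p > 1" and a: "a \<ge> 0" and sph: "\<And>z. z \<in> \<Theta> \<Longrightarrow> norm (fst z) = \<delta> \<Longrightarrow> k < pot_super p a z"
  shows "p_superparabolic p \<Theta> (\<lambda>z. ereal (c + trunc_super p a \<delta> k z))"
  unfolding p_superparabolic_def Let_def
proof (intro conjI ballI allI impI)
  let ?u = "trunc_super p a \<delta> k :: (real ^ 'n) \<times> real \<Rightarrow> real"
  show "\<Theta> \<subseteq> closure {z \<in> \<Theta>. \<bar>ereal (c + ?u z)\<bar> \<noteq> \<infinity>}" by (simp add: closure_subset)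
  have uc: "continuous_on \<Theta> ?u" by (rule continuous_trunc_super[OF p sph])
  show "lower_semicontinuous_on \<Theta> (\<lambda>z. ereal (c + ?u z))"
    unfolding lower_semicontinuous_on_def le_Liminf_iff
  proof (intro ballI allI impI)
    fix z and y :: ereal assume z: "z \<in> \<Theta>" and y: "y < ereal (c + ?u z)"
    have "continuous_on \<Theta> (\<lambda>z. ereal (c + ?u z))"
      by (intro continuous_on_ereal continuous_on_add continuous_on_const uc)
    then have "((\<lambda>z. ereal (c + ?u z)) \<longlongrightarrow> ereal (c + ?u z)) (at z within \<Theta>)"
      using z by (simp add: continuous_on_def)
    from order_tendstoD(1)[OF this y] show "\<forall>\<^sub>F x in at z within \<Theta>. y < ereal (c + ?u x)" .
  qed
  fix q b :: "real ^ 'n" and t1 t2 :: real and h :: "(real ^ 'n) \<times> real \<Rightarrow> real" and z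
  let ?Q = "box q b" let ?QT = "?Q \<times> {t1<..<t2}"
  assume qb: "\<forall>i. q $ i < b $ i" and t: "t1 < t2" and C: "?QT \<Subset> \<Theta>" and h: "p_parabolic p ?QT h"
    and hc: "continuous_on (closure ?QT) h"
    and bd: "\<forall>z\<in>closure ?Q \<times> {t1} \<union> frontier ?Q \<times> {t1<..t2}. ereal (h z) \<le> ereal (c + ?u z)"
    and z: "z \<in> ?QT"
  have cl: "closure ?QT = closure ?Q \<times> {t1..t2}" using t by (simp add: closure_Times)
  have fr: "frontier ?Q = closure ?Q - ?Q" by (simp only: frontier_def interior_open[OF open_box])
  have C\<Theta>: "closure ?QT \<subseteq> \<Theta>" using C by (simp add: compactly_contained_def)
  have bd': "h z \<le> c + ?u z" if "z \<in> closure ?QT - ?QT" "snd z < t2" for z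
  proof -
    have "z \<in> closure ?Q \<times> {t1} \<union> frontier ?Q \<times> {t1<..t2}"
      using that unfolding cl fr by (cases z) auto
    then show ?thesis using bd by auto
  qed
  \<comment> \<open>Slope 0 makes constants a special case of the comparison function.\<close>
  have k0: "pot_super p 0 z = 0" for z :: "(real ^ 'n) \<times> real" by (simp add: pot_super_def pot_flux_def)
  have uk: "?u z \<le> k" for z by (simp add: trunc_super_def)
  have step1: "h z \<le> c + k" if "z \<in> ?QT" for z
  proof -
    have "h z \<le> (c + k) + pot_super p 0 z"
    proof (rule box_comparison[OF p _ t h open_box bounded_box hc closed_UNIV _ _ _ that])
      show "open ?QT" by (intro open_Times open_box open_greaterThanLessThan)
      show "h z \<le> c + k + pot_super p 0 z" if "z \<in> closure ?QT \<inter> UNIV - ?QT" "snd z < t2" for z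
        using bd'[of z] that uk[of z] by (simp add: k0)
    qed auto
    then show ?thesis by (simp add: k0)
  qed
  have step2: "h z \<le> c + pot_super p a z" if zz: "z \<in> ?QT" "norm (fst z) < \<delta>" for z
  proof (rule box_comparison[OF p a t h open_box bounded_box hc, of "{z. norm (fst z) \<le> \<delta>}" "?QT \<inter> {z. norm (fst z) < \<delta>}"])
    show "closed {z :: (real ^ 'n) \<times> real. norm (fst z) \<le> \<delta>}" by (intro closed_Collect_le continuous_intros)
    show "open (?QT \<inter> {z. norm (fst z) < \<delta>})"
      by (intro open_Int open_Times open_box open_greaterThanLessThan open_Collect_less continuous_intros)
    show "h z \<le> c + pot_super p a z"
      if z: "z \<in> closure ?QT \<inter> {z. norm (fst z) \<le> \<delta>} - ?QT \<inter> {z. norm (fst z) < \<delta>}" "snd z < t2" for z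
    proof (cases "norm (fst z) = \<delta>")
      case True
      have "z \<in> \<Theta>" using z C\<Theta> by blast
      then have "k < pot_super p a z" using True by (rule sph)
      moreover have "h z \<le> c + k"
        using step1[of z] bd'[of z] uk[of z] z by (cases "z \<in> ?QT") auto
      ultimately show ?thesis by linarith
    next
      case False
      then have "norm (fst z) < \<delta>" "z \<notin> ?QT" using z by auto
      then have "h z \<le> c + min (pot_super p a z) k" using bd'[of z] z by (auto simp: trunc_super_def)
      then show ?thesis by linarith
    qed
  qed (use zz in auto)
  show "ereal (h z) \<le> ereal (c + ?u z)"
    using step1[OF z] step2[OF z] by (auto simp: trunc_super_def)
qed auto

text \<open>Strict touching from below at every point by an exact solution excludes interior minima of
  \<open>v - \<psi>\<close>; this replaces the existence theory behind the general parabolic comparison principle.\<close>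

lemma touching_no_interior_min:
  fixes \<Theta> :: "((real ^ 'n) \<times> real) set"
  assumes v: "p_superparabolic p \<Theta> v" and D: "open D" "D \<subseteq> \<Theta>" and z0: "(x0, t0) \<in> D"
    and H: "\<And>W c. p_parabolic p W (\<lambda>z. H z + c)" "continuous_on UNIV H"
    and dec: "\<And>x t. \<psi> (x, t) - H (x, t) = \<gamma> x - \<sigma> * (t - t0)"
    and \<gamma>: "continuous_on UNIV \<gamma>" "\<gamma> x0 = 0" "\<And>x. x \<noteq> x0 \<Longrightarrow> 0 < \<gamma> x" and \<sigma>: "\<sigma> > 0"
    and min: "\<And>z. z \<in> D \<Longrightarrow> ereal (\<psi> z + m) \<le> v z"
  shows "ereal (\<psi> (x0, t0) + m) < v (x0, t0)"
proof -
  obtain V I where VI: "open V" "open I" "(x0, t0) \<in> V \<times> I" "V \<times> I \<subseteq> D"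
    using open_prod_elim[OF D(1) z0] by metis
  obtain r1 where r1: "r1 > 0" "cball x0 r1 \<subseteq> V" using VI open_contains_cball by (metis mem_Sigma_iff)
  obtain r2 where r2: "r2 > 0" "cball t0 r2 \<subseteq> I" using VI open_contains_cball by (metis mem_Sigma_iff)
  \<comment> \<open>The half side is chosen so that the closed cube lies in the ball of radius
    \<open>r1\<close>, by comparison with the sum norm.\<close>
  define s where "s = r1 / real CARD('n)"
  have s: "s > 0" using r1 by (simp add: s_def)
  define q where "q = (\<chi> i. x0 $ i - s)"
  define b where "b = (\<chi> i. x0 $ i + s)"
  have qb: "\<forall>i. q $ i < b $ i" using s by (simp add: q_def b_def)
  have x0Q: "x0 \<in> box q b" using s by (simp add: mem_box_cart q_def b_def)
  have clQ: "closure (box q b) = cbox q b" using x0Q by (intro closure_box) auto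
  have QV: "cbox q b \<subseteq> V"
  proof
    fix x assume "x \<in> cbox q b"
    then have "\<bar>(x - x0) $ i\<bar> \<le> s" for i by (auto simp: mem_box_cart q_def b_def abs_le_iff algebra_simps)
    then have "(\<Sum>i\<in>UNIV. \<bar>(x - x0) $ i\<bar>) \<le> (\<Sum>i\<in>(UNIV::'n set). s)" by (intro sum_mono)
    also have "\<dots> = r1" by (simp add: s_def)
    finally have "norm (x - x0) \<le> r1" using norm_le_l1_cart[of "x - x0"] by linarith
    then show "x \<in> V" using r1(2) by (auto simp: dist_norm norm_minus_commute)
  qed
  have fr: "frontier (box q b) = cbox q b - box q b" by (simp only: frontier_def interior_open[OF open_box] clQ)
  have cfr: "compact (frontier (box q b))" by (simp add: compact_frontier_bounded)
  obtain \<mu> where \<mu>: "\<mu> > 0" "\<And>x. x \<in> frontier (box q b) \<Longrightarrow> \<mu> \<le> \<gamma> x"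
  proof (cases "frontier (box q b) = {}")
    case True
    then show ?thesis using that[of 1] by simp
  next
    case False
    obtain x1 where x1: "x1 \<in> frontier (box q b)" "\<And>x. x \<in> frontier (box q b) \<Longrightarrow> \<gamma> x1 \<le> \<gamma> x"
      using continuous_attains_inf[OF cfr False continuous_on_subset[OF \<gamma>(1) subset_UNIV]] by metis
    have "x1 \<noteq> x0" using x1(1) x0Q fr by auto
    then show ?thesis using that[of "\<gamma> x1"] \<gamma>(3) x1(2) by blast
  qed
  \<comment> \<open>A time span so short that \<sigma> (t - t0) consumes at most half of the lateral
    margin \<mu>.\<close>
  define \<rho> where "\<rho> = min r2 (\<mu> / (2 * \<sigma>))"
  have \<rho>: "\<rho> > 0" "\<rho> \<le> r2" "\<sigma> * \<rho> \<le> \<mu> / 2"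
  proof -
    show "\<rho> > 0" "\<rho> \<le> r2" using r2 \<mu> \<sigma> by (auto simp: \<rho>_def)
    have "\<sigma> * \<rho> \<le> \<sigma> * (\<mu> / (2 * \<sigma>))" by (rule mult_left_mono) (use \<sigma> in \<open>auto simp: \<rho>_def\<close>)
    then show "\<sigma> * \<rho> \<le> \<mu> / 2" using \<sigma> by simp
  qed
  define t1 where "t1 = t0 - \<rho>"
  define t2 where "t2 = t0 + \<rho>"
  have t: "t1 < t2" "t1 < t0" "t0 < t2" using \<rho> by (auto simp: t1_def t2_def)
  \<comment> \<open>The least gap between \<open>\<psi>\<close> and \<open>H\<close> guaranteed on
    the parabolic boundary: \<sigma> \<rho> at the bottom, \<mu>/2 on the sides. Lifting
    \<open>H\<close> by this amount keeps it below v - m there, and the comparison carries the lift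
    to the centre.\<close>
  define \<kappa> where "\<kappa> = min (\<sigma> * \<rho>) (\<mu> / 2)"
  have \<kappa>: "\<kappa> > 0" using \<sigma> \<rho> \<mu> by (simp add: \<kappa>_def)
  have sub: "cbox q b \<times> {t1..t2} \<subseteq> D"
  proof -
    have "{t1..t2} \<subseteq> cball t0 r2" using \<rho> by (auto simp: t1_def t2_def dist_real_def)
    then show ?thesis using QV r2(2) VI(4) by blast
  qed
  have clQT: "closure (box q b \<times> {t1<..<t2}) = cbox q b \<times> {t1..t2}" using t clQ by (simp add: closure_Times)
  have comp: "box q b \<times> {t1<..<t2} \<Subset> \<Theta>"
    unfolding compactly_contained_def clQT using sub D(2) by (auto intro!: compact_Times)
  let ?h = "\<lambda>z. H z + (m + \<kappa>)"
  have "\<forall>z\<in>box q b \<times> {t1<..<t2}. ereal (?h z) \<le> v z"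
  proof -
    note sp = v[unfolded p_superparabolic_def Let_def, THEN conjunct2, THEN conjunct2, THEN conjunct2, rule_format]
    have bdry: "ereal (?h z) \<le> v z" if z: "z \<in> closure (box q b) \<times> {t1} \<union> frontier (box q b) \<times> {t1<..t2}" for z
    proof -
      obtain x t where xt: "z = (x, t)" by (cases z)
      have "z \<in> cbox q b \<times> {t1..t2}" using z t by (auto simp: clQ fr)
      then have zD: "z \<in> D" using sub by blast
      have "\<kappa> \<le> \<gamma> x - \<sigma> * (t - t0)"
      proof (cases "t = t1")
        case True
        have "0 \<le> \<gamma> x" using \<gamma>(2) \<gamma>(3)[of x] by (cases "x = x0") auto
        then show ?thesis using True by (simp add: \<kappa>_def t1_def)
      next
        case False
        then have "x \<in> frontier (box q b)" "t \<le> t2" using z xt by auto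
        then have "\<mu> \<le> \<gamma> x" "\<sigma> * (t - t0) \<le> \<sigma> * \<rho>" using \<mu>(2) \<sigma> by (auto simp: t2_def)
        then show ?thesis using \<rho>(3) unfolding \<kappa>_def by linarith
      qed
      then have "?h z \<le> \<psi> z + m" using dec[of x t] by (simp add: xt)
      then show ?thesis using min[OF zD] by (meson ereal_less_eq(3) order_trans)
    qed
    show ?thesis
    proof (intro ballI, rule sp[OF _ t(1) comp H(1)])
      show "continuous_on (closure (box q b \<times> {t1<..<t2})) ?h"
        by (intro continuous_on_add continuous_on_const continuous_on_subset[OF H(2)]) auto
    qed (use qb bdry in auto)
  qed
  moreover have "(x0, t0) \<in> box q b \<times> {t1<..<t2}" using x0Q t by simp
  ultimately have le: "ereal (H (x0, t0) + (m + \<kappa>)) \<le> v (x0, t0)" by blast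
  have "\<psi> (x0, t0) = H (x0, t0)" using dec[of x0 t0] \<gamma>(2) by simp
  then have lt: "ereal (\<psi> (x0, t0) + m) < ereal (H (x0, t0) + (m + \<kappa>))" using \<kappa> by simp
  from lt le show ?thesis by (rule less_le_trans)
qed

section \<open>Strict convexity of powers of the norm\<close>

lemma powr_tangent_strict:
  fixes A m q :: real
  assumes q: "q > 1" and m: "m > 0" and A: "A \<ge> 0" "A \<noteq> m"
  shows "m powr q + q * m powr (q - 1) * (A - m) < A powr q"
proof -
  have mq: "m powr (q - 1) * m = m powr q" using m powr_add[of m "q - 1" 1] by simp
  have D: "((\<lambda>x. x powr q) has_real_derivative q * x powr (q - 1)) (at x)" if "x > 0" for x
    using that by (auto intro!: derivative_eq_intros)
  consider "A = 0" | "0 < A" "A < m" | "m < A" using A by linarith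
  then show ?thesis
  proof cases
    case 1
    have "m powr q + q * m powr (q - 1) * (A - m) = m powr q - q * (m powr (q - 1) * m)" using 1 by simp
    also have "\<dots> = (1 - q) * m powr q" unfolding mq by (simp add: algebra_simps)
    also have "\<dots> < 0" using q m by (intro mult_neg_pos) auto
    finally show ?thesis using 1 by simp
  next
    case 2
    obtain z where z: "A < z" "z < m" "m powr q - A powr q = (m - A) * (q * z powr (q - 1))"
      using MVT2[OF 2(2), of "\<lambda>x. x powr q" "\<lambda>x. q * x powr (q - 1)"] D 2(1) by force
    have "z powr (q - 1) < m powr (q - 1)" using z 2 q by (intro powr_less_mono2) auto
    then have "(m - A) * (q * z powr (q - 1)) < (m - A) * (q * m powr (q - 1))"
      using 2 q by (intro mult_strict_left_mono) auto
    then show ?thesis using z(3) by (simp add: algebra_simps)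
  next
    case 3
    obtain z where z: "m < z" "z < A" "A powr q - m powr q = (A - m) * (q * z powr (q - 1))"
      using MVT2[OF 3, of "\<lambda>x. x powr q" "\<lambda>x. q * x powr (q - 1)"] D m by force
    have "m powr (q - 1) < z powr (q - 1)" using z m q by (intro powr_less_mono2) auto
    then have "(A - m) * (q * m powr (q - 1)) < (A - m) * (q * z powr (q - 1))"
      using 3 q by (intro mult_strict_left_mono) auto
    then show ?thesis using z(3) by (simp add: algebra_simps)
  qed
qed

lemma powr_strict_convex:
  fixes A B q s :: real
  assumes q: "q > 1" and s: "0 < s" "s < 1" and AB: "A \<ge> 0" "B \<ge> 0" "A \<noteq> B"
  shows "(s * A + (1 - s) * B) powr q < s * A powr q + (1 - s) * B powr q"
proof -
  define m where "m = s * A + (1 - s) * B"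
  have Am: "A - m = (1 - s) * (A - B)" and Bm: "B - m = s * (B - A)" by (auto simp: m_def algebra_simps)
  have ne: "A \<noteq> m" "B \<noteq> m" using Am Bm s AB(3) by auto
  have m: "m > 0"
  proof -
    have "A > 0 \<or> B > 0" using AB by auto
    then show ?thesis unfolding m_def using s AB by (auto intro: add_pos_nonneg add_nonneg_pos)
  qed
  have "s * (m powr q + q * m powr (q - 1) * (A - m)) < s * A powr q"
    using powr_tangent_strict[OF q m AB(1) ne(1)] s by (intro mult_strict_left_mono) auto
  moreover have "(1 - s) * (m powr q + q * m powr (q - 1) * (B - m)) < (1 - s) * B powr q"
    using powr_tangent_strict[OF q m AB(2) ne(2)] s by (intro mult_strict_left_mono) auto
  moreover have "s * (m powr q + q * m powr (q - 1) * (A - m)) + (1 - s) * (m powr q + q * m powr (q - 1) * (B - m)) = m powr q"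
    unfolding Am Bm by (simp add: algebra_simps)
  ultimately show ?thesis unfolding m_def[symmetric] by linarith
qed

text \<open>If the norms differ, strictness comes from the scalar power; if they agree, it comes
  from the strict convexity of the Euclidean ball.\<close>

lemma norm_powr_strict_convex:
  fixes u w :: "'a::real_inner"
  assumes q: "q > 1" and s: "0 < s" "s < 1" and uw: "u \<noteq> w"
  shows "norm (s *\<^sub>R u + (1 - s) *\<^sub>R w) powr q < s * norm u powr q + (1 - s) * norm w powr q"
proof (cases "norm u = norm w")
  case False
  have "norm (s *\<^sub>R u + (1 - s) *\<^sub>R w) \<le> s * norm u + (1 - s) * norm w"
    using norm_triangle_ineq[of "s *\<^sub>R u" "(1 - s) *\<^sub>R w"] s by simp
  then have "norm (s *\<^sub>R u + (1 - s) *\<^sub>R w) powr q \<le> (s * norm u + (1 - s) * norm w) powr q"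
    using q by (intro powr_mono2) auto
  also have "\<dots> < s * norm u powr q + (1 - s) * norm w powr q"
    by (rule powr_strict_convex[OF q s]) (use False in auto)
  finally show ?thesis .
next
  case True
  have "(norm (s *\<^sub>R u + (1 - s) *\<^sub>R w))\<^sup>2 = s * (norm u)\<^sup>2 + (1 - s) * (norm w)\<^sup>2 - s * (1 - s) * (norm (u - w))\<^sup>2"
    by (simp add: power2_norm_eq_inner inner_add_left inner_add_right inner_diff_left inner_diff_right
        inner_commute[of w u] algebra_simps)
  also have "\<dots> = (norm w)\<^sup>2 - s * (1 - s) * (norm (u - w))\<^sup>2" unfolding True by (simp add: algebra_simps)
  also have "\<dots> < (norm w)\<^sup>2" using s uw by simp
  finally have "norm (s *\<^sub>R u + (1 - s) *\<^sub>R w) < norm w" by (rule power2_less_imp_less) simp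
  then have "norm (s *\<^sub>R u + (1 - s) *\<^sub>R w) powr q < norm w powr q" using q by (intro powr_less_mono2) auto
  also have "\<dots> = s * norm u powr q + (1 - s) * norm w powr q" unfolding True by (simp add: algebra_simps)
  finally show ?thesis .
qed

lemma pot_flux_nonneg: "0 \<le> pot_flux p a"
  by (simp add: pot_flux_def)

text \<open>Let q = p/(p-1). For 0 < s < 1 put a2 = a s^(-1/(p-1)) and y = (1 - s) x0. Since q -
  1/(p-1) = 1, with x = s u + (1 - s) x0 one has a2 |x - y|^q = a s |u|^q. Strict convexity then
  says that a2 |x - y|^q - a |x|^q exceeds its value at x0, the point where u = x0. The steeper
  slope multiplies the time rate n \<alpha> by 1/s, and the slack \<kappa> admits such a factor for
  s close to 1.\<close>

lemma touching_potential:
  fixes x0 :: "real ^ 'n" and c :: real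
  assumes p: "p > 1" and a: "a \<ge> 0" and \<kappa>: "\<kappa> > 0"
  defines "\<psi> \<equiv> \<lambda>z :: (real ^ 'n) \<times> real. c - pot_super p a z - \<kappa> * snd z"
  obtains H :: "(real ^ 'n) \<times> real \<Rightarrow> real" and \<gamma> and \<sigma>
  where "\<And>W c. p_parabolic p W (\<lambda>z. H z + c)" "continuous_on UNIV H"
    "\<And>x t. \<psi> (x, t) - H (x, t) = \<gamma> x - \<sigma> * (t - t0)"
    "continuous_on UNIV \<gamma>" "\<gamma> x0 = 0" "\<And>x. x \<noteq> x0 \<Longrightarrow> 0 < \<gamma> x" "\<sigma> > 0"
proof -
  define q where "q = p / (p - 1)"
  define n\<alpha> where "n\<alpha> = real CARD('n) * pot_flux p a"
  have q: "q > 1" using p by (simp add: q_def)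
  have n\<alpha>: "n\<alpha> \<ge> 0" by (simp add: n\<alpha>_def pot_flux_nonneg)
  note witness = that
  \<comment> \<open>It remains to choose slope and centre so that the exact solution decreases more
    slowly in time than \<open>\<psi>\<close> while a2 |x - y|^q - a |x|^q has its strict minimum at
    x0.\<close>
  have main: thesis if a2: "a2 \<ge> 0" and \<sigma>: "real CARD('n) * pot_flux p a2 < n\<alpha> + \<kappa>"
    and pos: "\<And>x. x \<noteq> x0 \<Longrightarrow> a * norm x powr q - a * norm x0 powr q < a2 * norm (x - y) powr q - a2 * norm (x0 - y) powr q"
    for a2 y
  proof -
    define K where "K = a2 * norm (x0 - y) powr q - a * norm x0 powr q"
    define \<sigma> where "\<sigma> = n\<alpha> + \<kappa> - real CARD('n) * pot_flux p a2"
    define \<gamma> where "\<gamma> x = a2 * norm (x - y) powr q - a * norm x powr q - K" for x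
    show thesis
    proof (rule witness[of "pot_sol p a2 y (c + K - \<sigma> * t0)" \<gamma> \<sigma>])
      show "p_parabolic p W (\<lambda>z. pot_sol p a2 y (c + K - \<sigma> * t0) z + c')" for W c'
      proof -
        have "(\<lambda>z. pot_sol p a2 y (c + K - \<sigma> * t0) z + c') = pot_sol p a2 y (c + K - \<sigma> * t0 + c')"
          by (rule ext) (simp add: pot_sol_def)
        then show ?thesis using p_parabolic_pot_sol[OF p a2] by simp
      qed
      show "continuous_on UNIV (pot_sol p a2 y (c + K - \<sigma> * t0))" by (rule continuous_pot_sol[OF p])
      show "\<psi> (x, t) - pot_sol p a2 y (c + K - \<sigma> * t0) (x, t) = \<gamma> x - \<sigma> * (t - t0)" for x t
        by (simp add: \<psi>_def pot_super_def pot_sol_def \<gamma>_def \<sigma>_def q_def n\<alpha>_def algebra_simps)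
      show "continuous_on UNIV \<gamma>"
        unfolding \<gamma>_def[abs_def] q_def
        by (intro continuous_on_diff continuous_on_const continuous_potential[OF p]
            continuous_on_compose2[OF continuous_potential[OF p, of UNIV]] continuous_on_id) auto
      show "\<gamma> x0 = 0" by (simp add: \<gamma>_def K_def)
      show "0 < \<gamma> x" if "x \<noteq> x0" for x using pos[OF that] by (simp add: \<gamma>_def K_def)
      show "\<sigma> > 0" using \<open>real CARD('n) * pot_flux p a2 < n\<alpha> + \<kappa>\<close> by (simp add: \<sigma>_def)
    qed
  qed
  show thesis
  proof (cases "a = 0")
    case True
    define N where "N = real CARD('n)"
    have N: "N > 0" by (simp add: N_def)
    \<comment> \<open>Any small positive slope centred at x0 touches a constant; this one has time
      rate \<kappa>/2.\<close>
    define a2 where "a2 = (\<kappa> / (2 * N)) powr (1 / (p - 1)) / q"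
    have a2: "a2 > 0" unfolding a2_def using \<kappa> N q by (intro divide_pos_pos) auto
    have "pot_flux p a2 = \<kappa> / (2 * N)"
      using \<kappa> N q p by (simp add: pot_flux_def a2_def q_def[symmetric] powr_powr)
    then have "N * pot_flux p a2 = \<kappa> / 2" using N by simp
    then show ?thesis
      using \<kappa> n\<alpha> a2 True by (intro main[of a2 x0]) (auto simp: N_def)
  next
    case False
    then have a0: "a > 0" using a by simp
    \<comment> \<open>Chosen so that (n \<alpha> + \<kappa>) s lies strictly between n \<alpha> and
      n \<alpha> + \<kappa>, which gives both n \<alpha> / s < n \<alpha> + \<kappa> and s <
      1.\<close>
    define s where "s = (n\<alpha> + \<kappa> / 2) / (n\<alpha> + \<kappa>)"
    have s: "0 < s" "s < 1" using n\<alpha> \<kappa> by (auto simp: s_def)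
    define a2 where "a2 = a * s powr (- (1 / (p - 1)))"
    define y where "y = (1 - s) *\<^sub>R x0"
    have "pot_flux p a2 = (a * (p / (p - 1))) powr (p - 1) * (s powr (- (1 / (p - 1)))) powr (p - 1)"
      unfolding pot_flux_def a2_def using a0 p by (simp add: powr_mult[symmetric] mult_ac)
    also have "(s powr (- (1 / (p - 1)))) powr (p - 1) = 1 / s"
    proof -
      have e: "- (1 / (p - 1)) * (p - 1) = - 1" using p by simp
      show ?thesis unfolding powr_powr e using s by (simp add: powr_minus_divide)
    qed
    finally have "real CARD('n) * pot_flux p a2 = n\<alpha> / s" by (simp add: pot_flux_def n\<alpha>_def)
    moreover have "n\<alpha> / s < n\<alpha> + \<kappa>"
    proof -
      have "(n\<alpha> + \<kappa>) * s = n\<alpha> + \<kappa> / 2" using n\<alpha> \<kappa> by (simp add: s_def)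
      then show ?thesis using s \<kappa> by (simp add: divide_less_eq)
    qed
    moreover have scale: "a2 * norm (x - y) powr q = a * (s * norm ((1 / s) *\<^sub>R (x - y)) powr q)" for x
    proof -
      have "norm (x - y) powr q = (s * norm ((1 / s) *\<^sub>R (x - y))) powr q" using s by simp
      also have "\<dots> = s powr q * norm ((1 / s) *\<^sub>R (x - y)) powr q"
        by (rule powr_mult)
      finally have "a2 * norm (x - y) powr q = a * (s powr (- (1 / (p - 1))) * s powr q) * norm ((1 / s) *\<^sub>R (x - y)) powr q"
        by (simp only: a2_def mult.assoc)
      also have "s powr (- (1 / (p - 1))) * s powr q = s"
      proof -
        have "- (1 / (p - 1)) + q = (p - 1) / (p - 1)" unfolding diff_divide_distrib[of p 1] q_def by linarith
        also have "\<dots> = 1" using p by simp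
        finally have "- (1 / (p - 1)) + q = 1" .
        then show ?thesis using s by (simp add: powr_add[symmetric])
      qed
      finally show ?thesis by simp
    qed
    moreover have "a * norm x powr q - a * norm x0 powr q < a2 * norm (x - y) powr q - a2 * norm (x0 - y) powr q"
      if x: "x \<noteq> x0" for x
    proof -
      define u where "u = (1 / s) *\<^sub>R (x - y)"
      have xu: "x = s *\<^sub>R u + (1 - s) *\<^sub>R x0" using s by (simp add: u_def y_def)
      have "u \<noteq> x0"
      proof
        assume "u = x0"
        then have "x = s *\<^sub>R x0 + (1 - s) *\<^sub>R x0" using xu by simp
        then show False using x by (simp add: scaleR_add_left[symmetric])
      qed
      from norm_powr_strict_convex[OF q s this] xu
      have "norm x powr q < s * norm u powr q + (1 - s) * norm x0 powr q" by simp
      then have "a * norm x powr q < a * (s * norm u powr q + (1 - s) * norm x0 powr q)"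
        using a0 by (rule mult_strict_left_mono)
      moreover have "(1 / s) *\<^sub>R (x0 - y) = x0" using s by (simp add: y_def algebra_simps)
      ultimately show ?thesis
        unfolding scale u_def[symmetric] by (simp add: algebra_simps)
    qed
    ultimately show ?thesis using a0 s by (intro main[of a2 y]) (auto simp: a2_def)
  qed
qed

text \<open>A minimum principle: if v - \<psi> had negative infimum over \<open>D\<close>, a
  minimising sequence would accumulate at some point of the closure. Boundary points are excluded by
  \<open>bdry\<close>. At an interior point lower semicontinuity makes the infimum finite and
  attained, which \<open>touch\<close> forbids.\<close>

lemma superparabolic_ge:
  fixes \<Theta> :: "((real ^ 'n) \<times> real) set"
  assumes v: "p_superparabolic p \<Theta> v" and D: "open D" "D \<subseteq> \<Theta>" "bounded D" and \<psi>: "continuous_on UNIV \<psi>"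
    and bdry: "\<And>\<xi>. \<xi> \<in> closure D - D \<Longrightarrow> ereal (\<psi> \<xi>) \<le> Liminf (at \<xi> within D) v"
    and touch: "\<And>x0 t0 m. (x0, t0) \<in> D \<Longrightarrow> (\<And>z. z \<in> D \<Longrightarrow> ereal (\<psi> z + m) \<le> v z) \<Longrightarrow> ereal (\<psi> (x0, t0) + m) < v (x0, t0)"
    and z: "z \<in> D"
  shows "ereal (\<psi> z) \<le> v z"
proof (rule ccontr)
  assume "\<not> ereal (\<psi> z) \<le> v z"
  then have neg: "v z < ereal (\<psi> z)" by simp
  define w where "w z = v z - ereal (\<psi> z)" for z
  define \<mu> where "\<mu> = Inf (w ` D)"
  have vm: "v z \<noteq> - \<infinity>" if "z \<in> D" for z using v D that by (auto simp: p_superparabolic_def)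
  have "w z < 0" using neg by (cases "v z") (auto simp: w_def)
  then have \<mu>0: "\<mu> < 0" using z unfolding \<mu>_def by (meson INF_lower le_less_trans)
  obtain u where u: "\<And>n. u n \<in> w ` D" "u \<longlonglongrightarrow> \<mu>"
    using Inf_as_limit[of "w ` D"] z unfolding \<mu>_def by blast
  then have "\<forall>n. \<exists>y\<in>D. u n = w y" by blast
  then obtain zs where zs: "\<And>n. zs n \<in> D" "\<And>n. u n = w (zs n)" by metis
  have "compact (closure D)" using D(3) by simp
  moreover have "\<forall>n. zs n \<in> closure D" using zs(1) closure_subset by blast
  ultimately obtain \<xi> r where \<xi>: "\<xi> \<in> closure D" and r: "strict_mono r" "(zs \<circ> r) \<longlonglongrightarrow> \<xi>"
    unfolding compact_def by blast
  \<comment> \<open>A lower bound for the limit inferior of v along the sequence, by lower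
    semicontinuity inside \<open>D\<close> and by \<open>bdry\<close> on its boundary. It may be
    infinite, so the estimates use real numbers below it.\<close>
  define L where "L = (if \<xi> \<in> D then v \<xi> else ereal (\<psi> \<xi>))"
  have ev: "\<forall>\<^sub>F n in sequentially. ereal y < v (zs (r n))" if y: "ereal y < L" for y
  proof -
    have "\<forall>\<^sub>F x in at \<xi> within D. ereal y < v x"
    proof (cases "\<xi> \<in> D")
      case True
      have "v \<xi> \<le> Liminf (at \<xi> within \<Theta>) v"
        using v True D(2) by (auto simp: p_superparabolic_def lower_semicontinuous_on_def)
      then have "\<forall>\<^sub>F x in at \<xi> within \<Theta>. ereal y < v x" using y True by (auto simp: L_def le_Liminf_iff)
      then show ?thesis by (rule filter_leD[OF at_le[OF D(2)]])
    next
      case False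
      then have "ereal (\<psi> \<xi>) \<le> Liminf (at \<xi> within D) v" using bdry \<xi> by blast
      then show ?thesis using y False by (simp add: L_def le_Liminf_iff)
    qed
    then obtain S where S: "open S" "\<xi> \<in> S" "\<And>x. x \<in> S \<Longrightarrow> x \<noteq> \<xi> \<Longrightarrow> x \<in> D \<Longrightarrow> ereal y < v x"
      unfolding eventually_at_topological by blast
    have "\<forall>\<^sub>F n in sequentially. (zs \<circ> r) n \<in> S" by (rule topological_tendstoD[OF r(2) S(1,2)])
    then show ?thesis
    proof eventually_elim
      case (elim n)
      show ?case
      proof (cases "zs (r n) = \<xi>")
        case True
        then show ?thesis using y zs(1)[of "r n"] by (simp add: L_def)
      next
        case False
        then show ?thesis using S(3) elim zs(1) by simp
      qed
    qed
  qed
  have key: "ereal (y - \<psi> \<xi>) \<le> \<mu>" if y: "ereal y < L" for y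
  proof (rule tendsto_le[OF sequentially_bot])
    show "(\<lambda>n. u (r n)) \<longlonglongrightarrow> \<mu>" using LIMSEQ_subseq_LIMSEQ[OF u(2) r(1)] by (simp add: comp_def)
    have "(\<lambda>n. \<psi> (zs (r n))) \<longlonglongrightarrow> \<psi> \<xi>"
      using continuous_on_tendsto_compose[OF \<psi> r(2)] by (simp add: comp_def)
    then show "(\<lambda>n. ereal (y - \<psi> (zs (r n)))) \<longlonglongrightarrow> ereal (y - \<psi> \<xi>)"
      by (intro tendsto_ereal tendsto_diff tendsto_const)
    show "\<forall>\<^sub>F n in sequentially. ereal (y - \<psi> (zs (r n))) \<le> u (r n)"
      using ev[OF y]
    proof eventually_elim
      case (elim n)
      then show ?case unfolding zs(2) w_def by (cases "v (zs (r n))") auto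
    qed
  qed
  have Lm: "L \<le> \<mu> + ereal (\<psi> \<xi>)"
  proof (rule ccontr)
    assume "\<not> L \<le> \<mu> + ereal (\<psi> \<xi>)"
    then have "\<mu> + ereal (\<psi> \<xi>) < L" by simp
    from ereal_dense2[OF this] obtain y where y: "\<mu> + ereal (\<psi> \<xi>) < ereal y" "ereal y < L" by blast
    from key[OF y(2)] y(1) show False by (cases \<mu>) auto
  qed
  show False
  proof (cases "\<xi> \<in> D")
    case False
    then show ?thesis using Lm \<mu>0 by (cases \<mu>) (auto simp: L_def)
  next
    case True
    then have "v \<xi> \<le> \<mu> + ereal (\<psi> \<xi>)" "v \<xi> \<noteq> - \<infinity>" using Lm vm by (auto simp: L_def)
    then obtain m where m: "\<mu> = ereal m" using \<mu>0 by (cases \<mu>) auto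
    have "ereal (\<psi> z + m) \<le> v z" if "z \<in> D" for z
    proof -
      have "\<mu> \<le> w z" unfolding \<mu>_def using that by (rule INF_lower)
      then show ?thesis unfolding m w_def by (cases "v z") auto
    qed
    then have "ereal (\<psi> (fst \<xi>, snd \<xi>) + m) < v (fst \<xi>, snd \<xi>)"
      by (intro touch) (use True in auto)
    then have "ereal (\<psi> \<xi> + m) < v \<xi>" by simp
    moreover have "v \<xi> \<le> ereal (\<psi> \<xi> + m)" using \<open>v \<xi> \<le> \<mu> + ereal (\<psi> \<xi>)\<close> by (simp add: m add.commute)
    ultimately show False by simp
  qed
qed

text \<open>\<open>touching_potential\<close> needs the slack -\<kappa> t. Lowering the comparison
  function by \<kappa> T makes the perturbation -\<kappa> (T + t), which is nonpositive on the
  closure of \<open>D\<close> and so respects the boundary inequality; then \<kappa> tends to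
  0.\<close>

lemma superparabolic_ge_potential:
  fixes \<Theta> :: "((real ^ 'n) \<times> real) set"
  assumes p: "p > 1" and a: "a \<ge> 0" and v: "p_superparabolic p \<Theta> v" and D: "open D" "D \<subseteq> \<Theta>" "bounded D"
    and T: "\<And>z. z \<in> D \<Longrightarrow> - T \<le> snd z"
    and bdry: "\<And>\<xi>. \<xi> \<in> closure D - D \<Longrightarrow> ereal (c - pot_super p a \<xi>) \<le> Liminf (at \<xi> within D) v"
    and z: "z \<in> D"
  shows "ereal (c - pot_super p a z) \<le> v z"
proof (rule ereal_le_epsilon2)
  fix e :: real assume e: "0 < e"
  have Tz: "T + snd z \<ge> 0" using T[OF z] by simp
  \<comment> \<open>The perturbation at the given point then costs at most e; the \<open>+ 1\<close>
    keeps the denominator positive.\<close>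
  define \<kappa> where "\<kappa> = e / (T + snd z + 1)"
  have \<kappa>: "\<kappa> > 0" using e Tz by (simp add: \<kappa>_def)
  define \<psi> where "\<psi> = (\<lambda>z :: (real ^ 'n) \<times> real. (c - \<kappa> * T) - pot_super p a z - \<kappa> * snd z)"
  have "closed {z :: (real ^ 'n) \<times> real. - T \<le> snd z}" by (intro closed_Collect_le continuous_intros)
  then have clT: "closure D \<subseteq> {z. - T \<le> snd z}" using T by (intro closure_minimal) auto
  have "ereal (\<psi> z) \<le> v z"
  proof (rule superparabolic_ge[OF v D _ _ _ z])
    show "continuous_on UNIV \<psi>"
      unfolding \<psi>_def by (intro continuous_on_diff continuous_on_mult continuous_on_const continuous_pot_super[OF p] continuous_on_snd continuous_on_id)
    show "ereal (\<psi> \<xi>) \<le> Liminf (at \<xi> within D) v" if \<xi>: "\<xi> \<in> closure D - D" for \<xi>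
    proof -
      have "0 \<le> \<kappa> * (T + snd \<xi>)" using \<xi> clT \<kappa> by (intro mult_nonneg_nonneg) auto
      then have "\<psi> \<xi> \<le> c - pot_super p a \<xi>" by (simp add: \<psi>_def algebra_simps)
      then show ?thesis using bdry[OF \<xi>] by (meson ereal_less_eq(3) order_trans)
    qed
    fix x0 t0 m assume z0: "(x0, t0) \<in> D" and min: "\<And>z. z \<in> D \<Longrightarrow> ereal (\<psi> z + m) \<le> v z"
    obtain H :: "(real ^ 'n) \<times> real \<Rightarrow> real" and \<gamma> \<sigma> where
      "\<And>W c. p_parabolic p W (\<lambda>z. H z + c)" "continuous_on UNIV H"
      "\<And>x t. \<psi> (x, t) - H (x, t) = \<gamma> x - \<sigma> * (t - t0)"
      "continuous_on UNIV \<gamma>" "\<gamma> x0 = 0" "\<And>x. x \<noteq> x0 \<Longrightarrow> 0 < \<gamma> x" "\<sigma> > 0"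
      unfolding \<psi>_def by (rule touching_potential[OF p a \<kappa>]) blast
    from touching_no_interior_min[OF v D(1,2) z0 this min]
    show "ereal (\<psi> (x0, t0) + m) < v (x0, t0)" .
  qed
  moreover have "c - pot_super p a z \<le> \<psi> z + e"
  proof -
    have "\<kappa> * (T + snd z) \<le> \<kappa> * (T + snd z + 1)" using \<kappa> by simp
    also have "\<dots> = e" using Tz by (simp add: \<kappa>_def)
    finally show ?thesis by (simp add: \<psi>_def algebra_simps)
  qed
  ultimately show "ereal (c - pot_super p a z) \<le> v z + ereal e" by (cases "v z") auto
qed

subsection \<open>The domain \<open>\<Theta>\<^bsub>l,\<theta>\<^esub>\<close>\<close>

lemma Theta_dom_iff:
  "z \<in> Theta_dom l \<theta> \<longleftrightarrow> 0 < - snd z \<and> - snd z < \<theta> * norm (fst z) powr l \<and> \<theta> * norm (fst z) powr l < \<theta>"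
  by (cases z) (simp add: Theta_dom_def)

lemma continuous_norm_fst_powr:
  assumes "l > 0"
  shows "continuous_on S (\<lambda>z :: (real ^ 'n) \<times> real. norm (fst z) powr l)"
  by (intro continuous_on_powr' continuous_intros) (use assms in auto)

lemma continuous_UNIV_tendsto:
  assumes "continuous_on UNIV g"
  shows "(g \<longlongrightarrow> g x) (at x within S)"
  by (rule tendsto_within_subset[OF _ subset_UNIV]) (use assms in \<open>simp add: continuous_on_def\<close>)

locale cusp =
  fixes p l \<theta> \<delta> :: real and \<Theta> :: "((real ^ 'n) \<times> real) set"
  assumes p: "p > 2" and l: "l \<ge> p / (p - 1)" and \<theta>: "\<theta> > 0" and \<Theta>: "\<Theta> = Theta_dom l \<theta>"
    and \<delta>: "0 < \<delta>" "\<delta> \<le> 1"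
begin

definition q :: real where "q = p / (p - 1)"

text \<open>The value of a q at the optimal slope: the derivative of a - n (a q)^(p-1) \<theta>
  \<delta>^(l-q) vanishes, in view of (p-1) q = p, when n p (a q)^(p-2) \<theta> \<delta>^(l-q) =
  1.\<close>

definition E :: real where
  "E = (\<delta> powr (q - l) / (real CARD('n) * p * \<theta>)) powr (1 / (p - 2))"

text \<open>The slope \<open>a\<close> maximises \<open>a - n (a q)\<^bsup>p-1\<^esup> \<theta> \<delta>\<^bsup>l-q\<^esup>\<close>, and \<open>c\<close> is the maximum.\<close>

definition a :: real where "a = (p - 1) / p * E"

definition c :: real where "c = (p - 2) / p * E"

definition u :: "(real ^ 'n) \<times> real \<Rightarrow> real" where
  "u = trunc_super p a \<delta> (c * \<delta> powr q)"

text \<open>The deviation from f(0,0) that the smallness condition allows. It is continuous on the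
  whole space and lies below \<open>u\<close> in the domain, so it carries boundary data to limits
  from inside.\<close>

definition M :: "(real ^ 'n) \<times> real \<Rightarrow> real" where
  "M z = c * min (norm (fst z)) \<delta> powr q"

lemma q: "1 < q" using p by (simp add: q_def)

lemma l0: "l > 0" using l q by (simp add: q_def)

lemma E: "E > 0"
  unfolding E_def using p \<theta> \<delta> by simp

lemma a: "a > 0" and c: "c > 0"
  using p E by (auto simp: a_def c_def)

text \<open>On |x| at most \<delta> the ratio of |x|^l to |x|^q is at most \<delta>^(l-q). At the
  optimal slope the time term therefore costs at most E/p of the coefficient a, and a - E/p =
  c.\<close>

lemma flux_a: "real CARD('n) * pot_flux p a * \<theta> * \<delta> powr (l - q) = E / p"
proof -
  define N where "N = real CARD('n)"
  have N: "N > 0" by (simp add: N_def)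
  define F where "F = \<delta> powr (q - l) / (N * p * \<theta>)"
  have F: "F > 0" unfolding F_def using N p \<theta> \<delta> by simp
  have EF: "E = F powr (1 / (p - 2))" by (simp add: E_def F_def N_def)
  have "a * (p / (p - 1)) = E" using p by (simp add: a_def)
  then have "pot_flux p a = E powr (p - 1)" by (simp add: pot_flux_def)
  also have "\<dots> = E powr (p - 2) * E" using powr_add[of E "p - 2" 1] E by simp
  also have "E powr (p - 2) = F" using F p by (simp add: EF powr_powr)
  finally have "N * pot_flux p a * \<theta> * \<delta> powr (l - q) = N * \<theta> * E * (F * \<delta> powr (l - q))" by simp
  also have "F * \<delta> powr (l - q) = 1 / (N * p * \<theta>)"
    using \<delta> by (simp add: F_def powr_add[symmetric])
  finally show ?thesis using N \<theta> by (simp add: N_def)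
qed

text \<open>With r = |x|, l at least q and r at most \<delta> give r^l at most \<delta>^(l-q) r^q,
  so by \<open>flux_a\<close> the time term is at least -(E/p) r^q, and a - E/p = c. The strict form
  provides the gap on |x| = \<delta> that the truncation requires.\<close>

lemma pot_super_ge:
  fixes z :: "(real ^ 'n) \<times> real"
  assumes "- snd z \<le> \<theta> * norm (fst z) powr l" "norm (fst z) \<le> \<delta>"
  shows "c * norm (fst z) powr q \<le> pot_super p a z"
    and "- snd z < \<theta> * norm (fst z) powr l \<Longrightarrow> c * norm (fst z) powr q < pot_super p a z"
proof -
  define r where "r = norm (fst z)"
  define K where "K = real CARD('n) * pot_flux p a"
  have r: "0 \<le> r" "r \<le> \<delta>" using assms by (auto simp: r_def)
  have KE: "K * \<theta> * \<delta> powr (l - q) = E / p" using flux_a by (simp add: K_def)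
  have K: "K > 0"
  proof -
    have "pot_flux p a > 0" unfolding pot_flux_def using a p by simp
    then show ?thesis by (simp add: K_def)
  qed
  have "r powr l = r powr q * r powr (l - q)" by (simp add: powr_add[symmetric])
  also have "\<dots> \<le> r powr q * \<delta> powr (l - q)"
    using r l by (intro mult_left_mono powr_mono2) (auto simp: q_def)
  finally have rl: "r powr l \<le> r powr q * \<delta> powr (l - q)" .
  have "K * (\<theta> * r powr l) \<le> K * (\<theta> * (r powr q * \<delta> powr (l - q)))"
    by (intro mult_left_mono rl) (use K \<theta> in auto)
  also have "\<dots> = (K * \<theta> * \<delta> powr (l - q)) * r powr q" by (simp only: mult_ac)
  also have "\<dots> = E / p * r powr q" unfolding KE ..
  finally have *: "K * (\<theta> * r powr l) \<le> E / p * r powr q" .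
  have ac: "a - E / p = c" using p by (simp add: a_def c_def field_simps)
  have ps: "pot_super p a z = a * r powr q + K * snd z" by (simp add: pot_super_def r_def K_def q_def)
  have ineq: "c * r powr q \<le> a * r powr q - K * (\<theta> * r powr l)"
    using * unfolding ac[symmetric] by (simp add: left_diff_distrib)
  have "K * (- snd z) \<le> K * (\<theta> * r powr l)" using assms(1) K by (intro mult_left_mono) (auto simp: r_def)
  then show "c * norm (fst z) powr q \<le> pot_super p a z" unfolding ps using ineq by (simp add: r_def)
  assume "- snd z < \<theta> * norm (fst z) powr l"
  then have "K * (- snd z) < K * (\<theta> * r powr l)" using K by (intro mult_strict_left_mono) (auto simp: r_def)
  then show "c * norm (fst z) powr q < pot_super p a z" unfolding ps using ineq by (simp add: r_def)
qed

lemma \<Theta>D: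
  assumes "z \<in> \<Theta>"
  shows "snd z < 0" "- snd z < \<theta> * norm (fst z) powr l" "norm (fst z) < 1" "- \<theta> \<le> snd z" "0 < norm (fst z)"
proof -
  have z: "0 < - snd z" "- snd z < \<theta> * norm (fst z) powr l" "\<theta> * norm (fst z) powr l < \<theta>"
    using assms by (auto simp: \<Theta> Theta_dom_iff)
  then show "snd z < 0" "- snd z < \<theta> * norm (fst z) powr l" "- \<theta> \<le> snd z" by auto
  have lt1: "norm (fst z) powr l < 1" using z(3) \<theta> by simp
  show "norm (fst z) < 1"
  proof (rule ccontr)
    assume "\<not> norm (fst z) < 1"
    then have "1 \<le> norm (fst z) powr l" using l0 by (intro ge_one_powr_ge_zero) auto
    then show False using lt1 by simp
  qed
  show "0 < norm (fst z)" using z(1,2) l0 by (cases "fst z = 0") auto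
qed

lemma open_\<Theta>: "open \<Theta>"
proof -
  have "\<Theta> = {z. 0 < - snd z} \<inter> {z. - snd z < \<theta> * norm (fst z) powr l} \<inter> {z. \<theta> * norm (fst z) powr l < \<theta>}"
    by (auto simp: \<Theta> Theta_dom_iff)
  then show ?thesis
    by (simp only:) (intro open_Int open_Collect_less continuous_on_mult continuous_norm_fst_powr l0 continuous_intros)
qed

lemma bounded_\<Theta>: "bounded \<Theta>"
proof -
  have "\<Theta> \<subseteq> cball 0 1 \<times> {- \<theta>..0}"
  proof
    fix z assume "z \<in> \<Theta>"
    then show "z \<in> cball 0 1 \<times> {- \<theta>..0}" using \<Theta>D[of z] by (cases z) auto
  qed
  then show ?thesis using bounded_subset[OF bounded_Times[OF bounded_cball bounded_closed_interval]] by metis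
qed

lemma closure_\<Theta>D:
  assumes "z \<in> closure \<Theta>"
  shows "snd z \<le> 0" "- snd z \<le> \<theta> * norm (fst z) powr l"
proof -
  have "closed ({z :: (real ^ 'n) \<times> real. snd z \<le> 0} \<inter> {z. - snd z \<le> \<theta> * norm (fst z) powr l})"
    by (intro closed_Int closed_Collect_le continuous_on_mult continuous_norm_fst_powr l0 continuous_intros)
  then have "closure \<Theta> \<subseteq> {z. snd z \<le> 0} \<inter> {z. - snd z \<le> \<theta> * norm (fst z) powr l}"
    by (rule closure_minimal[rotated]) (auto dest: \<Theta>D(1,2) intro: less_imp_le)
  then show "snd z \<le> 0" "- snd z \<le> \<theta> * norm (fst z) powr l" using assms by auto
qed

lemma frontier_\<Theta>: "frontier \<Theta> = closure \<Theta> - \<Theta>"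
  by (simp only: frontier_def interior_open[OF open_\<Theta>])

lemma zero_in_frontier: "(0, 0) \<in> frontier \<Theta>"
proof -
  define e :: "real ^ 'n" where "e = axis undefined 1"
  have ne: "norm e = 1" by (simp add: e_def norm_axis_1)
  \<comment> \<open>The shift by two gives \<open>s n < 1\<close>, as the domain requires. The times
    are then taken halfway between t = 0 and the lower surface.\<close>
  define s where "s n = 1 / real (Suc (Suc n))" for n
  have s: "0 < s n" "s n < 1" for n by (auto simp: s_def)
  have slim: "s \<longlonglongrightarrow> 0" unfolding s_def by (intro LIMSEQ_Suc lim_1_over_n)
  define zs where "zs n = (s n *\<^sub>R e, - (\<theta> * s n powr l / 2))" for n
  have "zs n \<in> \<Theta>" for n
  proof -
    have "s n powr l < 1" using s[of n] l0 powr_less_mono2[of l "s n" 1] by simp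
    moreover have "0 < s n powr l" using s[of n] by simp
    ultimately show ?thesis using s[of n] \<theta> by (simp add: \<Theta> Theta_dom_iff zs_def ne)
  qed
  moreover have "zs \<longlonglongrightarrow> (0, 0)"
  proof -
    have "(\<lambda>n. s n powr l) \<longlonglongrightarrow> 0 powr l"
      using slim l0 s by (intro tendsto_powr') (auto intro!: always_eventually less_imp_le)
    then have "(\<lambda>n. - (\<theta> * s n powr l / 2)) \<longlonglongrightarrow> - (\<theta> * 0 / 2)"
      by (intro tendsto_intros) simp_all
    moreover have "(\<lambda>n. s n *\<^sub>R e) \<longlonglongrightarrow> 0 *\<^sub>R e" by (intro tendsto_intros slim)
    ultimately have "(\<lambda>n. (s n *\<^sub>R e, - (\<theta> * s n powr l / 2))) \<longlonglongrightarrow> (0 *\<^sub>R e, - (\<theta> * 0 / 2))"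
      by (intro tendsto_Pair)
    then show ?thesis by (simp add: zs_def[abs_def])
  qed
  ultimately have "(0, 0) \<in> closure \<Theta>" unfolding closure_sequential by blast
  moreover have "(0, 0) \<notin> \<Theta>" by (simp add: \<Theta> Theta_dom_iff)
  ultimately show ?thesis by (simp add: frontier_\<Theta>)
qed

lemma M_le: "M z \<le> c * \<delta> powr q"
  unfolding M_def using c q \<delta> by (intro mult_left_mono powr_mono2) auto

lemma M_nonneg: "0 \<le> M z"
  unfolding M_def using c by simp

lemma continuous_M: "continuous_on S M"
  unfolding M_def[abs_def]
  by (intro continuous_on_mult continuous_on_powr' continuous_on_min continuous_intros) (use q \<delta> in auto)

lemma M_le_u:
  assumes "z \<in> \<Theta>"
  shows "M z \<le> u z"
proof (cases "norm (fst z) < \<delta>")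
  case True
  have "c * norm (fst z) powr q \<le> pot_super p a z"
    using pot_super_ge(1)[of z] \<Theta>D(2)[OF assms] True by simp
  then show ?thesis using True M_le[of z] by (simp add: u_def trunc_super_def M_def)
next
  case False
  then show ?thesis using M_le[of z] by (simp add: u_def trunc_super_def)
qed

lemma sphere_gt:
  assumes "z \<in> \<Theta>" "norm (fst z) = \<delta>"
  shows "c * \<delta> powr q < pot_super p a z"
  using pot_super_ge(2)[of z] \<Theta>D(2)[OF assms(1)] assms(2) by simp

lemma u_superparabolic: "p_superparabolic p \<Theta> (\<lambda>z. ereal (b + u z))"
  unfolding u_def using p a sphere_gt by (intro superparabolic_trunc_super) auto

lemma Liminf_ge_continuous:
  assumes g: "continuous_on UNIV g" and le: "\<And>z. z \<in> \<Theta> \<Longrightarrow> g z \<le> w z"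
  shows "ereal (g \<xi>) \<le> Liminf (at \<xi> within \<Theta>) (\<lambda>z. ereal (w z))"
  unfolding le_Liminf_iff
proof (intro allI impI)
  fix y assume y: "y < ereal (g \<xi>)"
  have "(g \<longlongrightarrow> g \<xi>) (at \<xi> within \<Theta>)"
    by (rule continuous_UNIV_tendsto[OF g])
  from order_tendstoD(1)[OF tendsto_ereal[OF this] y]
  have "\<forall>\<^sub>F x in at \<xi> within \<Theta>. y < ereal (g x)" .
  moreover have "\<forall>\<^sub>F x in at \<xi> within \<Theta>. x \<in> \<Theta>" by (simp add: eventually_at_filter)
  ultimately show "\<forall>\<^sub>F x in at \<xi> within \<Theta>. y < ereal (w x)"
  proof eventually_elim
    case (elim x)
    then show ?case using le[of x] by (meson ereal_less_eq(3) less_le_trans)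
  qed
qed

text \<open>In |x| < \<delta>, b - u is the maximum of b - k and b - \<open>pot_super\<close>, so v
  is compared with each in turn. The constant goes first, on all of the domain. Its result provides
  the boundary inequality on the part of |x| = \<delta> inside the domain when b -
  \<open>pot_super\<close> is treated in |x| < \<delta>; on the frontier of the domain
  \<open>M\<close> is below \<open>pot_super\<close>.\<close>

lemma superparabolic_ge_minus_u:
  assumes v: "p_superparabolic p \<Theta> v"
    and bd: "\<And>\<xi>. \<xi> \<in> frontier \<Theta> \<Longrightarrow> ereal (b - M \<xi>) \<le> Liminf (at \<xi> within \<Theta>) v"
    and z: "z \<in> \<Theta>"
  shows "ereal (b - u z) \<le> v z"
proof -
  have p1: "p > 1" using p by simp
  define k where "k = c * \<delta> powr q"
  have p0: "pot_super p 0 z = 0" for z :: "(real ^ 'n) \<times> real" by (simp add: pot_super_def pot_flux_def)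
  have 1: "ereal (b - k) \<le> v z" if z: "z \<in> \<Theta>" for z
  proof -
    have "ereal ((b - k) - pot_super p 0 z) \<le> v z"
    proof (rule superparabolic_ge_potential[OF p1 order_refl v open_\<Theta> subset_refl bounded_\<Theta> \<Theta>D(4) _ z])
      fix \<xi> assume "\<xi> \<in> closure \<Theta> - \<Theta>"
      then have "ereal (b - M \<xi>) \<le> Liminf (at \<xi> within \<Theta>) v" by (intro bd) (simp add: frontier_\<Theta>)
      moreover have "b - k - pot_super p 0 \<xi> \<le> b - M \<xi>" using M_le[of \<xi>] by (simp add: p0 k_def)
      ultimately show "ereal (b - k - pot_super p 0 \<xi>) \<le> Liminf (at \<xi> within \<Theta>) v"
        by (meson ereal_less_eq(3) order_trans)
    qed
    then show ?thesis by (simp add: p0)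
  qed
  have 2: "ereal (b - pot_super p a z) \<le> v z" if z: "z \<in> \<Theta>" "norm (fst z) < \<delta>" for z
  proof -
    let ?D = "\<Theta> \<inter> {z. norm (fst z) < \<delta>}"
    have sub: "?D \<subseteq> \<Theta>" by blast
    have oD: "open ?D" by (intro open_Int open_\<Theta> open_Collect_less continuous_intros)
    have bD: "bounded ?D" using bounded_\<Theta> sub by (rule bounded_subset)
    have TD: "- \<theta> \<le> snd z" if "z \<in> ?D" for z using \<Theta>D(4) that by blast
    have zD: "z \<in> ?D" using z by blast
    have a0: "a \<ge> 0" using a by simp
    show ?thesis
    proof (rule superparabolic_ge_potential[OF p1 a0 v oD sub bD TD _ zD])
      fix \<xi> assume \<xi>: "\<xi> \<in> closure ?D - ?D"
      have "closed {z :: (real ^ 'n) \<times> real. norm (fst z) \<le> \<delta>}" by (intro closed_Collect_le continuous_intros)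
      then have "closure ?D \<subseteq> {z. norm (fst z) \<le> \<delta>}" by (intro closure_minimal) auto
      then have x\<delta>: "norm (fst \<xi>) \<le> \<delta>" using \<xi> by blast
      have cl: "\<xi> \<in> closure \<Theta>" using \<xi> closure_mono[OF sub] by blast
      have ps: "c * norm (fst \<xi>) powr q \<le> pot_super p a \<xi>"
        by (rule pot_super_ge(1)[OF closure_\<Theta>D(2)[OF cl] x\<delta>])
      have Mx: "M \<xi> = c * norm (fst \<xi>) powr q" using x\<delta> by (simp add: M_def min_absorb1)
      show "ereal (b - pot_super p a \<xi>) \<le> Liminf (at \<xi> within ?D) v"
      proof (cases "\<xi> \<in> \<Theta>")
        case True
        then have "norm (fst \<xi>) = \<delta>" using \<xi> x\<delta> by auto
        then have "b - pot_super p a \<xi> \<le> b - k" using ps by (simp add: k_def)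
        then have le: "ereal (b - pot_super p a \<xi>) \<le> ereal (b - k)" by simp
        have "\<forall>\<^sub>F x in at \<xi> within ?D. ereal (b - k) \<le> v x"
          using 1 by (simp add: eventually_at_filter)
        from order_trans[OF le Liminf_bounded[OF this]] show ?thesis .
      next
        case False
        then have "\<xi> \<in> frontier \<Theta>" using cl by (simp add: frontier_\<Theta>)
        have "ereal (b - pot_super p a \<xi>) \<le> ereal (b - M \<xi>)" using ps Mx by simp
        also have "\<dots> \<le> Liminf (at \<xi> within \<Theta>) v" by (rule bd) fact
        also have "\<dots> \<le> Liminf (at \<xi> within ?D) v"
        proof -
          have "\<forall>y < Liminf (at \<xi> within \<Theta>) v. \<forall>\<^sub>F x in at \<xi> within \<Theta>. y < v x"
            using le_Liminf_iff[of "Liminf (at \<xi> within \<Theta>) v" "at \<xi> within \<Theta>" v] by simp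
          then show ?thesis
            unfolding le_Liminf_iff using filter_leD[OF at_le[OF sub]] by blast
        qed
        finally show ?thesis .
      qed
    qed
  qed
  show ?thesis
    using 1[OF z] 2[OF z] by (auto simp: u_def trunc_super_def k_def min_def)
qed

section \<open>Bounds for the Perron solutions and the barrier\<close>

lemma u_tendsto: "((\<lambda>z. u z) \<longlongrightarrow> 0) (at (0, 0) within \<Theta>)"
proof (rule tendsto_sandwich[where f="\<lambda>_. 0" and h="pot_super p a"])
  have ev: "\<forall>\<^sub>F x in at (0, 0) within \<Theta>. x \<in> \<Theta>" by (simp add: eventually_at_filter)
  then show "\<forall>\<^sub>F z in at (0, 0) within \<Theta>. 0 \<le> u z"
    by eventually_elim (use M_le_u M_nonneg order_trans in blast)
  have "\<forall>\<^sub>F z :: (real ^ 'n) \<times> real in at (0, 0) within \<Theta>. norm (fst z) < \<delta>"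
  proof -
    have "((\<lambda>z :: (real ^ 'n) \<times> real. norm (fst z)) \<longlongrightarrow> norm (fst ((0, 0) :: (real ^ 'n) \<times> real))) (at (0, 0) within \<Theta>)"
      by (intro tendsto_intros)
    from order_tendstoD(2)[OF this, of \<delta>] \<delta>(1) show ?thesis by simp
  qed
  then show "\<forall>\<^sub>F z in at (0, 0) within \<Theta>. u z \<le> pot_super p a z"
    by eventually_elim (simp add: u_def trunc_super_def)
  have "continuous_on UNIV (pot_super p a :: (real ^ 'n) \<times> real \<Rightarrow> real)" using p by (intro continuous_pot_super) simp
  then have "(pot_super p a \<longlongrightarrow> pot_super p a ((0, 0) :: (real ^ 'n) \<times> real)) (at (0, 0) within \<Theta>)"
    by (rule continuous_UNIV_tendsto)
  then show "(pot_super p a \<longlongrightarrow> 0) (at ((0, 0) :: (real ^ 'n) \<times> real) within \<Theta>)" by (simp add: pot_super_def)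
qed simp

context
  fixes f :: "(real ^ 'n) \<times> real \<Rightarrow> real"
  assumes f: "\<And>\<xi>. \<xi> \<in> frontier \<Theta> \<Longrightarrow> \<bar>f \<xi> - f (0, 0)\<bar> \<le> M \<xi>"
begin

lemma upper_class_u: "(\<lambda>z. ereal (f (0, 0) + u z)) \<in> upper_class p \<Theta> f"
  unfolding upper_class_def
proof (intro CollectI conjI ballI u_superparabolic)
  fix \<xi> assume "\<xi> \<in> frontier \<Theta>"
  then have "f \<xi> \<le> f (0, 0) + M \<xi>" using f[of \<xi>] by linarith
  then have "ereal (f \<xi>) \<le> ereal (f (0, 0) + M \<xi>)" by simp
  also have "\<dots> \<le> Liminf (at \<xi> within \<Theta>) (\<lambda>z. ereal (f (0, 0) + u z))"
    by (rule Liminf_ge_continuous) (intro continuous_on_add continuous_on_const continuous_M, simp add: M_le_u)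
  finally show "ereal (f \<xi>) \<le> Liminf (at \<xi> within \<Theta>) (\<lambda>z. ereal (f (0, 0) + u z))" .
qed

lemma lower_class_u: "(\<lambda>z. ereal (f (0, 0) - u z)) \<in> lower_class p \<Theta> f"
  unfolding lower_class_def
proof (intro CollectI conjI ballI)
  have eq: "(\<lambda>z. - ereal (f (0, 0) - u z)) = (\<lambda>z. ereal (- f (0, 0) + u z))" by (rule ext) simp
  show "p_subparabolic p \<Theta> (\<lambda>z. ereal (f (0, 0) - u z))"
    unfolding p_subparabolic_def eq by (rule u_superparabolic)
  fix \<xi> assume "\<xi> \<in> frontier \<Theta>"
  then have "- f \<xi> \<le> - f (0, 0) + M \<xi>" using f[of \<xi>] by linarith
  then have "ereal (- f \<xi>) \<le> ereal (- f (0, 0) + M \<xi>)" by simp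
  also have "\<dots> \<le> Liminf (at \<xi> within \<Theta>) (\<lambda>z. ereal (- f (0, 0) + u z))"
    by (rule Liminf_ge_continuous) (intro continuous_on_add continuous_on_const continuous_M, simp add: M_le_u)
  also have "\<dots> = - Limsup (at \<xi> within \<Theta>) (\<lambda>z. ereal (f (0, 0) - u z))"
    unfolding eq[symmetric] by (rule ereal_Liminf_uminus)
  finally show "Limsup (at \<xi> within \<Theta>) (\<lambda>z. ereal (f (0, 0) - u z)) \<le> ereal (f \<xi>)"
    using ereal_minus_le_minus[of "ereal (f \<xi>)"] by simp
qed

text \<open>The bound from above needs one member of the class, f(0,0) + u. The bound from below
  must hold for all members, which is the content of
  \<open>superparabolic_ge_minus_u\<close>.\<close>

lemma upper_Perron_bounds:
  assumes z: "z \<in> \<Theta>"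
  shows "ereal (f (0, 0) - u z) \<le> upper_Perron p \<Theta> f z" "upper_Perron p \<Theta> f z \<le> ereal (f (0, 0) + u z)"
proof -
  show "upper_Perron p \<Theta> f z \<le> ereal (f (0, 0) + u z)"
    unfolding upper_Perron_def by (rule INF_lower2[OF upper_class_u]) simp
  show "ereal (f (0, 0) - u z) \<le> upper_Perron p \<Theta> f z"
    unfolding upper_Perron_def
  proof (rule INF_greatest)
    fix v assume v: "v \<in> upper_class p \<Theta> f"
    show "ereal (f (0, 0) - u z) \<le> v z"
    proof (rule superparabolic_ge_minus_u[OF _ _ z])
      show "p_superparabolic p \<Theta> v" using v by (simp add: upper_class_def)
      fix \<xi> assume \<xi>: "\<xi> \<in> frontier \<Theta>"
      then have "f (0, 0) - M \<xi> \<le> f \<xi>" using f[of \<xi>] by linarith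
      then have "ereal (f (0, 0) - M \<xi>) \<le> ereal (f \<xi>)" by simp
      also have "\<dots> \<le> Liminf (at \<xi> within \<Theta>) v" using v \<xi> by (simp add: upper_class_def)
      finally show "ereal (f (0, 0) - M \<xi>) \<le> Liminf (at \<xi> within \<Theta>) v" .
    qed
  qed
qed

text \<open>The roles are exchanged: -v is superparabolic for v in the lower class and is compared
  with the data -f, which satisfy the same smallness bound.\<close>

lemma lower_Perron_bounds:
  assumes z: "z \<in> \<Theta>"
  shows "ereal (f (0, 0) - u z) \<le> lower_Perron p \<Theta> f z" "lower_Perron p \<Theta> f z \<le> ereal (f (0, 0) + u z)"
proof -
  show "ereal (f (0, 0) - u z) \<le> lower_Perron p \<Theta> f z"
    unfolding lower_Perron_def by (rule SUP_upper2[OF lower_class_u]) simp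
  show "lower_Perron p \<Theta> f z \<le> ereal (f (0, 0) + u z)"
    unfolding lower_Perron_def
  proof (rule SUP_least)
    fix v assume v: "v \<in> lower_class p \<Theta> f"
    have "ereal (- f (0, 0) - u z) \<le> - v z"
    proof (rule superparabolic_ge_minus_u[OF _ _ z])
      show "p_superparabolic p \<Theta> (\<lambda>z. - v z)" using v by (simp add: lower_class_def p_subparabolic_def)
      fix \<xi> assume \<xi>: "\<xi> \<in> frontier \<Theta>"
      then have "- f (0, 0) - M \<xi> \<le> - f \<xi>" using f[of \<xi>] by linarith
      then have "ereal (- f (0, 0) - M \<xi>) \<le> - ereal (f \<xi>)" by simp
      also have "\<dots> \<le> - Limsup (at \<xi> within \<Theta>) v"
        using v \<xi> unfolding lower_class_def by (intro ereal_minus_le_minus[THEN iffD2]) blast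
      also have "\<dots> = Liminf (at \<xi> within \<Theta>) (\<lambda>z. - v z)" by (rule ereal_Liminf_uminus[symmetric])
      finally show "ereal (- f (0, 0) - M \<xi>) \<le> Liminf (at \<xi> within \<Theta>) (\<lambda>z. - v z)" .
    qed
    then show "v z \<le> ereal (f (0, 0) + u z)" by (cases "v z") auto
  qed
qed

lemma Perron_tendsto:
  "(lower_Perron p \<Theta> f \<longlongrightarrow> ereal (f (0, 0))) (at (0, 0) within \<Theta>)"
  "(upper_Perron p \<Theta> f \<longlongrightarrow> ereal (f (0, 0))) (at (0, 0) within \<Theta>)"
proof -
  have ev: "\<forall>\<^sub>F x in at (0, 0) within \<Theta>. x \<in> \<Theta>" by (simp add: eventually_at_filter)
  have "((\<lambda>z. f (0, 0) - u z) \<longlongrightarrow> f (0, 0) - 0) (at (0, 0) within \<Theta>)"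
    "((\<lambda>z. f (0, 0) + u z) \<longlongrightarrow> f (0, 0) + 0) (at (0, 0) within \<Theta>)"
    by (intro tendsto_intros u_tendsto)+
  then have lo: "((\<lambda>z. ereal (f (0, 0) - u z)) \<longlongrightarrow> ereal (f (0, 0))) (at (0, 0) within \<Theta>)"
    and hi: "((\<lambda>z. ereal (f (0, 0) + u z)) \<longlongrightarrow> ereal (f (0, 0))) (at (0, 0) within \<Theta>)"
    by (simp_all add: tendsto_ereal)
  show "(lower_Perron p \<Theta> f \<longlongrightarrow> ereal (f (0, 0))) (at (0, 0) within \<Theta>)"
    by (rule tendsto_sandwich[OF eventually_mono[OF ev lower_Perron_bounds(1)] eventually_mono[OF ev lower_Perron_bounds(2)] lo hi])
  show "(upper_Perron p \<Theta> f \<longlongrightarrow> ereal (f (0, 0))) (at (0, 0) within \<Theta>)"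
    by (rule tendsto_sandwich[OF eventually_mono[OF ev upper_Perron_bounds(1)] eventually_mono[OF ev upper_Perron_bounds(2)] lo hi])
qed

end

lemma is_barrier_u: "is_barrier p \<Theta> (0, 0) (\<lambda>z. ereal (u z))"
  unfolding is_barrier_def
proof (intro conjI ballI zero_in_frontier)
  show "p_superparabolic p \<Theta> (\<lambda>z. ereal (u z))" using u_superparabolic[of 0] by simp
  have Mpos: "0 < M z" if "fst z \<noteq> 0" for z using that c \<delta> by (simp add: M_def min_def)
  show "0 < ereal (u z)" if "z \<in> \<Theta>" for z
  proof -
    have "0 < M z" using \<Theta>D(5)[OF that] by (intro Mpos) auto
    then show ?thesis using M_le_u[OF that] by simp
  qed
  show "((\<lambda>z. ereal (u z)) \<longlongrightarrow> 0) (at (0, 0) within \<Theta>)"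
    using tendsto_ereal[OF u_tendsto] by (simp add: zero_ereal_def)
  fix \<xi> assume \<xi>: "\<xi> \<in> frontier \<Theta> - {(0, 0)}"
  then have "\<xi> \<in> closure \<Theta>" by (simp add: frontier_\<Theta>)
  note cl = closure_\<Theta>D[OF this]
  \<comment> \<open>In the closure of the domain -t is between 0 and \<theta> |x|^l, so the axis x =
    0 meets it only at the origin.\<close>
  have "fst \<xi> \<noteq> 0"
  proof
    assume 0: "fst \<xi> = 0"
    then have "snd \<xi> = 0" using cl l0 by simp
    then have "\<xi> = (0, 0)" using 0 by (cases \<xi>) simp
    then show False using \<xi> by simp
  qed
  then have "0 < ereal (M \<xi>)" using Mpos by simp
  also have "\<dots> \<le> Liminf (at \<xi> within \<Theta>) (\<lambda>z. ereal (u z))"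
    by (rule Liminf_ge_continuous[OF continuous_M M_le_u])
  finally show "0 < Liminf (at \<xi> within \<Theta>) (\<lambda>z. ereal (u z))" .
qed

end

theorem proposition1p6:
  fixes p l \<theta> :: real
    and \<Theta> :: "((real ^ 'n) \<times> real) set"
  assumes "p > 2" and "l \<ge> p / (p - 1)" and "\<theta> > 0"
    and "\<Theta> = Theta_dom l \<theta>"
  shows "(\<forall>\<delta> f. 0 < \<delta> \<and> \<delta> \<le> 1 \<and>
            (\<forall>(x, t)\<in>frontier \<Theta>.
               \<bar>f (x, t) - f (0, 0)\<bar>
                 \<le> (p - 2) / p
                   * (\<delta> powr (p / (p - 1) - l) / (real CARD('n) * p * \<theta>)) powr (1 / (p - 2))
                   * min (norm x) \<delta> powr (p / (p - 1)))
          \<longrightarrow> (lower_Perron p \<Theta> f \<longlongrightarrow> ereal (f (0, 0))) (at (0, 0) within \<Theta>) \<and>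
              (upper_Perron p \<Theta> f \<longlongrightarrow> ereal (f (0, 0))) (at (0, 0) within \<Theta>))
       \<and> (\<exists>w. is_barrier p \<Theta> (0, 0) w)"
proof (intro conjI allI impI; (elim conjE)?)
  fix \<delta> :: real and f :: "(real ^ 'n) \<times> real \<Rightarrow> real"
  assume \<delta>: "0 < \<delta>" "\<delta> \<le> 1" and f: "\<forall>(x, t)\<in>frontier \<Theta>. \<bar>f (x, t) - f (0, 0)\<bar>
                 \<le> (p - 2) / p
                   * (\<delta> powr (p / (p - 1) - l) / (real CARD('n) * p * \<theta>)) powr (1 / (p - 2))
                   * min (norm x) \<delta> powr (p / (p - 1))"
  interpret cusp p l \<theta> \<delta> \<Theta> using assms \<delta> by unfold_locales
  have *: "\<bar>f \<xi> - f (0, 0)\<bar> \<le> M \<xi>" if "\<xi> \<in> frontier \<Theta>" for \<xi>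
    using bspec[OF f that] by (cases \<xi>) (simp add: M_def c_def E_def q_def)
  show "(lower_Perron p \<Theta> f \<longlongrightarrow> ereal (f (0, 0))) (at (0, 0) within \<Theta>)"
    by (rule Perron_tendsto(1)) (rule *)
  show "(upper_Perron p \<Theta> f \<longlongrightarrow> ereal (f (0, 0))) (at (0, 0) within \<Theta>)"
    by (rule Perron_tendsto(2)) (rule *)
next
  \<comment> \<open>The barrier does not involve boundary data, so any admissible \<delta> can be
    fixed.\<close>
  interpret cusp p l \<theta> 1 \<Theta> using assms by unfold_locales auto
  show "\<exists>w. is_barrier p \<Theta> (0, 0) w" using is_barrier_u by blast
qed

end
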